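(* Let $X$ be a locally path-connected and semilocally simply connected topological space. For every unital algebra $B$, parallel transport defines an equivalence of groupoids $$\operatorname{Mon}_B:\mathrm{LCS}(X,B)\xrightarrow{\sim}\mathrm{Fun}(\Pi_1(X),\mathrm{Proj}(B)^{\simeq}).$$ A quasi-inverse sends $F$ to the sheaf of path-compatible families; on a path-connected open set $U$ whose loops are null-homotopic in $X$, evaluation at any base point identifies its sections with the corresponding value of $F$.
   Context: Algebras are associative and unital over a field of characteristic zero. $\Pi_1(X)$ is the fundamental groupoid. $\mathrm{Proj}(B)^{\simeq}$ is the core groupoid of finitely generated projective left $B$-modules. $\mathrm{LCS}(X,B)$ is the groupoid (morphisms: isomorphisms) of locally constant sheaves of left modules over the constant sheaf $\underline B$ whose stalks are finitely generated projective. $\mathrm{Fun}(\Pi_1(X),\mathrm{Proj}(B)^{\simeq})$ is the groupoid of functors and natural isomorphisms. $\operatorname{Mon}_B(\mathcal E)$ sends $x$ to the stalk $\mathcal E_x$ and a path class to parallel transport (the composite of the constant identifications along a chain of trivialising open sets). For a functor $F:\Pi_1(X)\to\mathrm{Proj}(B)^{\simeq}$, the sheaf $\mathcal E_F$ of path-compatible families has sections over $U$ the families $(s_x)_{x\in U}$, $s_x\in F(x)$, with $F([\gamma])(s_x)=s_y$ for every path $\gamma$ in $U$ from $x$ to $y$. *)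

theory Defs
  imports "HOL-Analysis.Analysis" "HOL-Algebra.Module"
begin

section \<open>Categories, groupoids, functors\<close>

text \<open>Hom-sets are not required to be disjoint, so composition and the action of a functor on
  morphisms take the objects as arguments. \<open>Comp C x y z g f\<close> is \<open>g\<close> after \<open>f\<close>.\<close>

record ('o, 'f) category =
  Ob :: "'o set"
  Hom :: "'o \<Rightarrow> 'o \<Rightarrow> 'f set"
  Ident :: "'o \<Rightarrow> 'f"
  Comp :: "'o \<Rightarrow> 'o \<Rightarrow> 'o \<Rightarrow> 'f \<Rightarrow> 'f \<Rightarrow> 'f"

definition is_category :: "('o, 'f) category \<Rightarrow> bool" where
  "is_category C \<longleftrightarrow>
    (\<forall>x\<in>Ob C. Ident C x \<in> Hom C x x) \<and>
    (\<forall>x\<in>Ob C. \<forall>y\<in>Ob C. \<forall>z\<in>Ob C. \<forall>f\<in>Hom C x y. \<forall>g\<in>Hom C y z. Comp C x y z g f \<in> Hom C x z) \<and>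
    (\<forall>x\<in>Ob C. \<forall>y\<in>Ob C. \<forall>f\<in>Hom C x y.
        Comp C x x y f (Ident C x) = f \<and> Comp C x y y (Ident C y) f = f) \<and>
    (\<forall>w\<in>Ob C. \<forall>x\<in>Ob C. \<forall>y\<in>Ob C. \<forall>z\<in>Ob C. \<forall>f\<in>Hom C w x. \<forall>g\<in>Hom C x y. \<forall>h\<in>Hom C y z.
        Comp C w y z h (Comp C w x y g f) = Comp C w x z (Comp C x y z h g) f)"

definition is_iso :: "('o, 'f) category \<Rightarrow> 'o \<Rightarrow> 'o \<Rightarrow> 'f \<Rightarrow> bool" where
  "is_iso C x y f \<longleftrightarrow> f \<in> Hom C x y \<and>
    (\<exists>g\<in>Hom C y x. Comp C x y x g f = Ident C x \<and> Comp C y x y f g = Ident C y)"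

definition is_groupoid :: "('o, 'f) category \<Rightarrow> bool" where
  "is_groupoid C \<longleftrightarrow> is_category C \<and> (\<forall>x\<in>Ob C. \<forall>y\<in>Ob C. \<forall>f\<in>Hom C x y. is_iso C x y f)"

definition core :: "('o, 'f) category \<Rightarrow> ('o, 'f) category" where
  "core C = C\<lparr>Hom := (\<lambda>x y. {f. is_iso C x y f})\<rparr>"

record ('o, 'f, 'p, 'g) cfunctor =
  on_ob :: "'o \<Rightarrow> 'p"
  on_hom :: "'o \<Rightarrow> 'o \<Rightarrow> 'f \<Rightarrow> 'g"

definition is_functor ::
    "('o, 'f) category \<Rightarrow> ('p, 'g) category \<Rightarrow> ('o, 'f, 'p, 'g) cfunctor \<Rightarrow> bool" where
  "is_functor C D F \<longleftrightarrow>
    (\<forall>x\<in>Ob C. on_ob F x \<in> Ob D) \<and>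
    (\<forall>x\<in>Ob C. \<forall>y\<in>Ob C. \<forall>f\<in>Hom C x y. on_hom F x y f \<in> Hom D (on_ob F x) (on_ob F y)) \<and>
    (\<forall>x\<in>Ob C. on_hom F x x (Ident C x) = Ident D (on_ob F x)) \<and>
    (\<forall>x\<in>Ob C. \<forall>y\<in>Ob C. \<forall>z\<in>Ob C. \<forall>f\<in>Hom C x y. \<forall>g\<in>Hom C y z.
        on_hom F x z (Comp C x y z g f) =
        Comp D (on_ob F x) (on_ob F y) (on_ob F z) (on_hom F y z g) (on_hom F x y f))"

definition id_functor :: "('o, 'f, 'o, 'f) cfunctor" where
  "id_functor = \<lparr>on_ob = (\<lambda>x. x), on_hom = (\<lambda>_ _ f. f)\<rparr>"

definition comp_functor ::
    "('p, 'g, 'q, 'h) cfunctor \<Rightarrow> ('o, 'f, 'p, 'g) cfunctor \<Rightarrow> ('o, 'f, 'q, 'h) cfunctor" where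
  "comp_functor G F = \<lparr>on_ob = (\<lambda>x. on_ob G (on_ob F x)),
     on_hom = (\<lambda>x y f. on_hom G (on_ob F x) (on_ob F y) (on_hom F x y f))\<rparr>"

definition is_nat_iso :: "('o, 'f) category \<Rightarrow> ('p, 'g) category \<Rightarrow>
    ('o, 'f, 'p, 'g) cfunctor \<Rightarrow> ('o, 'f, 'p, 'g) cfunctor \<Rightarrow> ('o \<Rightarrow> 'g) \<Rightarrow> bool" where
  "is_nat_iso C D F G \<eta> \<longleftrightarrow>
    \<eta> \<in> extensional (Ob C) \<and>
    (\<forall>x\<in>Ob C. is_iso D (on_ob F x) (on_ob G x) (\<eta> x)) \<and>
    (\<forall>x\<in>Ob C. \<forall>y\<in>Ob C. \<forall>f\<in>Hom C x y.
        Comp D (on_ob F x) (on_ob F y) (on_ob G y) (\<eta> y) (on_hom F x y f) =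
        Comp D (on_ob F x) (on_ob G x) (on_ob G y) (on_hom G x y f) (\<eta> x))"

definition Fun_groupoid :: "('o, 'f) category \<Rightarrow> ('p, 'g) category \<Rightarrow>
    (('o, 'f, 'p, 'g) cfunctor, 'o \<Rightarrow> 'g) category" where
  "Fun_groupoid C D = \<lparr>Ob = {F. is_functor C D F},
     Hom = (\<lambda>F G. {\<eta>. is_nat_iso C D F G \<eta>}),
     Ident = (\<lambda>F. \<lambda>x\<in>Ob C. Ident D (on_ob F x)),
     Comp = (\<lambda>F G H \<theta> \<eta>. \<lambda>x\<in>Ob C. Comp D (on_ob F x) (on_ob G x) (on_ob H x) (\<theta> x) (\<eta> x))\<rparr>"

text \<open>\<open>F\<close> is an equivalence of groupoids with quasi-inverse \<open>G\<close>.\<close>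

definition groupoid_equivalence :: "('o, 'f) category \<Rightarrow> ('p, 'g) category \<Rightarrow>
    ('o, 'f, 'p, 'g) cfunctor \<Rightarrow> ('p, 'g, 'o, 'f) cfunctor \<Rightarrow> bool" where
  "groupoid_equivalence C D F G \<longleftrightarrow>
    is_groupoid C \<and> is_groupoid D \<and> is_functor C D F \<and> is_functor D C G \<and>
    (\<exists>\<eta>. is_nat_iso C C id_functor (comp_functor G F) \<eta>) \<and>
    (\<exists>\<epsilon>. is_nat_iso D D (comp_functor F G) id_functor \<epsilon>)"


section \<open>The fundamental groupoid\<close>

definition path_homotopic :: "'a topology \<Rightarrow> (real \<Rightarrow> 'a) \<Rightarrow> (real \<Rightarrow> 'a) \<Rightarrow> bool" where
  "path_homotopic X g h \<longleftrightarrow>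
    homotopic_with (\<lambda>r. r 0 = g 0 \<and> r 1 = g 1) (subtopology euclideanreal {0..1}) X g h"

definition path_class :: "'a topology \<Rightarrow> (real \<Rightarrow> 'a) \<Rightarrow> (real \<Rightarrow> 'a) set" where
  "path_class X g = {h. path_homotopic X g h}"

text \<open>The library's \<open>joinpaths\<close> is only available on types of class \<open>topological_space\<close>.\<close>

definition path_join :: "(real \<Rightarrow> 'a) \<Rightarrow> (real \<Rightarrow> 'a) \<Rightarrow> real \<Rightarrow> 'a" where
  "path_join g h = (\<lambda>t. if t \<le> 1/2 then g (2 * t) else h (2 * t - 1))"

definition fundamental_groupoid :: "'a topology \<Rightarrow> ('a, (real \<Rightarrow> 'a) set) category" where
  "fundamental_groupoid X = \<lparr>Ob = topspace X,
     Hom = (\<lambda>x y. {path_class X g |g. pathin X g \<and> g 0 = x \<and> g 1 = y}),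
     Ident = (\<lambda>x. path_class X (\<lambda>_. x)),
     Comp = (\<lambda>x y z d c. {h. \<exists>f\<in>c. \<exists>g\<in>d. path_homotopic X (path_join f g) h})\<rparr>"

definition loops_nullhomotopic_in :: "'a topology \<Rightarrow> 'a set \<Rightarrow> bool" where
  "loops_nullhomotopic_in X U \<longleftrightarrow>
    (\<forall>g. pathin (subtopology X U) g \<and> g 0 = g 1 \<longrightarrow> path_homotopic X g (\<lambda>_. g 0))"

definition semilocally_simply_connected :: "'a topology \<Rightarrow> bool" where
  "semilocally_simply_connected X \<longleftrightarrow>
    (\<forall>x\<in>topspace X. \<exists>U. openin X U \<and> x \<in> U \<and>
      (\<forall>g. pathin (subtopology X U) g \<and> g 0 = x \<and> g 1 = x \<longrightarrow> path_homotopic X g (\<lambda>_. x)))"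


section \<open>Algebras and modules\<close>

definition char_zero :: "('k, 'x) ring_scheme \<Rightarrow> bool" where
  "char_zero K \<longleftrightarrow> (\<forall>n::nat. n > 0 \<longrightarrow> [n] \<cdot>\<^bsub>K\<^esub> \<one>\<^bsub>K\<^esub> \<noteq> \<zero>\<^bsub>K\<^esub>)"

text \<open>The library's locales \<open>module\<close> and \<open>algebra\<close> require commutative rings; only their record
  type is reused here. In a record standing for a module, \<open>mult\<close> and \<open>one\<close> are meaningless.\<close>

locale unital_algebra = K?: field K + B?: ring B
  for K :: "('k, 'x) ring_scheme" and B :: "('k, 'b, 'y) module_scheme" +
  assumes scale_closed: "\<lbrakk>a \<in> carrier K; x \<in> carrier B\<rbrakk> \<Longrightarrow> a \<odot>\<^bsub>B\<^esub> x \<in> carrier B"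
    and scale_l_distr: "\<lbrakk>a \<in> carrier K; b \<in> carrier K; x \<in> carrier B\<rbrakk> \<Longrightarrow>
      (a \<oplus>\<^bsub>K\<^esub> b) \<odot>\<^bsub>B\<^esub> x = a \<odot>\<^bsub>B\<^esub> x \<oplus>\<^bsub>B\<^esub> b \<odot>\<^bsub>B\<^esub> x"
    and scale_r_distr: "\<lbrakk>a \<in> carrier K; x \<in> carrier B; y \<in> carrier B\<rbrakk> \<Longrightarrow>
      a \<odot>\<^bsub>B\<^esub> (x \<oplus>\<^bsub>B\<^esub> y) = a \<odot>\<^bsub>B\<^esub> x \<oplus>\<^bsub>B\<^esub> a \<odot>\<^bsub>B\<^esub> y"
    and scale_assoc: "\<lbrakk>a \<in> carrier K; b \<in> carrier K; x \<in> carrier B\<rbrakk> \<Longrightarrow>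
      (a \<otimes>\<^bsub>K\<^esub> b) \<odot>\<^bsub>B\<^esub> x = a \<odot>\<^bsub>B\<^esub> (b \<odot>\<^bsub>B\<^esub> x)"
    and scale_one: "x \<in> carrier B \<Longrightarrow> \<one>\<^bsub>K\<^esub> \<odot>\<^bsub>B\<^esub> x = x"
    and scale_mult_left: "\<lbrakk>a \<in> carrier K; x \<in> carrier B; y \<in> carrier B\<rbrakk> \<Longrightarrow>
      (a \<odot>\<^bsub>B\<^esub> x) \<otimes>\<^bsub>B\<^esub> y = a \<odot>\<^bsub>B\<^esub> (x \<otimes>\<^bsub>B\<^esub> y)"
    and scale_mult_right: "\<lbrakk>a \<in> carrier K; x \<in> carrier B; y \<in> carrier B\<rbrakk> \<Longrightarrow>
      x \<otimes>\<^bsub>B\<^esub> (a \<odot>\<^bsub>B\<^esub> y) = a \<odot>\<^bsub>B\<^esub> (x \<otimes>\<^bsub>B\<^esub> y)"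

locale left_module = R?: ring R + M?: abelian_group M
  for R :: "('b, 'x) ring_scheme" and M :: "('b, 'm, 'y) module_scheme" +
  assumes smult_closed: "\<lbrakk>a \<in> carrier R; x \<in> carrier M\<rbrakk> \<Longrightarrow> a \<odot>\<^bsub>M\<^esub> x \<in> carrier M"
    and smult_l_distr: "\<lbrakk>a \<in> carrier R; b \<in> carrier R; x \<in> carrier M\<rbrakk> \<Longrightarrow>
      (a \<oplus>\<^bsub>R\<^esub> b) \<odot>\<^bsub>M\<^esub> x = a \<odot>\<^bsub>M\<^esub> x \<oplus>\<^bsub>M\<^esub> b \<odot>\<^bsub>M\<^esub> x"
    and smult_r_distr: "\<lbrakk>a \<in> carrier R; x \<in> carrier M; y \<in> carrier M\<rbrakk> \<Longrightarrow>
      a \<odot>\<^bsub>M\<^esub> (x \<oplus>\<^bsub>M\<^esub> y) = a \<odot>\<^bsub>M\<^esub> x \<oplus>\<^bsub>M\<^esub> a \<odot>\<^bsub>M\<^esub> y"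
    and smult_assoc: "\<lbrakk>a \<in> carrier R; b \<in> carrier R; x \<in> carrier M\<rbrakk> \<Longrightarrow>
      (a \<otimes>\<^bsub>R\<^esub> b) \<odot>\<^bsub>M\<^esub> x = a \<odot>\<^bsub>M\<^esub> (b \<odot>\<^bsub>M\<^esub> x)"
    and smult_one: "x \<in> carrier M \<Longrightarrow> \<one>\<^bsub>R\<^esub> \<odot>\<^bsub>M\<^esub> x = x"

definition module_hom ::
    "('b, 'x) ring_scheme \<Rightarrow> ('b, 'm) module \<Rightarrow> ('b, 'n) module \<Rightarrow> ('m \<Rightarrow> 'n) set" where
  "module_hom R M N = {f \<in> carrier M \<rightarrow>\<^sub>E carrier N.
     (\<forall>x\<in>carrier M. \<forall>y\<in>carrier M. f (x \<oplus>\<^bsub>M\<^esub> y) = f x \<oplus>\<^bsub>N\<^esub> f y) \<and>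
     (\<forall>a\<in>carrier R. \<forall>x\<in>carrier M. f (a \<odot>\<^bsub>M\<^esub> x) = a \<odot>\<^bsub>N\<^esub> f x)}"

definition module_iso ::
    "('b, 'x) ring_scheme \<Rightarrow> ('b, 'm) module \<Rightarrow> ('b, 'n) module \<Rightarrow> ('m \<Rightarrow> 'n) set" where
  "module_iso R M N = {f \<in> module_hom R M N. bij_betw f (carrier M) (carrier N)}"

definition finitely_generated :: "('b, 'x) ring_scheme \<Rightarrow> ('b, 'm) module \<Rightarrow> bool" where
  "finitely_generated R M \<longleftrightarrow> (\<exists>S. finite S \<and> S \<subseteq> carrier M \<and>
     (\<forall>x\<in>carrier M. \<exists>c\<in>S \<rightarrow> carrier R. x = (\<Oplus>\<^bsub>M\<^esub>s\<in>S. c s \<odot>\<^bsub>M\<^esub> s)))"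

definition free_module :: "('b, 'x) ring_scheme \<Rightarrow> 'i set \<Rightarrow> ('b, 'i \<Rightarrow> 'b) module" where
  "free_module R I = \<lparr>carrier = {f \<in> I \<rightarrow>\<^sub>E carrier R. finite {i \<in> I. f i \<noteq> \<zero>\<^bsub>R\<^esub>}},
     mult = undefined, one = undefined,
     zero = (\<lambda>i\<in>I. \<zero>\<^bsub>R\<^esub>), add = (\<lambda>f g. \<lambda>i\<in>I. f i \<oplus>\<^bsub>R\<^esub> g i),
     smult = (\<lambda>a f. \<lambda>i\<in>I. a \<otimes>\<^bsub>R\<^esub> f i)\<rparr>"

text \<open>Projective: a direct summand of a free module. Index sets within the type of the module
  suffice, since a projective module is a summand of the free module on its own carrier.\<close>

definition projective :: "('b, 'x) ring_scheme \<Rightarrow> ('b, 'm) module \<Rightarrow> bool" where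
  "projective R M \<longleftrightarrow> (\<exists>(I::'m set) i p. i \<in> module_hom R M (free_module R I) \<and>
     p \<in> module_hom R (free_module R I) M \<and> (\<forall>x\<in>carrier M. p (i x) = x))"

definition fg_projective :: "('b, 'x) ring_scheme \<Rightarrow> ('b, 'm) module \<Rightarrow> bool" where
  "fg_projective R M \<longleftrightarrow> left_module R M \<and> finitely_generated R M \<and> projective R M"

definition Proj :: "('b, 'x) ring_scheme \<Rightarrow> (('b, 'm) module, 'm \<Rightarrow> 'm) category" where
  "Proj R = \<lparr>Ob = {M. fg_projective R M}, Hom = module_hom R,
     Ident = (\<lambda>M. \<lambda>x\<in>carrier M. x), Comp = (\<lambda>L M N g f. compose (carrier L) g f)\<rparr>"


section \<open>Sheaves of modules over a constant sheaf of rings\<close>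

text \<open>Locally constant functions \<open>U \<rightarrow> S\<close>, for \<open>U\<close> open in \<open>X\<close>: the sections over \<open>U\<close> of the
  constant sheaf with value \<open>S\<close>.\<close>

definition locally_constant_on :: "'a topology \<Rightarrow> 'a set \<Rightarrow> 's set \<Rightarrow> ('a \<Rightarrow> 's) set" where
  "locally_constant_on X U S = {f \<in> U \<rightarrow>\<^sub>E S.
     \<forall>x\<in>U. \<exists>W. openin X W \<and> x \<in> W \<and> W \<subseteq> U \<and> (\<forall>y\<in>W. f y = f x)}"

definition const_ring :: "'a topology \<Rightarrow> ('b, 'x) ring_scheme \<Rightarrow> 'a set \<Rightarrow> ('a \<Rightarrow> 'b) ring" where
  "const_ring X B U = \<lparr>carrier = locally_constant_on X U (carrier B),
     mult = (\<lambda>f g. \<lambda>x\<in>U. f x \<otimes>\<^bsub>B\<^esub> g x), one = (\<lambda>x\<in>U. \<one>\<^bsub>B\<^esub>),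
     zero = (\<lambda>x\<in>U. \<zero>\<^bsub>B\<^esub>), add = (\<lambda>f g. \<lambda>x\<in>U. f x \<oplus>\<^bsub>B\<^esub> g x)\<rparr>"

text \<open>\<open>res E U V\<close> is the restriction from \<open>U\<close> to \<open>V\<close>; values at sets that are not open
  are irrelevant. Hence the restriction of \<open>E\<close> to an open subset \<open>U\<close> of \<open>X\<close> is the same record,
  regarded as a sheaf on \<open>subtopology X U\<close>.\<close>

record ('a, 'b, 's) msheaf =
  sec :: "'a set \<Rightarrow> ('a \<Rightarrow> 'b, 's) module"
  res :: "'a set \<Rightarrow> 'a set \<Rightarrow> 's \<Rightarrow> 's"

definition is_presheaf ::
    "'a topology \<Rightarrow> ('b, 'x) ring_scheme \<Rightarrow> ('a, 'b, 's) msheaf \<Rightarrow> bool" where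
  "is_presheaf X B E \<longleftrightarrow>
    (\<forall>U. openin X U \<longrightarrow> left_module (const_ring X B U) (sec E U)) \<and>
    (\<forall>U V. openin X U \<and> openin X V \<and> V \<subseteq> U \<longrightarrow>
      res E U V \<in> carrier (sec E U) \<rightarrow> carrier (sec E V) \<and>
      (\<forall>s\<in>carrier (sec E U). \<forall>t\<in>carrier (sec E U).
         res E U V (s \<oplus>\<^bsub>sec E U\<^esub> t) = res E U V s \<oplus>\<^bsub>sec E V\<^esub> res E U V t) \<and>
      (\<forall>b\<in>carrier (const_ring X B U). \<forall>s\<in>carrier (sec E U).
         res E U V (b \<odot>\<^bsub>sec E U\<^esub> s) = restrict b V \<odot>\<^bsub>sec E V\<^esub> res E U V s)) \<and>
    (\<forall>U. openin X U \<longrightarrow> (\<forall>s\<in>carrier (sec E U). res E U U s = s)) \<and>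
    (\<forall>U V W. openin X U \<and> openin X V \<and> openin X W \<and> W \<subseteq> V \<and> V \<subseteq> U \<longrightarrow>
      (\<forall>s\<in>carrier (sec E U). res E V W (res E U V s) = res E U W s))"

definition is_sheaf ::
    "'a topology \<Rightarrow> ('b, 'x) ring_scheme \<Rightarrow> ('a, 'b, 's) msheaf \<Rightarrow> bool" where
  "is_sheaf X B E \<longleftrightarrow> is_presheaf X B E \<and>
    (\<forall>\<U> s. (\<forall>U\<in>\<U>. openin X U \<and> s U \<in> carrier (sec E U)) \<and>
       (\<forall>U\<in>\<U>. \<forall>V\<in>\<U>. res E U (U \<inter> V) (s U) = res E V (U \<inter> V) (s V)) \<longrightarrow>
       (\<exists>!t. t \<in> carrier (sec E (\<Union>\<U>)) \<and> (\<forall>U\<in>\<U>. res E (\<Union>\<U>) U t = s U)))"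

definition sheaf_hom :: "'a topology \<Rightarrow> ('b, 'x) ring_scheme \<Rightarrow>
    ('a, 'b, 's) msheaf \<Rightarrow> ('a, 'b, 't) msheaf \<Rightarrow> ('a set \<Rightarrow> 's \<Rightarrow> 't) set" where
  "sheaf_hom X B E E' = {\<phi> \<in> extensional {U. openin X U}.
     (\<forall>U. openin X U \<longrightarrow> \<phi> U \<in> module_hom (const_ring X B U) (sec E U) (sec E' U)) \<and>
     (\<forall>U V. openin X U \<and> openin X V \<and> V \<subseteq> U \<longrightarrow>
       (\<forall>s\<in>carrier (sec E U). res E' U V (\<phi> U s) = \<phi> V (res E U V s)))}"

definition sheaf_id :: "'a topology \<Rightarrow> ('a, 'b, 's) msheaf \<Rightarrow> 'a set \<Rightarrow> 's \<Rightarrow> 's" where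
  "sheaf_id X E = (\<lambda>U\<in>{U. openin X U}. \<lambda>s\<in>carrier (sec E U). s)"

definition sheaf_comp :: "'a topology \<Rightarrow> ('a, 'b, 's) msheaf \<Rightarrow>
    ('a set \<Rightarrow> 't \<Rightarrow> 'u) \<Rightarrow> ('a set \<Rightarrow> 's \<Rightarrow> 't) \<Rightarrow> 'a set \<Rightarrow> 's \<Rightarrow> 'u" where
  "sheaf_comp X E \<psi> \<phi> = (\<lambda>U\<in>{U. openin X U}. compose (carrier (sec E U)) (\<psi> U) (\<phi> U))"

definition sheaf_iso :: "'a topology \<Rightarrow> ('b, 'x) ring_scheme \<Rightarrow>
    ('a, 'b, 's) msheaf \<Rightarrow> ('a, 'b, 't) msheaf \<Rightarrow> ('a set \<Rightarrow> 's \<Rightarrow> 't) set" where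
  "sheaf_iso X B E E' = {\<phi> \<in> sheaf_hom X B E E'. \<exists>\<psi>\<in>sheaf_hom X B E' E.
     sheaf_comp X E \<psi> \<phi> = sheaf_id X E \<and> sheaf_comp X E' \<phi> \<psi> = sheaf_id X E'}"

definition const_sheaf :: "'a topology \<Rightarrow> ('b, 'm) module \<Rightarrow> ('a, 'b, 'a \<Rightarrow> 'm) msheaf" where
  "const_sheaf X M = \<lparr>
     sec = (\<lambda>U. \<lparr>carrier = locally_constant_on X U (carrier M),
       mult = undefined, one = undefined,
       zero = (\<lambda>x\<in>U. \<zero>\<^bsub>M\<^esub>), add = (\<lambda>f g. \<lambda>x\<in>U. f x \<oplus>\<^bsub>M\<^esub> g x),
       smult = (\<lambda>b f. \<lambda>x\<in>U. b x \<odot>\<^bsub>M\<^esub> f x)\<rparr>),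
     res = (\<lambda>U V f. restrict f V)\<rparr>"

definition trivialisation :: "'a topology \<Rightarrow> ('b, 'x) ring_scheme \<Rightarrow> ('a, 'b, 's) msheaf \<Rightarrow>
    'a set \<Rightarrow> ('b, 'm) module \<Rightarrow> ('a set \<Rightarrow> 's \<Rightarrow> ('a \<Rightarrow> 'm)) \<Rightarrow> bool" where
  "trivialisation X B E U M \<phi> \<longleftrightarrow> openin X U \<and> left_module B M \<and>
     \<phi> \<in> sheaf_iso (subtopology X U) B E (const_sheaf (subtopology X U) M)"

definition locally_constant_sheaf ::
    "'a topology \<Rightarrow> ('b, 'x) ring_scheme \<Rightarrow> ('a, 'b, 's) msheaf \<Rightarrow> bool" where
  "locally_constant_sheaf X B E \<longleftrightarrow> is_sheaf X B E \<and>
     (\<forall>x\<in>topspace X. \<exists>U (M :: ('b, 's) module) \<phi>. x \<in> U \<and> trivialisation X B E U M \<phi>)"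


section \<open>A universe of elements, and stalks\<close>

text \<open>HOL has no type of all sets, so the elements of modules and the sections of sheaves are taken
  from one type: the closure of an arbitrary type \<open>'c\<close> under formation of germs and of families
  indexed by points. It takes the role of the Grothendieck universe that is implicit in speaking of
  all modules; the stalks of a sheaf, and the path-compatible families of a functor, stay in it.
  Every module with carrier in \<open>'c\<close> has a copy in it, and \<open>'c\<close> is a type variable, so no module is
  excluded; for \<open>'c = 'b list\<close>, say, all finitely generated modules over a ring with carrier in \<open>'b\<close>
  occur up to isomorphism.\<close>

datatype ('a, 'c) univ =
    Atom 'c
  | Germ (germ_nbhd: "'a set") (germ_section: "('a, 'c) univ")
  | Family (members: "'a \<Rightarrow> ('a, 'c) univ")

definition germ_rel :: "'a topology \<Rightarrow> ('a, 'b, 's) msheaf \<Rightarrow> 'a \<Rightarrow>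
    (('a set \<times> 's) \<times> ('a set \<times> 's)) set" where
  "germ_rel X E x = {((U, s), (V, t)). openin X U \<and> openin X V \<and> x \<in> U \<inter> V \<and>
     s \<in> carrier (sec E U) \<and> t \<in> carrier (sec E V) \<and>
     (\<exists>W. openin X W \<and> x \<in> W \<and> W \<subseteq> U \<inter> V \<and> res E U W s = res E V W t)}"

text \<open>An equivalence class is represented by a chosen element of it.\<close>

definition germ :: "'a topology \<Rightarrow> ('a, 'b, ('a, 'c) univ) msheaf \<Rightarrow> 'a \<Rightarrow>
    'a set \<Rightarrow> ('a, 'c) univ \<Rightarrow> ('a, 'c) univ" where
  "germ X E x U s = (case (SOME p. p \<in> germ_rel X E x `` {(U, s)}) of (V, t) \<Rightarrow> Germ V t)"

text \<open>The stalk at \<open>x\<close> of the constant sheaf of rings is identified with \<open>B\<close>: a scalar acts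
  through the constant section it defines.\<close>

definition stalk :: "'a topology \<Rightarrow> ('a, 'b, ('a, 'c) univ) msheaf \<Rightarrow> 'a \<Rightarrow>
    ('b, ('a, 'c) univ) module" where
  "stalk X E x = \<lparr>
     carrier = {germ X E x U s |U s. openin X U \<and> x \<in> U \<and> s \<in> carrier (sec E U)},
     mult = undefined, one = undefined,
     zero = germ X E x (topspace X) \<zero>\<^bsub>sec E (topspace X)\<^esub>,
     add = (\<lambda>g h. let U = germ_nbhd g; V = germ_nbhd h; W = U \<inter> V in
       germ X E x W (res E U W (germ_section g) \<oplus>\<^bsub>sec E W\<^esub> res E V W (germ_section h))),
     smult = (\<lambda>b g. let U = germ_nbhd g in
       germ X E x U ((\<lambda>y\<in>U. b) \<odot>\<^bsub>sec E U\<^esub> germ_section g))\<rparr>"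

definition stalk_map :: "'a topology \<Rightarrow> ('a, 'b, ('a, 'c) univ) msheaf \<Rightarrow>
    ('a, 'b, ('a, 'c) univ) msheaf \<Rightarrow> ('a set \<Rightarrow> ('a, 'c) univ \<Rightarrow> ('a, 'c) univ) \<Rightarrow> 'a \<Rightarrow>
    ('a, 'c) univ \<Rightarrow> ('a, 'c) univ" where
  "stalk_map X E E' \<phi> x = (\<lambda>g\<in>carrier (stalk X E x).
     germ X E' x (germ_nbhd g) (\<phi> (germ_nbhd g) (germ_section g)))"

definition LCS :: "'a topology \<Rightarrow> ('b, 'x) ring_scheme \<Rightarrow>
    (('a, 'b, ('a, 'c) univ) msheaf, 'a set \<Rightarrow> ('a, 'c) univ \<Rightarrow> ('a, 'c) univ) category" where
  "LCS X B = core \<lparr>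
     Ob = {E. locally_constant_sheaf X B E \<and> (\<forall>x\<in>topspace X. fg_projective B (stalk X E x))},
     Hom = sheaf_hom X B,
     Ident = sheaf_id X,
     Comp = (\<lambda>E E' E'' \<psi> \<phi>. sheaf_comp X E \<psi> \<phi>)\<rparr>"


section \<open>Parallel transport\<close>

text \<open>The map on the stalk at \<open>x\<close> induced by a trivialisation over \<open>U\<close>, where the stalk at \<open>x\<close> of
  the constant sheaf is identified with its value by evaluation at \<open>x\<close>.\<close>

definition triv_fibre :: "('a, 'b, ('a, 'c) univ) msheaf \<Rightarrow> 'a set \<Rightarrow>
    ('a set \<Rightarrow> ('a, 'c) univ \<Rightarrow> ('a \<Rightarrow> 'm)) \<Rightarrow> 'a \<Rightarrow> ('a, 'c) univ \<Rightarrow> 'm" where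
  "triv_fibre E U \<phi> x g =
     (let V = germ_nbhd g in \<phi> (V \<inter> U) (res E V (V \<inter> U) (germ_section g)) x)"

definition constant_identification :: "'a topology \<Rightarrow> ('a, 'b, ('a, 'c) univ) msheaf \<Rightarrow> 'a set \<Rightarrow>
    ('a set \<Rightarrow> ('a, 'c) univ \<Rightarrow> ('a \<Rightarrow> 'm)) \<Rightarrow> 'a \<Rightarrow> 'a \<Rightarrow> ('a, 'c) univ \<Rightarrow> ('a, 'c) univ" where
  "constant_identification X E U \<phi> x y g =
     inv_into (carrier (stalk X E y)) (triv_fibre E U \<phi> y) (triv_fibre E U \<phi> x g)"

text \<open>\<open>transport_upto X B E \<gamma> t T\<close>: the map \<open>T\<close> from the stalk at \<open>\<gamma> 0\<close> to the stalk at \<open>\<gamma> t\<close> is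
  the composite of the constant identifications along a chain of trivialising open sets
  covering \<open>\<gamma>\<close> on \<open>[0, t]\<close>.\<close>

inductive transport_upto :: "'a topology \<Rightarrow> ('b, 'x) ring_scheme \<Rightarrow>
    ('a, 'b, ('a, 'c) univ) msheaf \<Rightarrow> (real \<Rightarrow> 'a) \<Rightarrow> real \<Rightarrow>
    (('a, 'c) univ \<Rightarrow> ('a, 'c) univ) \<Rightarrow> bool"
  for X B E \<gamma> where
  start: "transport_upto X B E \<gamma> 0 (\<lambda>g\<in>carrier (stalk X E (\<gamma> 0)). g)"
| step: "\<lbrakk>transport_upto X B E \<gamma> t T; t < t'; t' \<le> 1;
     trivialisation X B E U (M :: ('b, ('a, 'c) univ) module) \<phi>; \<gamma> ` {t..t'} \<subseteq> U\<rbrakk> \<Longrightarrow>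
     transport_upto X B E \<gamma> t'
       (compose (carrier (stalk X E (\<gamma> 0))) (constant_identification X E U \<phi> (\<gamma> t) (\<gamma> t')) T)"

definition parallel_transport :: "'a topology \<Rightarrow> ('b, 'x) ring_scheme \<Rightarrow>
    ('a, 'b, ('a, 'c) univ) msheaf \<Rightarrow> (real \<Rightarrow> 'a) set \<Rightarrow> ('a, 'c) univ \<Rightarrow> ('a, 'c) univ" where
  "parallel_transport X B E c = (THE T. \<exists>\<gamma>\<in>c. transport_upto X B E \<gamma> 1 T)"

definition Mon_ob :: "'a topology \<Rightarrow> ('b, 'x) ring_scheme \<Rightarrow> ('a, 'b, ('a, 'c) univ) msheaf \<Rightarrow>
    ('a, (real \<Rightarrow> 'a) set, ('b, ('a, 'c) univ) module, ('a, 'c) univ \<Rightarrow> ('a, 'c) univ) cfunctor" where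
  "Mon_ob X B E = \<lparr>on_ob = stalk X E, on_hom = (\<lambda>x y c. parallel_transport X B E c)\<rparr>"

definition Mon :: "'a topology \<Rightarrow> ('b, 'x) ring_scheme \<Rightarrow>
    (('a, 'b, ('a, 'c) univ) msheaf, 'a set \<Rightarrow> ('a, 'c) univ \<Rightarrow> ('a, 'c) univ,
     ('a, (real \<Rightarrow> 'a) set, ('b, ('a, 'c) univ) module, ('a, 'c) univ \<Rightarrow> ('a, 'c) univ) cfunctor,
     'a \<Rightarrow> ('a, 'c) univ \<Rightarrow> ('a, 'c) univ) cfunctor" where
  "Mon X B = \<lparr>on_ob = Mon_ob X B, on_hom = (\<lambda>E E' \<phi>. \<lambda>x\<in>topspace X. stalk_map X E E' \<phi> x)\<rparr>"


section \<open>The sheaf of path-compatible families\<close>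

definition path_compatible :: "'a topology \<Rightarrow>
    ('a, (real \<Rightarrow> 'a) set, ('b, 'm) module, 'm \<Rightarrow> 'm) cfunctor \<Rightarrow> 'a set \<Rightarrow> ('a \<Rightarrow> 'm) set" where
  "path_compatible X F U = {s \<in> (\<Pi>\<^sub>E x\<in>U. carrier (on_ob F x)).
     \<forall>\<gamma>. pathin (subtopology X U) \<gamma> \<longrightarrow>
       on_hom F (\<gamma> 0) (\<gamma> 1) (path_class X \<gamma>) (s (\<gamma> 0)) = s (\<gamma> 1)}"

definition family_sheaf :: "'a topology \<Rightarrow>
    ('a, (real \<Rightarrow> 'a) set, ('b, ('a, 'c) univ) module, ('a, 'c) univ \<Rightarrow> ('a, 'c) univ) cfunctor \<Rightarrow>
    ('a, 'b, ('a, 'c) univ) msheaf" where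
  "family_sheaf X F = \<lparr>
     sec = (\<lambda>U. \<lparr>carrier = Family ` path_compatible X F U,
       mult = undefined, one = undefined,
       zero = Family (\<lambda>x\<in>U. \<zero>\<^bsub>on_ob F x\<^esub>),
       add = (\<lambda>s t. Family (\<lambda>x\<in>U. members s x \<oplus>\<^bsub>on_ob F x\<^esub> members t x)),
       smult = (\<lambda>b s. Family (\<lambda>x\<in>U. b x \<odot>\<^bsub>on_ob F x\<^esub> members s x))\<rparr>),
     res = (\<lambda>U V s. Family (restrict (members s) V))\<rparr>"

definition Family_functor :: "'a topology \<Rightarrow>
    (('a, (real \<Rightarrow> 'a) set, ('b, ('a, 'c) univ) module, ('a, 'c) univ \<Rightarrow> ('a, 'c) univ) cfunctor,
     'a \<Rightarrow> ('a, 'c) univ \<Rightarrow> ('a, 'c) univ,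
     ('a, 'b, ('a, 'c) univ) msheaf, 'a set \<Rightarrow> ('a, 'c) univ \<Rightarrow> ('a, 'c) univ) cfunctor" where
  "Family_functor X = \<lparr>on_ob = family_sheaf X,
     on_hom = (\<lambda>F G \<eta>. \<lambda>U\<in>{U. openin X U}. \<lambda>s\<in>carrier (sec (family_sheaf X F) U).
       Family (\<lambda>x\<in>U. \<eta> x (members s x)))\<rparr>"

text \<open>The \<open>B\<close>-module underlying a module over the ring of sections over \<open>U\<close> of the constant
  sheaf, by restriction of scalars to constant sections.\<close>

definition constant_scalars :: "'a set \<Rightarrow> ('a \<Rightarrow> 'b, 's) module \<Rightarrow> ('b, 's) module" where
  "constant_scalars U M = \<lparr>carrier = carrier M, mult = mult M, one = one M, zero = zero M,
     add = add M, smult = (\<lambda>b s. (\<lambda>x\<in>U. b) \<odot>\<^bsub>M\<^esub> s)\<rparr>"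

definition evaluation_at :: "('a, 'b, ('a, 'c) univ) msheaf \<Rightarrow> 'a set \<Rightarrow> 'a \<Rightarrow>
    ('a, 'c) univ \<Rightarrow> ('a, 'c) univ" where
  "evaluation_at E U x = (\<lambda>s\<in>carrier (sec E U). members s x)"

end

theory Submission
  imports Defs
begin

text \<open>
  A locally constant sheaf becomes constant after pullback to the unit interval or to the unit square,
  and this is what makes monodromy work. The proof phrases it through flat sections along a map \<open>f\<close> into
  \<open>X\<close>: families of germs \<open>\<sigma> z\<close> of \<open>E\<close> at the points \<open>f z\<close> that locally come from sections of \<open>E\<close>. Two
  germs of sections that differ at a point differ nearby, since a trivialisation turns sections into
  locally constant functions; so flat sections over a connected domain are determined by one value
  (\<open>flat_along_unique\<close>). Over a square they exist through every germ (\<open>germs_extend_square\<close>): subdivide the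
  square until each piece is mapped into a trivialising set, and paste. A chain of constant
  identifications along a path \<open>\<gamma>\<close> carries \<open>\<sigma> 0\<close> to \<open>\<sigma> 1\<close> for each flat section \<open>\<sigma>\<close> along \<open>\<gamma>\<close>
  (\<open>transport_upto_flat\<close>). Hence parallel transport does not depend on the chain, and a flat section over
  a homotopy shows that it depends only on the class of \<open>\<gamma>\<close> (\<open>flat_along_homotopic\<close>). Functoriality in the
  path and naturality in the sheaf follow in the same way, by cutting flat sections in two and by
  applying stalk maps to them; this gives \<open>Mon_functor\<close>.

  Conversely let \<open>F\<close> be a functor on the fundamental groupoid. As \<open>X\<close> is locally path-connected and
  semilocally simply connected, its points have arbitrarily small path-connected open neighbourhoods \<open>U\<close>
  in which the action of a path on the values of \<open>F\<close> depends on its endpoints alone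
  (\<open>path_independent_nbhd\<close>). Over such a \<open>U\<close>, moving all values of a path-compatible family to one base
  point gives a locally constant function, and each locally constant function arises once. So the sheaf
  of families is locally constant (\<open>fam_trivialisation\<close>), its stalk at \<open>x\<close> is \<open>F(x)\<close> (\<open>stalk_eval_bij\<close>), and
  evaluation at a base point is an isomorphism on the sections over \<open>U\<close> (\<open>evaluation_at_module_iso\<close>).

  The counit of the equivalence is the identification of the stalk at \<open>x\<close> with \<open>F(x)\<close>. It commutes with
  parallel transport because the values \<open>F(\<gamma>|[0,t])(m)\<close> trace out a flat section along \<open>\<gamma>\<close>
  (\<open>stalk_eval_parallel_transport\<close>). The unit sends a section to the family of its germs. The germs of a
  section are flat, so the family is path-compatible; it determines the section because \<open>E\<close> is a sheaf;
  and a path-compatible family of germs is near each point the family of germs of one section, so these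
  sections glue (\<open>germ_family_of_section\<close>).
\<close>


section \<open>Cores and groupoids of functors\<close>

lemma category_ident: "is_category C \<Longrightarrow> x \<in> Ob C \<Longrightarrow> Ident C x \<in> Hom C x x"
  by (simp add: is_category_def)

lemma category_comp:
  "is_category C \<Longrightarrow> x \<in> Ob C \<Longrightarrow> y \<in> Ob C \<Longrightarrow> z \<in> Ob C \<Longrightarrow> f \<in> Hom C x y \<Longrightarrow> g \<in> Hom C y z
    \<Longrightarrow> Comp C x y z g f \<in> Hom C x z"
  by (simp add: is_category_def)

lemma category_ident_right:
  "is_category C \<Longrightarrow> x \<in> Ob C \<Longrightarrow> y \<in> Ob C \<Longrightarrow> f \<in> Hom C x y \<Longrightarrow> Comp C x x y f (Ident C x) = f"
  by (simp add: is_category_def)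

lemma category_ident_left:
  "is_category C \<Longrightarrow> x \<in> Ob C \<Longrightarrow> y \<in> Ob C \<Longrightarrow> f \<in> Hom C x y \<Longrightarrow> Comp C x y y (Ident C y) f = f"
  by (simp add: is_category_def)

lemma category_assoc:
  "is_category C \<Longrightarrow> w \<in> Ob C \<Longrightarrow> x \<in> Ob C \<Longrightarrow> y \<in> Ob C \<Longrightarrow> z \<in> Ob C \<Longrightarrow>
    f \<in> Hom C w x \<Longrightarrow> g \<in> Hom C x y \<Longrightarrow> h \<in> Hom C y z \<Longrightarrow>
    Comp C w y z h (Comp C w x y g f) = Comp C w x z (Comp C x y z h g) f"
  by (simp add: is_category_def)

lemmas category_rules = category_ident category_comp category_ident_right category_ident_left

lemma is_isoI:
  "f \<in> Hom C x y \<Longrightarrow> g \<in> Hom C y x \<Longrightarrow> Comp C x y x g f = Ident C x \<Longrightarrow>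
    Comp C y x y f g = Ident C y \<Longrightarrow> is_iso C x y f"
  by (auto simp: is_iso_def)

lemma is_isoE:
  assumes "is_iso C x y f"
  obtains g where "f \<in> Hom C x y" "g \<in> Hom C y x" "Comp C x y x g f = Ident C x"
    "Comp C y x y f g = Ident C y" "is_iso C y x g"
  using assms by (auto simp: is_iso_def)

lemma is_iso_in_Hom: "is_iso C x y f \<Longrightarrow> f \<in> Hom C x y"
  by (simp add: is_iso_def)

lemma is_iso_ident: "is_category C \<Longrightarrow> x \<in> Ob C \<Longrightarrow> is_iso C x x (Ident C x)"
  by (rule is_isoI[where g = "Ident C x"]) (simp_all add: category_rules)

lemma is_iso_comp:
  assumes C: "is_category C" and ob: "x \<in> Ob C" "y \<in> Ob C" "z \<in> Ob C"
    and f: "is_iso C x y f" and g: "is_iso C y z g"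
  shows "is_iso C x z (Comp C x y z g f)"
proof -
  obtain f' where f': "f \<in> Hom C x y" "f' \<in> Hom C y x" "Comp C x y x f' f = Ident C x"
    "Comp C y x y f f' = Ident C y" using f by (rule is_isoE)
  obtain g' where g': "g \<in> Hom C y z" "g' \<in> Hom C z y" "Comp C y z y g' g = Ident C y"
    "Comp C z y z g g' = Ident C z" using g by (rule is_isoE)
  note rules = category_rules[OF C] ob f'(1,2) g'(1,2)
  show ?thesis
  proof (rule is_isoI[where g = "Comp C z y x f' g'"])
    have "Comp C x z x (Comp C z y x f' g') (Comp C x y z g f)
        = Comp C x y x f' (Comp C x z y g' (Comp C x y z g f))"
      by (rule category_assoc[OF C, symmetric]) (simp_all add: rules)
    also have "Comp C x z y g' (Comp C x y z g f) = Comp C x y y (Comp C y z y g' g) f"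
      by (rule category_assoc[OF C]) (simp_all add: rules)
    also have "\<dots> = f" by (simp add: rules g')
    finally show "Comp C x z x (Comp C z y x f' g') (Comp C x y z g f) = Ident C x"
      by (simp add: f')
    have "Comp C z x z (Comp C x y z g f) (Comp C z y x f' g')
        = Comp C z y z g (Comp C z x y f (Comp C z y x f' g'))"
      by (rule category_assoc[OF C, symmetric]) (simp_all add: rules)
    also have "Comp C z x y f (Comp C z y x f' g') = Comp C z y y (Comp C y x y f f') g'"
      by (rule category_assoc[OF C]) (simp_all add: rules)
    also have "\<dots> = g'" by (simp add: rules f')
    finally show "Comp C z x z (Comp C x y z g f) (Comp C z y x f' g') = Ident C z"
      by (simp add: g')
  qed (simp_all add: rules)
qed

lemma core_simps [simp]:
  "Ob (core C) = Ob C" "Hom (core C) x y = {f. is_iso C x y f}"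
  "Ident (core C) = Ident C" "Comp (core C) = Comp C"
  by (simp_all add: core_def)

lemma is_iso_core: "is_iso (core C) x y f \<longleftrightarrow> is_iso C x y f"
  by (auto simp: is_iso_def)

lemma is_groupoid_core:
  assumes C: "is_category C"
  shows "is_groupoid (core C)"
  unfolding is_groupoid_def
proof
  show "is_category (core C)"
    unfolding is_category_def core_simps
    by (auto simp: is_iso_ident[OF C] is_iso_comp[OF C] category_ident_right[OF C]
        category_ident_left[OF C] is_iso_in_Hom
        intro!: category_assoc[OF C])
  show "\<forall>x\<in>Ob (core C). \<forall>y\<in>Ob (core C). \<forall>f\<in>Hom (core C) x y. is_iso (core C) x y f"
    by (simp add: is_iso_core)
qed

lemma functorI:
  assumes "\<And>x. x \<in> Ob C \<Longrightarrow> on_ob F x \<in> Ob D"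
    and "\<And>x y f. x \<in> Ob C \<Longrightarrow> y \<in> Ob C \<Longrightarrow> f \<in> Hom C x y \<Longrightarrow>
      on_hom F x y f \<in> Hom D (on_ob F x) (on_ob F y)"
    and "\<And>x. x \<in> Ob C \<Longrightarrow> on_hom F x x (Ident C x) = Ident D (on_ob F x)"
    and "\<And>x y z f g. x \<in> Ob C \<Longrightarrow> y \<in> Ob C \<Longrightarrow> z \<in> Ob C \<Longrightarrow> f \<in> Hom C x y \<Longrightarrow> g \<in> Hom C y z \<Longrightarrow>
      on_hom F x z (Comp C x y z g f)
      = Comp D (on_ob F x) (on_ob F y) (on_ob F z) (on_hom F y z g) (on_hom F x y f)"
  shows "is_functor C D F"
  using assms by (simp add: is_functor_def)

lemma functor_ob: "is_functor C D F \<Longrightarrow> x \<in> Ob C \<Longrightarrow> on_ob F x \<in> Ob D"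
  by (simp add: is_functor_def)

lemma functor_hom:
  "is_functor C D F \<Longrightarrow> x \<in> Ob C \<Longrightarrow> y \<in> Ob C \<Longrightarrow> f \<in> Hom C x y \<Longrightarrow>
    on_hom F x y f \<in> Hom D (on_ob F x) (on_ob F y)"
  by (simp add: is_functor_def)

lemma functor_ident:
  "is_functor C D F \<Longrightarrow> x \<in> Ob C \<Longrightarrow> on_hom F x x (Ident C x) = Ident D (on_ob F x)"
  by (simp add: is_functor_def)

lemma functor_comp:
  "is_functor C D F \<Longrightarrow> x \<in> Ob C \<Longrightarrow> y \<in> Ob C \<Longrightarrow> z \<in> Ob C \<Longrightarrow> f \<in> Hom C x y \<Longrightarrow> g \<in> Hom C y z \<Longrightarrow>
    on_hom F x z (Comp C x y z g f)
    = Comp D (on_ob F x) (on_ob F y) (on_ob F z) (on_hom F y z g) (on_hom F x y f)"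
  by (simp add: is_functor_def)

text \<open>Functors preserve isomorphisms, so a functor that starts at a groupoid lands in the core.\<close>

lemma functor_into_core:
  assumes C: "is_groupoid C" and F: "is_functor C D F"
  shows "is_functor C (core D) F"
proof (rule functorI)
  fix x y f assume x: "x \<in> Ob C" and y: "y \<in> Ob C" and f: "f \<in> Hom C x y"
  obtain g where g: "g \<in> Hom C y x" "Comp C x y x g f = Ident C x" "Comp C y x y f g = Ident C y"
    using C x y f unfolding is_groupoid_def is_iso_def by metis
  show "on_hom F x y f \<in> Hom (core D) (on_ob F x) (on_ob F y)"
    unfolding core_simps mem_Collect_eq
    by (rule is_isoI[where g = "on_hom F y x g"])
      (use F x y f g in \<open>simp_all add: functor_hom functor_comp[symmetric] functor_ident\<close>)
qed (use F in \<open>simp_all add: functor_ob functor_ident functor_comp\<close>)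

lemma nat_isoI:
  assumes "\<eta> \<in> extensional (Ob C)"
    and "\<And>x. x \<in> Ob C \<Longrightarrow> is_iso D (on_ob F x) (on_ob G x) (\<eta> x)"
    and "\<And>x y f. x \<in> Ob C \<Longrightarrow> y \<in> Ob C \<Longrightarrow> f \<in> Hom C x y \<Longrightarrow>
      Comp D (on_ob F x) (on_ob F y) (on_ob G y) (\<eta> y) (on_hom F x y f) =
      Comp D (on_ob F x) (on_ob G x) (on_ob G y) (on_hom G x y f) (\<eta> x)"
  shows "is_nat_iso C D F G \<eta>"
  using assms by (simp add: is_nat_iso_def)

lemma nat_iso_ext: "is_nat_iso C D F G \<eta> \<Longrightarrow> \<eta> \<in> extensional (Ob C)"
  by (simp add: is_nat_iso_def)

lemma nat_iso_iso:
  "is_nat_iso C D F G \<eta> \<Longrightarrow> x \<in> Ob C \<Longrightarrow> is_iso D (on_ob F x) (on_ob G x) (\<eta> x)"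
  by (simp add: is_nat_iso_def)

lemma nat_iso_natural:
  "is_nat_iso C D F G \<eta> \<Longrightarrow> x \<in> Ob C \<Longrightarrow> y \<in> Ob C \<Longrightarrow> f \<in> Hom C x y \<Longrightarrow>
      Comp D (on_ob F x) (on_ob F y) (on_ob G y) (\<eta> y) (on_hom F x y f) =
      Comp D (on_ob F x) (on_ob G x) (on_ob G y) (on_hom G x y f) (\<eta> x)"
  by (simp add: is_nat_iso_def)

lemma nat_iso_comp:
  assumes D: "is_category D"
    and F: "is_functor C D F" and G: "is_functor C D G" and H: "is_functor C D H"
    and \<eta>: "is_nat_iso C D F G \<eta>" and \<theta>: "is_nat_iso C D G H \<theta>"
  shows "is_nat_iso C D F H
    (\<lambda>x\<in>Ob C. Comp D (on_ob F x) (on_ob G x) (on_ob H x) (\<theta> x) (\<eta> x))"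
proof (rule nat_isoI)
  fix x assume x: "x \<in> Ob C"
  note ob = functor_ob[OF F x] functor_ob[OF G x] functor_ob[OF H x]
  show "is_iso D (on_ob F x) (on_ob H x)
      ((\<lambda>x\<in>Ob C. Comp D (on_ob F x) (on_ob G x) (on_ob H x) (\<theta> x) (\<eta> x)) x)"
    using x by (simp add: is_iso_comp[OF D ob nat_iso_iso[OF \<eta> x] nat_iso_iso[OF \<theta> x]])
next
  fix x y f assume x: "x \<in> Ob C" and y: "y \<in> Ob C" and f: "f \<in> Hom C x y"
  note ob = functor_ob[OF F x] functor_ob[OF G x] functor_ob[OF H x]
    functor_ob[OF F y] functor_ob[OF G y] functor_ob[OF H y]
  note hom = functor_hom[OF F x y f] functor_hom[OF G x y f] functor_hom[OF H x y f]
    is_iso_in_Hom[OF nat_iso_iso[OF \<eta> x]] is_iso_in_Hom[OF nat_iso_iso[OF \<eta> y]]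
    is_iso_in_Hom[OF nat_iso_iso[OF \<theta> x]] is_iso_in_Hom[OF nat_iso_iso[OF \<theta> y]]
  have "Comp D (on_ob F x) (on_ob F y) (on_ob H y)
      (Comp D (on_ob F y) (on_ob G y) (on_ob H y) (\<theta> y) (\<eta> y)) (on_hom F x y f)
    = Comp D (on_ob F x) (on_ob G y) (on_ob H y) (\<theta> y)
       (Comp D (on_ob F x) (on_ob F y) (on_ob G y) (\<eta> y) (on_hom F x y f))"
    by (rule category_assoc[OF D, symmetric]) (simp_all add: ob hom)
  also have "\<dots> = Comp D (on_ob F x) (on_ob G y) (on_ob H y) (\<theta> y)
       (Comp D (on_ob F x) (on_ob G x) (on_ob G y) (on_hom G x y f) (\<eta> x))"
    by (simp add: nat_iso_natural[OF \<eta> x y f])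
  also have "\<dots> = Comp D (on_ob F x) (on_ob G x) (on_ob H y)
       (Comp D (on_ob G x) (on_ob G y) (on_ob H y) (\<theta> y) (on_hom G x y f)) (\<eta> x)"
    by (rule category_assoc[OF D]) (simp_all add: ob hom)
  also have "\<dots> = Comp D (on_ob F x) (on_ob G x) (on_ob H y)
       (Comp D (on_ob G x) (on_ob H x) (on_ob H y) (on_hom H x y f) (\<theta> x)) (\<eta> x)"
    by (simp add: nat_iso_natural[OF \<theta> x y f])
  also have "\<dots> = Comp D (on_ob F x) (on_ob H x) (on_ob H y) (on_hom H x y f)
       (Comp D (on_ob F x) (on_ob G x) (on_ob H x) (\<theta> x) (\<eta> x))"
    by (rule category_assoc[OF D, symmetric]) (simp_all add: ob hom)
  finally show "Comp D (on_ob F x) (on_ob F y) (on_ob H y)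
      ((\<lambda>x\<in>Ob C. Comp D (on_ob F x) (on_ob G x) (on_ob H x) (\<theta> x) (\<eta> x)) y) (on_hom F x y f)
    = Comp D (on_ob F x) (on_ob H x) (on_ob H y) (on_hom H x y f)
      ((\<lambda>x\<in>Ob C. Comp D (on_ob F x) (on_ob G x) (on_ob H x) (\<theta> x) (\<eta> x)) x)"
    using x y by simp
qed simp

text \<open>Composing a naturality square with the inverses of its vertical sides on both sides gives the
  naturality square of the inverses.\<close>

lemma nat_iso_inverse:
  assumes D: "is_category D" and F: "is_functor C D F" and G: "is_functor C D G"
    and \<eta>: "is_nat_iso C D F G \<eta>"
  obtains \<theta> where "is_nat_iso C D G F \<theta>"
    "\<And>x. x \<in> Ob C \<Longrightarrow> Comp D (on_ob F x) (on_ob G x) (on_ob F x) (\<theta> x) (\<eta> x) = Ident D (on_ob F x)"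
    "\<And>x. x \<in> Ob C \<Longrightarrow> Comp D (on_ob G x) (on_ob F x) (on_ob G x) (\<eta> x) (\<theta> x) = Ident D (on_ob G x)"
proof -
  have "\<exists>g. g \<in> Hom D (on_ob G x) (on_ob F x) \<and>
      Comp D (on_ob F x) (on_ob G x) (on_ob F x) g (\<eta> x) = Ident D (on_ob F x) \<and>
      Comp D (on_ob G x) (on_ob F x) (on_ob G x) (\<eta> x) g = Ident D (on_ob G x)" if "x \<in> Ob C" for x
    using nat_iso_iso[OF \<eta> that] by (auto simp: is_iso_def)
  then obtain \<theta> where \<theta>: "\<And>x. x \<in> Ob C \<Longrightarrow> \<theta> x \<in> Hom D (on_ob G x) (on_ob F x)"
    "\<And>x. x \<in> Ob C \<Longrightarrow> Comp D (on_ob F x) (on_ob G x) (on_ob F x) (\<theta> x) (\<eta> x) = Ident D (on_ob F x)"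
    "\<And>x. x \<in> Ob C \<Longrightarrow> Comp D (on_ob G x) (on_ob F x) (on_ob G x) (\<eta> x) (\<theta> x) = Ident D (on_ob G x)"
    by metis
  show ?thesis
  proof
    show "is_nat_iso C D G F (restrict \<theta> (Ob C))"
    proof (rule nat_isoI)
      fix x assume x: "x \<in> Ob C"
      show "is_iso D (on_ob G x) (on_ob F x) (restrict \<theta> (Ob C) x)"
        by (rule is_isoI[where g = "\<eta> x"]) (use x \<theta> is_iso_in_Hom[OF nat_iso_iso[OF \<eta> x]] in simp_all)
    next
      fix x y f assume x: "x \<in> Ob C" and y: "y \<in> Ob C" and f: "f \<in> Hom C x y"
      note ob = functor_ob[OF F x] functor_ob[OF G x] functor_ob[OF F y] functor_ob[OF G y]
      note hom = functor_hom[OF F x y f] functor_hom[OF G x y f] \<theta>(1)[OF x] \<theta>(1)[OF y]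
        is_iso_in_Hom[OF nat_iso_iso[OF \<eta> x]] is_iso_in_Hom[OF nat_iso_iso[OF \<eta> y]]
      note rules = category_rules[OF D] ob hom
      let ?K = "Comp D"
      have "?K (on_ob G x) (on_ob G y) (on_ob F y) (\<theta> y) (on_hom G x y f)
        = ?K (on_ob G x) (on_ob G y) (on_ob F y) (\<theta> y)
            (?K (on_ob G x) (on_ob G x) (on_ob G y) (on_hom G x y f)
              (?K (on_ob G x) (on_ob F x) (on_ob G x) (\<eta> x) (\<theta> x)))"
        by (simp add: rules \<theta>(3)[OF x])
      also have "?K (on_ob G x) (on_ob G x) (on_ob G y) (on_hom G x y f)
              (?K (on_ob G x) (on_ob F x) (on_ob G x) (\<eta> x) (\<theta> x))
        = ?K (on_ob G x) (on_ob F x) (on_ob G y)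
            (?K (on_ob F x) (on_ob G x) (on_ob G y) (on_hom G x y f) (\<eta> x)) (\<theta> x)"
        by (rule category_assoc[OF D]) (simp_all add: rules)
      also have "?K (on_ob F x) (on_ob G x) (on_ob G y) (on_hom G x y f) (\<eta> x)
        = ?K (on_ob F x) (on_ob F y) (on_ob G y) (\<eta> y) (on_hom F x y f)"
        by (simp add: nat_iso_natural[OF \<eta> x y f])
      also have "?K (on_ob G x) (on_ob F x) (on_ob G y)
            (?K (on_ob F x) (on_ob F y) (on_ob G y) (\<eta> y) (on_hom F x y f)) (\<theta> x)
        = ?K (on_ob G x) (on_ob F y) (on_ob G y) (\<eta> y)
            (?K (on_ob G x) (on_ob F x) (on_ob F y) (on_hom F x y f) (\<theta> x))"
        by (rule category_assoc[OF D, symmetric]) (simp_all add: rules)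
      also have "?K (on_ob G x) (on_ob G y) (on_ob F y) (\<theta> y) \<dots>
        = ?K (on_ob G x) (on_ob F y) (on_ob F y)
            (?K (on_ob F y) (on_ob G y) (on_ob F y) (\<theta> y) (\<eta> y))
            (?K (on_ob G x) (on_ob F x) (on_ob F y) (on_hom F x y f) (\<theta> x))"
        by (rule category_assoc[OF D]) (simp_all add: rules)
      also have "\<dots> = ?K (on_ob G x) (on_ob F x) (on_ob F y) (on_hom F x y f) (\<theta> x)"
        by (simp add: \<theta>(2)[OF y] rules)
      finally show "?K (on_ob G x) (on_ob G y) (on_ob F y) (restrict \<theta> (Ob C) y) (on_hom G x y f)
          = ?K (on_ob G x) (on_ob F x) (on_ob F y) (on_hom F x y f) (restrict \<theta> (Ob C) x)"
        using x y by simp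
    qed simp
  qed (use \<theta> in simp_all)
qed

lemma nat_iso_ident:
  assumes D: "is_category D" and F: "is_functor C D F"
  shows "is_nat_iso C D F F (\<lambda>x\<in>Ob C. Ident D (on_ob F x))"
proof (rule nat_isoI)
  fix x y f assume "x \<in> Ob C" "y \<in> Ob C" "f \<in> Hom C x y"
  then show "Comp D (on_ob F x) (on_ob F y) (on_ob F y) ((\<lambda>x\<in>Ob C. Ident D (on_ob F x)) y) (on_hom F x y f)
    = Comp D (on_ob F x) (on_ob F x) (on_ob F y) (on_hom F x y f) ((\<lambda>x\<in>Ob C. Ident D (on_ob F x)) x)"
    by (simp add: category_rules[OF D] functor_ob[OF F] functor_hom[OF F])
qed (use F in \<open>simp_all add: is_iso_ident[OF D] functor_ob\<close>)

lemma Fun_groupoid_simps [simp]: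
  "Ob (Fun_groupoid C D) = {F. is_functor C D F}"
  "Hom (Fun_groupoid C D) F G = {\<eta>. is_nat_iso C D F G \<eta>}"
  "Ident (Fun_groupoid C D) F = (\<lambda>x\<in>Ob C. Ident D (on_ob F x))"
  "Comp (Fun_groupoid C D) F G H \<theta> \<eta>
    = (\<lambda>x\<in>Ob C. Comp D (on_ob F x) (on_ob G x) (on_ob H x) (\<theta> x) (\<eta> x))"
  by (simp_all add: Fun_groupoid_def)

lemma is_groupoid_Fun_groupoid:
  assumes D: "is_category D"
  shows "is_groupoid (Fun_groupoid C D)"
  unfolding is_groupoid_def
proof (intro conjI ballI)
  have hom: "\<eta> x \<in> Hom D (on_ob F x) (on_ob G x)" if "is_nat_iso C D F G \<eta>" "x \<in> Ob C" for F G \<eta> x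
    using nat_iso_iso[OF that] by (rule is_iso_in_Hom)
  have ext: "restrict \<eta> (Ob C) = \<eta>" if "is_nat_iso C D F G \<eta>" for F G \<eta>
    using nat_iso_ext[OF that] by (simp add: extensional_restrict)
  show "is_category (Fun_groupoid C D)"
    unfolding is_category_def Fun_groupoid_simps mem_Collect_eq Ball_Collect
  proof (intro conjI ballI subsetI CollectI; (unfold mem_Collect_eq)?)
    fix F G \<eta> assume F: "is_functor C D F" and G: "is_functor C D G" and \<eta>: "is_nat_iso C D F G \<eta>"
    show "(\<lambda>x\<in>Ob C. Comp D (on_ob F x) (on_ob F x) (on_ob G x) (\<eta> x) ((\<lambda>x\<in>Ob C. Ident D (on_ob F x)) x)) = \<eta>"
      by (subst (2) ext[OF \<eta>, symmetric], rule restrict_ext)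
        (simp add: category_rules[OF D] functor_ob[OF F] functor_ob[OF G] hom[OF \<eta>])
    show "(\<lambda>x\<in>Ob C. Comp D (on_ob F x) (on_ob G x) (on_ob G x) ((\<lambda>x\<in>Ob C. Ident D (on_ob G x)) x) (\<eta> x)) = \<eta>"
      by (subst (2) ext[OF \<eta>, symmetric], rule restrict_ext)
        (simp add: category_rules[OF D] functor_ob[OF F] functor_ob[OF G] hom[OF \<eta>])
  next
    fix F G H L \<eta> \<theta> \<zeta>
    assume "is_functor C D F" "is_functor C D G" "is_functor C D H" "is_functor C D L"
      and "is_nat_iso C D F G \<eta>" "is_nat_iso C D G H \<theta>" "is_nat_iso C D H L \<zeta>"
    then show "(\<lambda>x\<in>Ob C. Comp D (on_ob F x) (on_ob H x) (on_ob L x) (\<zeta> x)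
          ((\<lambda>x\<in>Ob C. Comp D (on_ob F x) (on_ob G x) (on_ob H x) (\<theta> x) (\<eta> x)) x))
        = (\<lambda>x\<in>Ob C. Comp D (on_ob F x) (on_ob G x) (on_ob L x)
          ((\<lambda>x\<in>Ob C. Comp D (on_ob G x) (on_ob H x) (on_ob L x) (\<zeta> x) (\<theta> x)) x) (\<eta> x))"
      by (intro restrict_ext) (simp add: category_assoc[OF D] functor_ob hom)
  qed (simp_all add: nat_iso_ident[OF D] nat_iso_comp[OF D])
  fix F G \<eta> assume "F \<in> Ob (Fun_groupoid C D)" "G \<in> Ob (Fun_groupoid C D)" "\<eta> \<in> Hom (Fun_groupoid C D) F G"
  then have F: "is_functor C D F" and G: "is_functor C D G" and \<eta>: "is_nat_iso C D F G \<eta>" by simp_all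
  obtain \<theta> where \<theta>: "is_nat_iso C D G F \<theta>"
    "\<And>x. x \<in> Ob C \<Longrightarrow> Comp D (on_ob F x) (on_ob G x) (on_ob F x) (\<theta> x) (\<eta> x) = Ident D (on_ob F x)"
    "\<And>x. x \<in> Ob C \<Longrightarrow> Comp D (on_ob G x) (on_ob F x) (on_ob G x) (\<eta> x) (\<theta> x) = Ident D (on_ob G x)"
    using nat_iso_inverse[OF D F G \<eta>] by metis
  show "is_iso (Fun_groupoid C D) F G \<eta>"
    by (rule is_isoI[where g = \<theta>]) (use \<eta> \<theta> in \<open>auto intro!: restrict_ext\<close>)
qed


section \<open>Modules and their isomorphisms\<close>

lemma left_module_add_closed:
  "left_module R M \<Longrightarrow> x \<in> carrier M \<Longrightarrow> y \<in> carrier M \<Longrightarrow> x \<oplus>\<^bsub>M\<^esub> y \<in> carrier M"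
  by (simp add: left_module_def abelian_groupE(1))

lemma left_module_zero_closed: "left_module R M \<Longrightarrow> \<zero>\<^bsub>M\<^esub> \<in> carrier M"
  by (simp add: left_module_def abelian_groupE(2))

lemma module_homI:
  assumes "f \<in> extensional (carrier M)"
    and "\<And>x. x \<in> carrier M \<Longrightarrow> f x \<in> carrier N"
    and "\<And>x y. x \<in> carrier M \<Longrightarrow> y \<in> carrier M \<Longrightarrow> f (x \<oplus>\<^bsub>M\<^esub> y) = f x \<oplus>\<^bsub>N\<^esub> f y"
    and "\<And>a x. a \<in> carrier R \<Longrightarrow> x \<in> carrier M \<Longrightarrow> f (a \<odot>\<^bsub>M\<^esub> x) = a \<odot>\<^bsub>N\<^esub> f x"
  shows "f \<in> module_hom R M N"
  using assms by (auto simp: module_hom_def PiE_def)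

lemma module_hom_ext: "f \<in> module_hom R M N \<Longrightarrow> f \<in> extensional (carrier M)"
  by (auto simp: module_hom_def PiE_def)

lemma module_hom_closed: "f \<in> module_hom R M N \<Longrightarrow> x \<in> carrier M \<Longrightarrow> f x \<in> carrier N"
  by (auto simp: module_hom_def)

lemma module_hom_add:
  "f \<in> module_hom R M N \<Longrightarrow> x \<in> carrier M \<Longrightarrow> y \<in> carrier M \<Longrightarrow> f (x \<oplus>\<^bsub>M\<^esub> y) = f x \<oplus>\<^bsub>N\<^esub> f y"
  by (simp add: module_hom_def)

lemma module_hom_smult:
  "f \<in> module_hom R M N \<Longrightarrow> a \<in> carrier R \<Longrightarrow> x \<in> carrier M \<Longrightarrow> f (a \<odot>\<^bsub>M\<^esub> x) = a \<odot>\<^bsub>N\<^esub> f x"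
  by (simp add: module_hom_def)

lemma module_hom_zero:
  assumes f: "f \<in> module_hom R M N" and M: "left_module R M" and N: "left_module R N"
  shows "f \<zero>\<^bsub>M\<^esub> = \<zero>\<^bsub>N\<^esub>"
proof -
  interpret M: left_module R M by (rule M)
  interpret N: left_module R N by (rule N)
  have z: "f \<zero>\<^bsub>M\<^esub> \<in> carrier N" by (simp add: module_hom_closed[OF f])
  have "f \<zero>\<^bsub>M\<^esub> \<oplus>\<^bsub>N\<^esub> f \<zero>\<^bsub>M\<^esub> = f \<zero>\<^bsub>M\<^esub>"
    using module_hom_add[OF f, of "\<zero>\<^bsub>M\<^esub>" "\<zero>\<^bsub>M\<^esub>"] by simp
  then show ?thesis using z by simp
qed

lemma module_hom_compose:
  assumes f: "f \<in> module_hom R L M" and g: "g \<in> module_hom R M N"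
    and add: "\<And>x y. x \<in> carrier L \<Longrightarrow> y \<in> carrier L \<Longrightarrow> x \<oplus>\<^bsub>L\<^esub> y \<in> carrier L"
    and smult: "\<And>a x. a \<in> carrier R \<Longrightarrow> x \<in> carrier L \<Longrightarrow> a \<odot>\<^bsub>L\<^esub> x \<in> carrier L"
  shows "compose (carrier L) g f \<in> module_hom R L N"
  by (rule module_homI)
    (simp_all add: compose_eq module_hom_closed[OF f] module_hom_closed[OF g] module_hom_add[OF f]
      module_hom_add[OF g] module_hom_smult[OF f] module_hom_smult[OF g] add smult)

lemma module_hom_inverse:
  assumes f: "f \<in> module_hom R M N" and bij: "bij_betw f (carrier M) (carrier N)"
    and add: "\<And>x y. x \<in> carrier M \<Longrightarrow> y \<in> carrier M \<Longrightarrow> x \<oplus>\<^bsub>M\<^esub> y \<in> carrier M"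
    and smult: "\<And>a x. a \<in> carrier R \<Longrightarrow> x \<in> carrier M \<Longrightarrow> a \<odot>\<^bsub>M\<^esub> x \<in> carrier M"
  shows "restrict (inv_into (carrier M) f) (carrier N) \<in> module_hom R N M" (is "?g \<in> _")
proof -
  have gf: "inv_into (carrier M) f (f x) = x" if "x \<in> carrier M" for x
    using bij that by (simp add: bij_betw_def)
  have ex: "\<exists>x\<in>carrier M. u = f x" if "u \<in> carrier N" for u
    using bij that by (auto simp: bij_betw_def)
  show ?thesis
  proof (rule module_homI)
    fix u v assume "u \<in> carrier N" "v \<in> carrier N"
    then obtain x y where "x \<in> carrier M" "u = f x" "y \<in> carrier M" "v = f y" using ex by metis
    then show "?g (u \<oplus>\<^bsub>N\<^esub> v) = ?g u \<oplus>\<^bsub>M\<^esub> ?g v"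
      by (simp add: module_hom_add[OF f, symmetric] add gf module_hom_closed[OF f])
  next
    fix a u assume "a \<in> carrier R" "u \<in> carrier N"
    then obtain x where "x \<in> carrier M" "u = f x" "a \<in> carrier R" using ex by metis
    then show "?g (a \<odot>\<^bsub>N\<^esub> u) = a \<odot>\<^bsub>M\<^esub> ?g u"
      by (simp add: module_hom_smult[OF f, symmetric] smult gf module_hom_closed[OF f])
  next
    fix u assume "u \<in> carrier N"
    then show "?g u \<in> carrier M" using ex gf by (metis restrict_apply)
  qed simp
qed

text \<open>The operations of a stalk are defined through chosen representatives of germs, so its module
  axioms are best pulled back from a module to which it maps bijectively.\<close>

lemma left_module_transfer:
  assumes N: "left_module R N" and f: "f \<in> module_hom R M N" and bij: "bij_betw f (carrier M) (carrier N)"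
    and add: "\<And>x y. x \<in> carrier M \<Longrightarrow> y \<in> carrier M \<Longrightarrow> x \<oplus>\<^bsub>M\<^esub> y \<in> carrier M"
    and smult: "\<And>a x. a \<in> carrier R \<Longrightarrow> x \<in> carrier M \<Longrightarrow> a \<odot>\<^bsub>M\<^esub> x \<in> carrier M"
    and zero: "\<zero>\<^bsub>M\<^esub> \<in> carrier M" "f \<zero>\<^bsub>M\<^esub> = \<zero>\<^bsub>N\<^esub>"
  shows "left_module R M"
proof -
  interpret N: left_module R N by (rule N)
  have inj: "x = y" if "f x = f y" "x \<in> carrier M" "y \<in> carrier M" for x y
    using bij that by (auto simp: bij_betw_def inj_on_def)
  note hom = module_hom_add[OF f] module_hom_smult[OF f] module_hom_closed[OF f] add smult zero
  show ?thesis
  proof (intro left_module.intro left_module_axioms.intro abelian_groupI N.R.ring_axioms)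
    fix x assume x: "x \<in> carrier M"
    have "\<ominus>\<^bsub>N\<^esub> f x \<in> carrier N" using x by (simp add: hom)
    then obtain y where "y \<in> carrier M" "f y = \<ominus>\<^bsub>N\<^esub> f x"
      using bij by (metis bij_betw_def imageE)
    then have "f (y \<oplus>\<^bsub>M\<^esub> x) = f \<zero>\<^bsub>M\<^esub>" using x by (simp add: hom N.l_neg)
    then show "\<exists>y\<in>carrier M. y \<oplus>\<^bsub>M\<^esub> x = \<zero>\<^bsub>M\<^esub>"
      using \<open>y \<in> carrier M\<close> x inj by (meson add zero(1))
  next
    fix x y z assume "x \<in> carrier M" "y \<in> carrier M" "z \<in> carrier M"
    then show "x \<oplus>\<^bsub>M\<^esub> y \<oplus>\<^bsub>M\<^esub> z = x \<oplus>\<^bsub>M\<^esub> (y \<oplus>\<^bsub>M\<^esub> z)"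
      by (intro inj) (simp_all add: hom N.a_assoc)
  next
    fix x y assume "x \<in> carrier M" "y \<in> carrier M"
    then show "x \<oplus>\<^bsub>M\<^esub> y = y \<oplus>\<^bsub>M\<^esub> x" by (intro inj) (simp_all add: hom N.M.a_comm)
  next
    fix x assume "x \<in> carrier M"
    then show "\<zero>\<^bsub>M\<^esub> \<oplus>\<^bsub>M\<^esub> x = x" by (intro inj) (simp_all add: hom)
  next
    fix x assume "x \<in> carrier M"
    then show "\<one>\<^bsub>R\<^esub> \<odot>\<^bsub>M\<^esub> x = x" by (intro inj) (simp_all add: hom N.smult_one)
  next
    fix a b x assume "a \<in> carrier R" "b \<in> carrier R" "x \<in> carrier M"
    then show "(a \<oplus>\<^bsub>R\<^esub> b) \<odot>\<^bsub>M\<^esub> x = a \<odot>\<^bsub>M\<^esub> x \<oplus>\<^bsub>M\<^esub> b \<odot>\<^bsub>M\<^esub> x"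
      and "(a \<otimes>\<^bsub>R\<^esub> b) \<odot>\<^bsub>M\<^esub> x = a \<odot>\<^bsub>M\<^esub> (b \<odot>\<^bsub>M\<^esub> x)"
      by (intro inj; simp add: hom N.smult_l_distr N.smult_assoc)+
  next
    fix a x y assume "a \<in> carrier R" "x \<in> carrier M" "y \<in> carrier M"
    then show "a \<odot>\<^bsub>M\<^esub> (x \<oplus>\<^bsub>M\<^esub> y) = a \<odot>\<^bsub>M\<^esub> x \<oplus>\<^bsub>M\<^esub> a \<odot>\<^bsub>M\<^esub> y"
      by (intro inj) (simp_all add: hom N.smult_r_distr)
  qed (simp_all add: hom)
qed

lemma module_hom_finsum:
  assumes f: "f \<in> module_hom R M N" and M: "left_module R M" and N: "left_module R N"
    and S: "finite S" "\<And>s. s \<in> S \<Longrightarrow> h s \<in> carrier M"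
  shows "f (\<Oplus>\<^bsub>M\<^esub>s\<in>S. h s) = (\<Oplus>\<^bsub>N\<^esub>s\<in>S. f (h s))"
proof -
  interpret M: left_module R M by (rule M)
  interpret N: left_module R N by (rule N)
  show ?thesis
    using S
  proof (induction S rule: finite_induct)
    case empty
    then show ?case by (simp add: module_hom_zero[OF f M N])
  next
    case (insert s S)
    then show ?case
      by (simp add: M.finsum_insert N.finsum_insert Pi_def module_hom_add[OF f] module_hom_closed[OF f])
  qed
qed

text \<open>The generators pull back along \<open>f\<close>, and \<open>f\<close> and its inverse transport the splitting of the free
  module.\<close>

lemma fg_projective_transfer:
  fixes M N :: "('b, 'm) module"
  assumes N: "fg_projective R N" and M: "left_module R M"
    and f: "f \<in> module_hom R M N" and bij: "bij_betw f (carrier M) (carrier N)"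
  shows "fg_projective R M"
proof -
  have lN: "left_module R N" using N by (simp add: fg_projective_def)
  let ?g = "restrict (inv_into (carrier M) f) (carrier N)"
  note clM = left_module_add_closed[OF M] left_module.smult_closed[OF M]
  note clN = left_module_add_closed[OF lN] left_module.smult_closed[OF lN]
  have g: "?g \<in> module_hom R N M" by (rule module_hom_inverse[OF f bij clM])
  have gf: "?g (f x) = x" if "x \<in> carrier M" for x
    using bij that by (simp add: bij_betw_def module_hom_closed[OF f])
  have fg: "f (?g u) = u" if "u \<in> carrier N" for u
    using bij that by (simp add: bij_betw_def f_inv_into_f)
  obtain S where S: "finite S" "S \<subseteq> carrier N"
    "\<And>u. u \<in> carrier N \<Longrightarrow> \<exists>c\<in>S \<rightarrow> carrier R. u = (\<Oplus>\<^bsub>N\<^esub>s\<in>S. c s \<odot>\<^bsub>N\<^esub> s)"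
    using N by (auto simp: fg_projective_def finitely_generated_def)
  have gS: "?g ` S \<subseteq> carrier M" using S(2) module_hom_closed[OF g] by blast
  have injS: "inj_on ?g S" by (rule inj_onI) (metis S(2) fg subsetD)
  have fin: "finitely_generated R M"
    unfolding finitely_generated_def
  proof (intro exI[of _ "?g ` S"] conjI ballI)
    fix x assume x: "x \<in> carrier M"
    obtain c where c: "c \<in> S \<rightarrow> carrier R" "f x = (\<Oplus>\<^bsub>N\<^esub>s\<in>S. c s \<odot>\<^bsub>N\<^esub> s)"
      using S(3)[OF module_hom_closed[OF f x]] by blast
    have cl: "c s \<in> carrier R" "s \<in> carrier N" if "s \<in> S" for s using that c(1) S(2) by auto
    have "x = ?g (f x)" using gf[OF x] by simp
    also have "\<dots> = (\<Oplus>\<^bsub>M\<^esub>s\<in>S. ?g (c s \<odot>\<^bsub>N\<^esub> s))"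
      unfolding c(2) by (rule module_hom_finsum[OF g lN M S(1)]) (simp add: clN cl)
    also have "\<dots> = (\<Oplus>\<^bsub>M\<^esub>s\<in>S. c s \<odot>\<^bsub>M\<^esub> ?g s)"
    proof (rule abelian_monoid.finsum_cong')
      show "abelian_monoid M" using M by (simp add: left_module_def abelian_group_def)
    qed (use cl clM module_hom_smult[OF g] module_hom_closed[OF g] in auto)
    also have "\<dots> = (\<Oplus>\<^bsub>M\<^esub>s\<in>S. (c \<circ> f) (?g s) \<odot>\<^bsub>M\<^esub> ?g s)"
    proof (rule abelian_monoid.finsum_cong')
      show "abelian_monoid M" using M by (simp add: left_module_def abelian_group_def)
    qed (use cl clM fg module_hom_closed[OF g] in auto)
    also have "\<dots> = (\<Oplus>\<^bsub>M\<^esub>s\<in>?g ` S. (c \<circ> f) s \<odot>\<^bsub>M\<^esub> s)"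
    proof (rule abelian_monoid.finsum_reindex[symmetric, OF _ _ injS])
      show "abelian_monoid M" using M by (simp add: left_module_def abelian_group_def)
      show "(\<lambda>s. (c \<circ> f) s \<odot>\<^bsub>M\<^esub> s) \<in> ?g ` S \<rightarrow> carrier M"
        using cl clM fg module_hom_closed[OF g] by fastforce
    qed
    finally have "x = (\<Oplus>\<^bsub>M\<^esub>s\<in>?g ` S. (c \<circ> f) s \<odot>\<^bsub>M\<^esub> s)" .
    moreover have "c \<circ> f \<in> ?g ` S \<rightarrow> carrier R" using cl fg by fastforce
    ultimately show "\<exists>c\<in>?g ` S \<rightarrow> carrier R. x = (\<Oplus>\<^bsub>M\<^esub>s\<in>?g ` S. c s \<odot>\<^bsub>M\<^esub> s)" by blast
  qed (use S gS in auto)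
  obtain I :: "'m set" and i p where ip: "i \<in> module_hom R N (free_module R I)"
    "p \<in> module_hom R (free_module R I) N" "\<And>x. x \<in> carrier N \<Longrightarrow> p (i x) = x"
    using N by (auto simp: fg_projective_def projective_def)
  interpret R: ring R using M by (simp add: left_module_def)
  have fadd: "x \<oplus>\<^bsub>free_module R I\<^esub> y \<in> carrier (free_module R I)"
    if "x \<in> carrier (free_module R I)" "y \<in> carrier (free_module R I)" for x y
  proof -
    have "finite ({i \<in> I. x i \<noteq> \<zero>\<^bsub>R\<^esub>} \<union> {i \<in> I. y i \<noteq> \<zero>\<^bsub>R\<^esub>})"
      using that by (simp add: free_module_def)
    then have "finite {i \<in> I. x i \<oplus>\<^bsub>R\<^esub> y i \<noteq> \<zero>\<^bsub>R\<^esub>}" by (rule rev_finite_subset) auto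
    then show ?thesis
      using that by (auto simp: free_module_def PiE_mem cong: conj_cong)
  qed
  have fsmult: "a \<odot>\<^bsub>free_module R I\<^esub> x \<in> carrier (free_module R I)"
    if "a \<in> carrier R" "x \<in> carrier (free_module R I)" for a x
  proof -
    have "finite {i \<in> I. x i \<noteq> \<zero>\<^bsub>R\<^esub>}"
      using that by (simp add: free_module_def)
    then have "finite {i \<in> I. a \<otimes>\<^bsub>R\<^esub> x i \<noteq> \<zero>\<^bsub>R\<^esub>}" by (rule rev_finite_subset) (use that in auto)
    then show ?thesis
      using that by (auto simp: free_module_def PiE_mem cong: conj_cong)
  qed
  have "projective R M"
    unfolding projective_def
  proof (intro exI conjI ballI)
    show "compose (carrier M) i f \<in> module_hom R M (free_module R I)"
      by (rule module_hom_compose[OF f ip(1) clM])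
    show "compose (carrier (free_module R I)) ?g p \<in> module_hom R (free_module R I) M"
      by (rule module_hom_compose[OF ip(2) g fadd fsmult])
    fix x assume "x \<in> carrier M"
    then show "compose (carrier (free_module R I)) ?g p (compose (carrier M) i f x) = x"
      by (simp add: compose_eq module_hom_closed[OF f] module_hom_closed[OF ip(1)] ip(3) gf del: restrict_apply)
  qed
  then show ?thesis using fin M by (simp add: fg_projective_def)
qed

lemma Proj_simps [simp]:
  "Ob (Proj R) = {M. fg_projective R M}" "Hom (Proj R) = module_hom R"
  "Ident (Proj R) M = (\<lambda>x\<in>carrier M. x)" "Comp (Proj R) L M N g f = compose (carrier L) g f"
  by (simp_all add: Proj_def)

lemma fg_projective_left_module: "fg_projective R M \<Longrightarrow> left_module R M"
  by (simp add: fg_projective_def)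

lemma is_category_Proj: "is_category (Proj R)"
  unfolding is_category_def
proof (intro conjI ballI)
  fix M assume "M \<in> Ob (Proj R)"
  then have M: "left_module R M" by (simp add: fg_projective_left_module)
  show "Ident (Proj R) M \<in> Hom (Proj R) M M"
    by (simp, rule module_homI) (simp_all add: left_module_add_closed[OF M] left_module.smult_closed[OF M])
next
  fix L M N f g assume "L \<in> Ob (Proj R)" and *: "f \<in> Hom (Proj R) L M" "g \<in> Hom (Proj R) M N"
  then have L: "left_module R L" by (simp add: fg_projective_left_module)
  show "Comp (Proj R) L M N g f \<in> Hom (Proj R) L N"
    using * module_hom_compose[OF _ _ left_module_add_closed[OF L] left_module.smult_closed[OF L]] by simp
next
  fix M N f assume "f \<in> Hom (Proj R) M N"
  then have f: "f \<in> module_hom R M N" by simp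
  show "Comp (Proj R) M M N f (Ident (Proj R) M) = f"
    by (rule extensionalityI[where A = "carrier M"]) (simp_all add: module_hom_ext[OF f] compose_eq)
  show "Comp (Proj R) M N N (Ident (Proj R) N) f = f"
    by (rule extensionalityI[where A = "carrier M"]) (simp_all add: module_hom_ext[OF f] compose_eq module_hom_closed[OF f])
next
  fix L M N P f g h assume "f \<in> Hom (Proj R) L M"
  then show "Comp (Proj R) L N P h (Comp (Proj R) L M N g f) = Comp (Proj R) L M P (Comp (Proj R) M N P h g) f"
    by (auto simp: compose_def restrict_def fun_eq_iff module_hom_closed)
qed

lemma is_iso_Proj:
  assumes "left_module R M"
  shows "is_iso (Proj R) M N f \<longleftrightarrow> f \<in> module_iso R M N"
proof
  assume "is_iso (Proj R) M N f"
  then obtain g where f: "f \<in> module_hom R M N" and g: "g \<in> module_hom R N M"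
    and 1: "compose (carrier M) g f = (\<lambda>x\<in>carrier M. x)"
    and 2: "compose (carrier N) f g = (\<lambda>x\<in>carrier N. x)"
    by (auto simp: is_iso_def)
  have "g (f x) = x" if "x \<in> carrier M" for x using fun_cong[OF 1, of x] that by (simp add: compose_eq)
  moreover have "f (g x) = x" if "x \<in> carrier N" for x using fun_cong[OF 2, of x] that by (simp add: compose_eq)
  ultimately have "bij_betw f (carrier M) (carrier N)"
    by (intro bij_betwI[where g = g]) (auto simp: module_hom_closed[OF f] module_hom_closed[OF g])
  then show "f \<in> module_iso R M N" using f by (simp add: module_iso_def)
next
  assume "f \<in> module_iso R M N"
  then have f: "f \<in> module_hom R M N" and bij: "bij_betw f (carrier M) (carrier N)"
    by (simp_all add: module_iso_def)
  show "is_iso (Proj R) M N f"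
  proof (rule is_isoI)
    show "f \<in> Hom (Proj R) M N" using f by simp
    show "restrict (inv_into (carrier M) f) (carrier N) \<in> Hom (Proj R) N M"
      using module_hom_inverse[OF f bij left_module_add_closed[OF assms] left_module.smult_closed[OF assms]]
      by simp
  qed (use f bij in \<open>auto simp: compose_def fun_eq_iff restrict_def bij_betw_def f_inv_into_f module_hom_closed\<close>)
qed

lemma module_iso_comp:
  assumes L: "left_module R L" and f: "f \<in> module_iso R L M" and g: "g \<in> module_iso R M N"
  shows "compose (carrier L) g f \<in> module_iso R L N"
proof -
  have "bij_betw (g \<circ> f) (carrier L) (carrier N)"
    using f g by (auto simp: module_iso_def intro: bij_betw_trans)
  then have "bij_betw (compose (carrier L) g f) (carrier L) (carrier N)"
    by (rule iffD1[OF bij_betw_cong, rotated]) (simp add: compose_eq)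
  then show ?thesis
    using module_hom_compose[where R = R and L = L, OF _ _ left_module_add_closed[OF L]
        left_module.smult_closed[OF L]] f g
    unfolding module_iso_def by blast
qed

lemma module_iso_ident:
  assumes "left_module R M"
  shows "(\<lambda>x\<in>carrier M. x) \<in> module_iso R M M"
proof -
  have "(\<lambda>x\<in>carrier M. x) \<in> module_hom R M M"
    by (rule module_homI) (simp_all add: left_module_add_closed[OF assms] left_module.smult_closed[OF assms])
  moreover have "bij_betw (\<lambda>x\<in>carrier M. x) (carrier M) (carrier M)"
    by (auto simp: bij_betw_def inj_on_def)
  ultimately show ?thesis by (simp add: module_iso_def)
qed

lemma module_iso_closed: "f \<in> module_iso R M N \<Longrightarrow> x \<in> carrier M \<Longrightarrow> f x \<in> carrier N"
  by (auto simp: module_iso_def dest: module_hom_closed)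

lemma module_iso_extensional: "f \<in> module_iso R M N \<Longrightarrow> f \<in> extensional (carrier M)"
  by (auto simp: module_iso_def dest: module_hom_ext)

lemma is_category_core_Proj: "is_category (core (Proj R))"
  using is_groupoid_core[OF is_category_Proj, of R] unfolding is_groupoid_def by (rule conjunct1)


section \<open>Paths and their homotopy classes\<close>

lemma path_homotopic_refl: "pathin X g \<Longrightarrow> path_homotopic X g g"
  by (simp add: path_homotopic_def pathin_def)

lemma path_homotopic_ends: "path_homotopic X g h \<Longrightarrow> h 0 = g 0 \<and> h 1 = g 1"
  unfolding path_homotopic_def by (drule homotopic_with_imp_property) simp

lemma path_homotopic_pathin: "path_homotopic X g h \<Longrightarrow> pathin X g \<and> pathin X h"
  unfolding path_homotopic_def pathin_def by (rule homotopic_with_imp_continuous_maps)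

lemma path_homotopic_sym: "path_homotopic X g h \<Longrightarrow> path_homotopic X h g"
  using path_homotopic_ends[of X g h] unfolding path_homotopic_def by (simp add: homotopic_with_symD)

lemma path_homotopic_trans: "path_homotopic X f g \<Longrightarrow> path_homotopic X g h \<Longrightarrow> path_homotopic X f h"
  using path_homotopic_ends[of X f g] unfolding path_homotopic_def by (auto elim: homotopic_with_trans)

lemma path_class_eq: "path_homotopic X g h \<Longrightarrow> path_class X g = path_class X h"
  unfolding path_class_def by (blast intro: path_homotopic_trans path_homotopic_sym)

lemma path_homotopicE:
  assumes "path_homotopic X g h"
  obtains H where "continuous_map (top_of_set ({0..1::real} \<times> {0..1::real})) X H"
    "\<And>t. H (0, t) = g t" "\<And>t. H (1, t) = h t"
    "\<And>s. s \<in> {0..1} \<Longrightarrow> H (s, 0) = g 0" "\<And>s. s \<in> {0..1} \<Longrightarrow> H (s, 1) = g 1"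
  using assms unfolding path_homotopic_def homotopic_with_def by auto

lemma path_homotopicI:
  assumes "continuous_map (top_of_set ({0..1::real} \<times> {0..1::real})) X H"
    and "\<And>t. H (0, t) = g t" "\<And>t. H (1, t) = h t"
    and "\<And>s. s \<in> {0..1} \<Longrightarrow> H (s, 0) = g 0" "\<And>s. s \<in> {0..1} \<Longrightarrow> H (s, 1) = g 1"
  shows "path_homotopic X g h"
  unfolding path_homotopic_def homotopic_with_def using assms by (intro exI[of _ H]) auto

lemma pathin_in_topspace: "pathin X \<gamma> \<Longrightarrow> t \<in> {0..1} \<Longrightarrow> \<gamma> t \<in> topspace X"
  using path_image_subset_topspace by blast

lemma pathin_continuous_on_subset:
  assumes "pathin X \<gamma>" "A \<subseteq> {0..1}"
  shows "continuous_map (top_of_set A) X \<gamma>"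
  using continuous_map_from_subtopology[of "top_of_set {0..1}" X \<gamma> A] assms
  by (simp add: pathin_def subtopology_subtopology Int_absorb1)

lemma pathin_reparam:
  assumes "pathin X \<gamma>" "continuous_on {0..1} k" "k ` {0..1} \<subseteq> {0..1}"
  shows "pathin X (\<lambda>t. \<gamma> (k t))"
proof -
  have "continuous_map (top_of_set {0..1}) (top_of_set {0..1}) k"
    using assms(2,3) by (simp add: continuous_map_iff_continuous continuous_map_in_subtopology Pi_def image_subset_iff)
  from continuous_map_compose[OF this] assms(1) show ?thesis by (simp add: pathin_def o_def)
qed

text \<open>Two reparametrisations with the same endpoints are homotopic inside the unit interval by the
  linear homotopy. The groupoid laws that are needed for paths are all instances of this.\<close>

lemma path_homotopic_reparam:
  assumes \<gamma>: "pathin X \<gamma>"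
    and k: "continuous_on {0..1} k" "k ` {0..1} \<subseteq> {0..1}"
    and l: "continuous_on {0..1} l" "l ` {0..1} \<subseteq> {0..1}"
    and ends: "k 0 = l 0" "k 1 = l 1"
  shows "path_homotopic X (\<lambda>t. \<gamma> (k t)) (\<lambda>t. \<gamma> (l t))"
proof (rule path_homotopicI)
  let ?h = "\<lambda>z. (1 - fst z) * k (snd z) + fst z * l (snd z)"
  have comp: "continuous_on ({0..1} \<times> {0..1}) (\<lambda>z::real \<times> real. m (snd z))"
    if "continuous_on {0..1} m" for m :: "real \<Rightarrow> real"
    by (rule continuous_on_compose2[OF that]) (auto intro!: continuous_intros)
  have "continuous_on ({0..1} \<times> {0..1}) ?h"
    by (intro continuous_intros comp k l)
  moreover have "?h z \<in> {0..1}" if "z \<in> {0..1} \<times> {0..1}" for z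
  proof -
    have "k (snd z) \<in> {0..1}" "l (snd z) \<in> {0..1}" "fst z \<in> {0..1}" using that k(2) l(2) by force+
    then show ?thesis
      using convexD_alt[of "{0..1::real}" "k (snd z)" "l (snd z)" "fst z"] by simp
  qed
  ultimately have "continuous_map (top_of_set ({0..1} \<times> {0..1})) (top_of_set {0..1}) ?h"
    unfolding continuous_map_subtopology_eu by blast
  from continuous_map_compose[OF this] \<gamma>
  show "continuous_map (top_of_set ({0..1} \<times> {0..1})) X (\<lambda>z. \<gamma> (?h z))"
    by (simp add: pathin_def o_def)
  show "\<gamma> (?h (s, 0)) = \<gamma> (k 0)" "\<gamma> (?h (s, 1)) = \<gamma> (k 1)" for s
    by (simp_all add: ends flip: distrib_right)
qed simp_all

lemma path_join_ends [simp]: "path_join g h 0 = g 0" "path_join g h 1 = h 1"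
  by (simp_all add: path_join_def)

lemma pathin_join:
  assumes "pathin X g" "pathin X h" "g 1 = h 0"
  shows "pathin X (path_join g h)"
proof -
  have "continuous_map (top_of_set {0..1}) X (\<lambda>t. if t \<le> 1/2 then g (2 * t) else h (2 * t - 1))"
  proof (rule continuous_map_cases_le)
    show "continuous_map (subtopology (top_of_set {0..1}) {t \<in> topspace (top_of_set {0..1}). t \<le> 1/2}) X
        (\<lambda>t. g (2 * t))"
      by (rule continuous_map_compose[where g = g and f = "\<lambda>t. 2 * t" and X' = "top_of_set {0..1}", unfolded o_def])
        (use assms in \<open>auto simp: pathin_def subtopology_subtopology continuous_map_in_subtopology
          intro!: continuous_intros\<close>)
    show "continuous_map (subtopology (top_of_set {0..1}) {t \<in> topspace (top_of_set {0..1}). 1/2 \<le> t}) X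
        (\<lambda>t. h (2 * t - 1))"
      by (rule continuous_map_compose[where g = h and f = "\<lambda>t. 2 * t - 1" and X' = "top_of_set {0..1}", unfolded o_def])
        (use assms in \<open>auto simp: pathin_def subtopology_subtopology continuous_map_in_subtopology
          intro!: continuous_intros\<close>)
    show "continuous_map (top_of_set {0..1}) euclideanreal (\<lambda>t. t)"
      and "continuous_map (top_of_set {0..1}) euclideanreal (\<lambda>t. 1/2)" by simp_all
    show "g (2 * t) = h (2 * t - 1)" if "t = 1/2" for t
      using assms(3) by (simp add: that)
  qed
  then show ?thesis by (simp add: pathin_def path_join_def)
qed

lemma path_homotopic_join:
  assumes g: "path_homotopic X g g'" and h: "path_homotopic X h h'" and ends: "g 1 = h 0"
  shows "path_homotopic X (path_join g h) (path_join g' h')"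
proof -
  obtain G where G: "continuous_map (top_of_set ({0..1::real} \<times> {0..1::real})) X G"
    "\<And>t. G (0, t) = g t" "\<And>t. G (1, t) = g' t"
    "\<And>s. s \<in> {0..1} \<Longrightarrow> G (s, 0) = g 0" "\<And>s. s \<in> {0..1} \<Longrightarrow> G (s, 1) = g 1"
    using g by (rule path_homotopicE) blast
  obtain H where H: "continuous_map (top_of_set ({0..1::real} \<times> {0..1::real})) X H"
    "\<And>t. H (0, t) = h t" "\<And>t. H (1, t) = h' t"
    "\<And>s. s \<in> {0..1} \<Longrightarrow> H (s, 0) = h 0" "\<And>s. s \<in> {0..1} \<Longrightarrow> H (s, 1) = h 1"
    using h by (rule path_homotopicE) blast
  let ?Q = "{0..1::real} \<times> {0..1::real}"
  let ?K = "\<lambda>z. if snd z \<le> 1/2 then G (fst z, 2 * snd z) else H (fst z, 2 * snd z - 1)"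
  have "continuous_map (top_of_set ?Q) X ?K"
  proof (rule continuous_map_cases_le)
    show "continuous_map (subtopology (top_of_set ?Q) {z \<in> topspace (top_of_set ?Q). snd z \<le> 1/2}) X
        (\<lambda>z. G (fst z, 2 * snd z))"
      by (rule continuous_map_compose[where g = G and f = "\<lambda>z. (fst z, 2 * snd z)" and X' = "top_of_set ?Q", unfolded o_def])
        (use G in \<open>auto simp: subtopology_subtopology continuous_map_in_subtopology
          intro!: continuous_intros\<close>)
    show "continuous_map (subtopology (top_of_set ?Q) {z \<in> topspace (top_of_set ?Q). 1/2 \<le> snd z}) X
        (\<lambda>z. H (fst z, 2 * snd z - 1))"
      by (rule continuous_map_compose[where g = H and f = "\<lambda>z. (fst z, 2 * snd z - 1)" and X' = "top_of_set ?Q", unfolded o_def])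
        (use H in \<open>auto simp: subtopology_subtopology continuous_map_in_subtopology
          intro!: continuous_intros\<close>)
    show "continuous_map (top_of_set ?Q) euclideanreal snd"
      by (simp add: continuous_on_snd)
    show "continuous_map (top_of_set ?Q) euclideanreal (\<lambda>z. 1/2)" by simp
    show "G (fst z, 2 * snd z) = H (fst z, 2 * snd z - 1)"
      if "z \<in> topspace (top_of_set ?Q)" "snd z = 1/2" for z
    proof -
      have "fst z \<in> {0..1}" "2 * snd z = 1" using that by auto
      then show ?thesis using G(5) H(4) ends by simp
    qed
  qed
  then show ?thesis
    by (rule path_homotopicI) (use G H in \<open>auto simp: path_join_def\<close>)
qed

text \<open>Composition in the fundamental groupoid is a union over representatives; as joining respects
  homotopy, one pair of representatives suffices.\<close>

lemma path_class_join:
  assumes "pathin X g" "pathin X h" "g 1 = h 0"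
  shows "Comp (fundamental_groupoid X) x y z (path_class X h) (path_class X g) = path_class X (path_join g h)"
proof -
  have "path_homotopic X (path_join g h) k"
    if "path_homotopic X g f" "path_homotopic X h f'" "path_homotopic X (path_join f f') k" for f f' k
    using path_homotopic_trans[OF path_homotopic_join[OF that(1,2) assms(3)] that(3)] .
  then show ?thesis
    using assms by (auto simp: fundamental_groupoid_def path_class_def intro: path_homotopic_refl)
qed

lemma fundamental_groupoid_simps [simp]:
  "Ob (fundamental_groupoid X) = topspace X"
  "Hom (fundamental_groupoid X) x y = {path_class X g |g. pathin X g \<and> g 0 = x \<and> g 1 = y}"
  "Ident (fundamental_groupoid X) x = path_class X (\<lambda>_. x)"
  by (simp_all add: fundamental_groupoid_def)

text \<open>The part of a path between two parameters, run through backwards if \<open>b < a\<close>.\<close>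

definition subpath_between :: "real \<Rightarrow> real \<Rightarrow> (real \<Rightarrow> 'a) \<Rightarrow> real \<Rightarrow> 'a" where
  "subpath_between a b \<gamma> = (\<lambda>t. \<gamma> (a + t * (b - a)))"

lemma subpath_between_ends [simp]: "subpath_between a b \<gamma> 0 = \<gamma> a" "subpath_between a b \<gamma> 1 = \<gamma> b"
  by (simp_all add: subpath_between_def)

lemma subpath_between_0_1 [simp]: "subpath_between 0 1 \<gamma> = \<gamma>"
  by (simp add: subpath_between_def)

lemma subpath_parameter_in_segment:
  assumes "a \<le> (b::real)" "t \<in> {0..1}"
  shows "a + t * (b - a) \<in> {a..b}" "b + t * (a - b) \<in> {a..b}"
proof -
  have "0 \<le> t * (b - a)" "t * (b - a) \<le> 1 * (b - a)"
    using assms by (auto intro: mult_left_le_one_le)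
  moreover have "t * (a - b) = - (t * (b - a))" by (simp add: algebra_simps)
  ultimately show "a + t * (b - a) \<in> {a..b}" "b + t * (a - b) \<in> {a..b}" by auto
qed

lemma subpath_parameter:
  assumes "a \<in> {0..1}" "b \<in> {0..1}" "t \<in> {0..1::real}"
  shows "a + t * (b - a) \<in> {0..1}"
  using subpath_parameter_in_segment[of a b t] subpath_parameter_in_segment[of b a t] assms
  by (cases "a \<le> b") auto

lemma pathin_subpath_between:
  assumes "pathin X \<gamma>" "a \<in> {0..1}" "b \<in> {0..1}"
  shows "pathin X (subpath_between a b \<gamma>)"
  unfolding subpath_between_def
  by (rule pathin_reparam[OF assms(1)])
    (use subpath_parameter[OF assms(2,3)] in \<open>auto intro!: continuous_intros\<close>)

lemma path_homotopic_subpath_join: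
  assumes \<gamma>: "pathin X \<gamma>" and abc: "a \<in> {0..1}" "b \<in> {0..1}" "c \<in> {0..1}"
  shows "path_homotopic X (path_join (subpath_between a b \<gamma>) (subpath_between b c \<gamma>)) (subpath_between a c \<gamma>)"
proof -
  let ?k = "\<lambda>t. if t \<le> 1/2 then a + 2 * t * (b - a) else b + (2 * t - 1) * (c - b)"
  have "continuous_on ({0..1/2} \<union> {1/2..1}) ?k"
    by (rule continuous_on_If) (auto intro!: continuous_intros simp: algebra_simps)
  then have k: "continuous_on {0..1} ?k" by (simp add: split_01)
  have "?k t \<in> {0..1}" if "t \<in> {0..1}" for t
    using subpath_parameter[of a b "2 * t"] subpath_parameter[of b c "2 * t - 1"] abc that by auto
  then have k': "?k ` {0..1} \<subseteq> {0..1}" by (rule image_subsetI)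
  have l: "continuous_on {0..1} (\<lambda>t. a + t * (c - a))" by (intro continuous_intros)
  have l': "(\<lambda>t. a + t * (c - a)) ` {0..1} \<subseteq> {0..1}"
    using subpath_parameter abc by (intro image_subsetI) blast
  have "path_homotopic X (\<lambda>t. \<gamma> (?k t)) (\<lambda>t. \<gamma> (a + t * (c - a)))"
    by (rule path_homotopic_reparam[OF \<gamma> k k' l l']) simp_all
  then show ?thesis
    by (simp add: path_join_def subpath_between_def if_distrib[of \<gamma>])
qed

lemma subpath_between_same: "subpath_between a a \<gamma> = (\<lambda>_. \<gamma> a)"
  by (simp add: subpath_between_def)

lemma short_subpaths_in_open:
  assumes \<gamma>: "pathin X \<gamma>" and U: "openin X U" and t: "t \<in> {0..1}" "\<gamma> t \<in> U"
  obtains d where "d > 0"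
    "\<And>s. s \<in> {0..1} \<Longrightarrow> dist s t < d \<Longrightarrow> pathin (subtopology X U) (subpath_between t s \<gamma>)"
proof -
  have "openin (top_of_set {0..1}) {y \<in> {0..1}. \<gamma> y \<in> U}"
    using openin_continuous_map_preimage[OF \<gamma>[unfolded pathin_def] U] by simp
  then obtain d where d: "d > 0" "\<And>y. y \<in> {0..1} \<Longrightarrow> dist y t < d \<Longrightarrow> \<gamma> y \<in> U"
    using t unfolding openin_euclidean_subtopology_iff by blast
  have "pathin (subtopology X U) (subpath_between t s \<gamma>)" if s: "s \<in> {0..1}" "dist s t < d" for s
    unfolding pathin_subtopology
  proof (intro conjI ballI)
    show "pathin X (subpath_between t s \<gamma>)" by (rule pathin_subpath_between[OF \<gamma> t(1) s(1)])
    fix u :: real assume u: "u \<in> {0..1}"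
    have "t + u * (s - t) \<in> {0..1}" by (rule subpath_parameter[OF t(1) s(1) u])
    moreover have "dist (t + u * (s - t)) t < d"
    proof -
      have "\<bar>u * (s - t)\<bar> \<le> \<bar>s - t\<bar>" using u by (simp add: abs_mult mult_left_le_one_le)
      then show ?thesis using s(2) by (simp add: dist_real_def)
    qed
    ultimately show "subpath_between t s \<gamma> u \<in> U" unfolding subpath_between_def by (rule d(2))
  qed
  with d(1) show ?thesis by (rule that)
qed

lemma path_between_in:
  assumes "path_connectedin X U" "x \<in> U" "y \<in> U"
  obtains \<gamma> where "pathin (subtopology X U) \<gamma>" "\<gamma> 0 = x" "\<gamma> 1 = y"
proof -
  have "path_connected_space (subtopology X U)" "x \<in> topspace (subtopology X U)" "y \<in> topspace (subtopology X U)"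
    using assms by (auto simp: path_connectedin_def)
  then show ?thesis using that by (auto simp: path_connected_space_def)
qed


section \<open>Locally constant functions\<close>

lemma locally_constant_onI:
  assumes "f \<in> U \<rightarrow>\<^sub>E S"
    and "\<And>x. x \<in> U \<Longrightarrow> \<exists>W. openin X W \<and> x \<in> W \<and> W \<subseteq> U \<and> (\<forall>y\<in>W. f y = f x)"
  shows "f \<in> locally_constant_on X U S"
  using assms by (simp add: locally_constant_on_def)

lemma locally_constant_onE:
  assumes "f \<in> locally_constant_on X U S" "x \<in> U"
  obtains W where "openin X W" "x \<in> W" "W \<subseteq> U" "\<And>y. y \<in> W \<Longrightarrow> f y = f x"
proof -
  have "\<exists>W. openin X W \<and> x \<in> W \<and> W \<subseteq> U \<and> (\<forall>y\<in>W. f y = f x)"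
    using assms by (simp add: locally_constant_on_def)
  then show ?thesis using that by (elim exE conjE) blast
qed

lemma locally_constant_on_PiE: "f \<in> locally_constant_on X U S \<Longrightarrow> f \<in> U \<rightarrow>\<^sub>E S"
  by (simp add: locally_constant_on_def)

lemma locally_constant_on_closed: "f \<in> locally_constant_on X U S \<Longrightarrow> x \<in> U \<Longrightarrow> f x \<in> S"
  by (auto simp: locally_constant_on_def)

lemma locally_constant_on_const:
  "openin X U \<Longrightarrow> c \<in> S \<Longrightarrow> (\<lambda>y\<in>U. c) \<in> locally_constant_on X U S"
  by (auto simp: locally_constant_on_def intro!: exI[of _ U])

lemma locally_constant_on_map2:
  assumes f: "f \<in> locally_constant_on X U S" and g: "g \<in> locally_constant_on X U T"
    and h: "\<And>x y. x \<in> S \<Longrightarrow> y \<in> T \<Longrightarrow> h x y \<in> R"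
  shows "(\<lambda>x\<in>U. h (f x) (g x)) \<in> locally_constant_on X U R"
proof (rule locally_constant_onI)
  fix x assume x: "x \<in> U"
  obtain V where V: "openin X V" "x \<in> V" "V \<subseteq> U" "\<And>y. y \<in> V \<Longrightarrow> f y = f x"
    using locally_constant_onE[OF f x] by metis
  obtain W where W: "openin X W" "x \<in> W" "W \<subseteq> U" "\<And>y. y \<in> W \<Longrightarrow> g y = g x"
    using locally_constant_onE[OF g x] by metis
  show "\<exists>W. openin X W \<and> x \<in> W \<and> W \<subseteq> U \<and>
      (\<forall>y\<in>W. (\<lambda>x\<in>U. h (f x) (g x)) y = (\<lambda>x\<in>U. h (f x) (g x)) x)"
  proof (intro exI conjI ballI)
    fix y assume y: "y \<in> V \<inter> W"
    then have "f y = f x" "g y = g x" using V(4) W(4) by blast+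
    then show "(\<lambda>x\<in>U. h (f x) (g x)) y = (\<lambda>x\<in>U. h (f x) (g x)) x"
      using x y V(3) by auto
  qed (use V(1,2,3) W(1,2) in auto)
qed (use f g h in \<open>auto dest: locally_constant_on_closed\<close>)

lemma locally_constant_on_subtopology:
  assumes "openin X U" "V \<subseteq> U"
  shows "locally_constant_on (subtopology X U) V S = locally_constant_on X V S"
proof -
  have "openin (subtopology X U) W \<and> x \<in> W \<and> W \<subseteq> V \<and> P \<longleftrightarrow> openin X W \<and> x \<in> W \<and> W \<subseteq> V \<and> P" for W x P
    using assms by (auto simp: openin_open_subtopology)
  then show ?thesis by (simp add: locally_constant_on_def)
qed

text \<open>Along a path, the set of parameters with a given value is open, and the unit interval is
  connected.\<close>

lemma locally_constant_on_path:
  assumes f: "f \<in> locally_constant_on X U S" and \<gamma>: "pathin (subtopology X U) \<gamma>"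
  shows "f (\<gamma> 0) = f (\<gamma> 1)"
proof -
  have \<gamma>': "pathin X \<gamma>" "\<And>t. t \<in> {0..1} \<Longrightarrow> \<gamma> t \<in> U" using \<gamma> by (auto simp: pathin_subtopology)
  have "f (\<gamma> 1) = f (\<gamma> 0)"
  proof (rule connected_induction_simple[where P = "\<lambda>t. f (\<gamma> t) = f (\<gamma> 0)" and S = "{0..1}"])
    fix t :: real assume t: "t \<in> {0..1}"
    obtain W where W: "openin X W" "\<gamma> t \<in> W" "W \<subseteq> U" "\<And>y. y \<in> W \<Longrightarrow> f y = f (\<gamma> t)"
      using locally_constant_onE[OF f \<gamma>'(2)[OF t]] by blast
    have "openin (top_of_set {0..1}) {s \<in> {0..1}. \<gamma> s \<in> W}"
      using openin_continuous_map_preimage[OF \<gamma>'(1)[unfolded pathin_def] W(1)] by simp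
    moreover have "f (\<gamma> s) = f (\<gamma> t)" if "s \<in> {s \<in> {0..1}. \<gamma> s \<in> W}" for s using that W(4) by blast
    ultimately show "\<exists>T. openin (top_of_set {0..1}) T \<and> t \<in> T \<and>
        (\<forall>x\<in>T. \<forall>y\<in>T. f (\<gamma> x) = f (\<gamma> 0) \<longrightarrow> f (\<gamma> y) = f (\<gamma> 0))"
      using t W(2) by (intro exI[of _ "{s \<in> {0..1}. \<gamma> s \<in> W}"]) (metis (mono_tags, lifting) mem_Collect_eq)
  qed auto
  then show ?thesis by simp
qed

lemma const_ring_simps [simp]:
  "carrier (const_ring X B U) = locally_constant_on X U (carrier B)"
  "f \<otimes>\<^bsub>const_ring X B U\<^esub> g = (\<lambda>x\<in>U. f x \<otimes>\<^bsub>B\<^esub> g x)"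
  "\<one>\<^bsub>const_ring X B U\<^esub> = (\<lambda>x\<in>U. \<one>\<^bsub>B\<^esub>)"
  "\<zero>\<^bsub>const_ring X B U\<^esub> = (\<lambda>x\<in>U. \<zero>\<^bsub>B\<^esub>)"
  "f \<oplus>\<^bsub>const_ring X B U\<^esub> g = (\<lambda>x\<in>U. f x \<oplus>\<^bsub>B\<^esub> g x)"
  by (simp_all add: const_ring_def)

lemma ring_const_ring:
  fixes X :: "'a topology" and B :: "('b, 'x) ring_scheme"
  assumes B: "ring B" and U: "openin X U"
  shows "ring (const_ring X B U)"
proof -
  interpret B: ring B by (rule B)
  note lc = locally_constant_on_map2[where S = "carrier B" and T = "carrier B" and R = "carrier B"]
  have cl: "f x \<in> carrier B" if "f \<in> carrier (const_ring X B U)" "x \<in> U" for f x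
    using that locally_constant_on_closed[of f X U "carrier B" x] by simp
  have eqI: "f = g" if "f \<in> extensional U" "g \<in> extensional U" "\<And>x. x \<in> U \<Longrightarrow> f x = g x" for f g :: "'a \<Rightarrow> 'b"
    using that by (rule extensionalityI)
  have ext: "f \<in> extensional U" if "f \<in> carrier (const_ring X B U)" for f
    using that locally_constant_on_PiE by (fastforce simp: PiE_def)
  have const: "(\<lambda>x\<in>U. c) \<in> locally_constant_on X U (carrier B)" if "c \<in> carrier B" for c
    using locally_constant_on_const[OF U that] .
  have group: "abelian_group (const_ring X B U)"
  proof (rule abelian_groupI)
    fix f assume f: "f \<in> carrier (const_ring X B U)"
    have "(\<lambda>x\<in>U. \<ominus>\<^bsub>B\<^esub> f x) \<in> locally_constant_on X U (carrier B)"
      using lc[of f X U f "\<lambda>x y. \<ominus>\<^bsub>B\<^esub> x"] f by simp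
    then show "\<exists>g\<in>carrier (const_ring X B U). g \<oplus>\<^bsub>const_ring X B U\<^esub> f = \<zero>\<^bsub>const_ring X B U\<^esub>"
      by (intro bexI[of _ "\<lambda>x\<in>U. \<ominus>\<^bsub>B\<^esub> f x"]) (auto intro!: eqI simp: cl[OF f] B.l_neg)
    show "\<zero>\<^bsub>const_ring X B U\<^esub> \<oplus>\<^bsub>const_ring X B U\<^esub> f = f"
      by (rule eqI) (simp_all add: cl[OF f] ext[OF f])
    fix g assume g: "g \<in> carrier (const_ring X B U)"
    show "f \<oplus>\<^bsub>const_ring X B U\<^esub> g \<in> carrier (const_ring X B U)" using f g by (simp add: lc)
    show "f \<oplus>\<^bsub>const_ring X B U\<^esub> g = g \<oplus>\<^bsub>const_ring X B U\<^esub> f"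
      by (rule eqI) (simp_all add: cl[OF f] cl[OF g] B.a_comm)
    fix h assume h: "h \<in> carrier (const_ring X B U)"
    show "f \<oplus>\<^bsub>const_ring X B U\<^esub> g \<oplus>\<^bsub>const_ring X B U\<^esub> h
        = f \<oplus>\<^bsub>const_ring X B U\<^esub> (g \<oplus>\<^bsub>const_ring X B U\<^esub> h)"
      by (rule eqI) (simp_all add: cl[OF f] cl[OF g] cl[OF h] B.a_assoc)
  qed (simp add: const)
  have monoid: "monoid (const_ring X B U)"
  proof (rule monoidI)
    fix f assume f: "f \<in> carrier (const_ring X B U)"
    show "\<one>\<^bsub>const_ring X B U\<^esub> \<otimes>\<^bsub>const_ring X B U\<^esub> f = f" "f \<otimes>\<^bsub>const_ring X B U\<^esub> \<one>\<^bsub>const_ring X B U\<^esub> = f"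
      by (rule eqI; simp add: cl[OF f] ext[OF f])+
    fix g assume g: "g \<in> carrier (const_ring X B U)"
    show "f \<otimes>\<^bsub>const_ring X B U\<^esub> g \<in> carrier (const_ring X B U)" using f g by (simp add: lc)
    fix h assume h: "h \<in> carrier (const_ring X B U)"
    show "f \<otimes>\<^bsub>const_ring X B U\<^esub> g \<otimes>\<^bsub>const_ring X B U\<^esub> h
        = f \<otimes>\<^bsub>const_ring X B U\<^esub> (g \<otimes>\<^bsub>const_ring X B U\<^esub> h)"
      by (rule eqI) (simp_all add: cl[OF f] cl[OF g] cl[OF h] B.m_assoc)
  qed (simp add: const)
  show ?thesis
  proof (rule ringI[OF group monoid])
    fix f g h assume f: "f \<in> carrier (const_ring X B U)" and g: "g \<in> carrier (const_ring X B U)"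
      and h: "h \<in> carrier (const_ring X B U)"
    show "(f \<oplus>\<^bsub>const_ring X B U\<^esub> g) \<otimes>\<^bsub>const_ring X B U\<^esub> h
        = f \<otimes>\<^bsub>const_ring X B U\<^esub> h \<oplus>\<^bsub>const_ring X B U\<^esub> g \<otimes>\<^bsub>const_ring X B U\<^esub> h"
      by (rule eqI) (simp_all add: cl[OF f] cl[OF g] cl[OF h] B.l_distr)
    show "h \<otimes>\<^bsub>const_ring X B U\<^esub> (f \<oplus>\<^bsub>const_ring X B U\<^esub> g)
        = h \<otimes>\<^bsub>const_ring X B U\<^esub> f \<oplus>\<^bsub>const_ring X B U\<^esub> h \<otimes>\<^bsub>const_ring X B U\<^esub> g"
      by (rule eqI) (simp_all add: cl[OF f] cl[OF g] cl[OF h] B.r_distr)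
  qed
qed

lemma const_sheaf_simps [simp]:
  "carrier (sec (const_sheaf X M) U) = locally_constant_on X U (carrier M)"
  "f \<oplus>\<^bsub>sec (const_sheaf X M) U\<^esub> g = (\<lambda>x\<in>U. f x \<oplus>\<^bsub>M\<^esub> g x)"
  "b \<odot>\<^bsub>sec (const_sheaf X M) U\<^esub> f = (\<lambda>x\<in>U. b x \<odot>\<^bsub>M\<^esub> f x)"
  "res (const_sheaf X M) U V f = restrict f V"
  by (simp_all add: const_sheaf_def)


section \<open>Germs and stalks\<close>

locale module_presheaf =
  fixes X :: "'a topology" and B :: "('b, 'x) ring_scheme" and E :: "('a, 'b, ('a, 'c) univ) msheaf"
  assumes presheaf: "is_presheaf X B E"
begin

lemma sec_module: "openin X U \<Longrightarrow> left_module (const_ring X B U) (sec E U)"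
  using presheaf by (simp add: is_presheaf_def)

lemma res_properties:
  assumes "openin X U" "openin X V" "V \<subseteq> U"
  shows "res E U V \<in> carrier (sec E U) \<rightarrow> carrier (sec E V) \<and>
      (\<forall>s\<in>carrier (sec E U). \<forall>t\<in>carrier (sec E U).
         res E U V (s \<oplus>\<^bsub>sec E U\<^esub> t) = res E U V s \<oplus>\<^bsub>sec E V\<^esub> res E U V t) \<and>
      (\<forall>b\<in>carrier (const_ring X B U). \<forall>s\<in>carrier (sec E U).
         res E U V (b \<odot>\<^bsub>sec E U\<^esub> s) = restrict b V \<odot>\<^bsub>sec E V\<^esub> res E U V s)"
  by (rule presheaf[unfolded is_presheaf_def, THEN conjunct2, THEN conjunct1, THEN spec, THEN spec, THEN mp])
    (use assms in simp)

lemma res_closed: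
  assumes "openin X U" "openin X V" "V \<subseteq> U" "s \<in> carrier (sec E U)"
  shows "res E U V s \<in> carrier (sec E V)"
  using res_properties[OF assms(1-3), THEN conjunct1] assms(4) by (rule funcset_mem)

lemma res_add:
  assumes "openin X U" "openin X V" "V \<subseteq> U" "s \<in> carrier (sec E U)" "t \<in> carrier (sec E U)"
  shows "res E U V (s \<oplus>\<^bsub>sec E U\<^esub> t) = res E U V s \<oplus>\<^bsub>sec E V\<^esub> res E U V t"
  using res_properties[OF assms(1-3), THEN conjunct2, THEN conjunct1] assms(4,5) by blast

lemma res_smult:
  assumes "openin X U" "openin X V" "V \<subseteq> U" "b \<in> locally_constant_on X U (carrier B)"
    "s \<in> carrier (sec E U)"
  shows "res E U V (b \<odot>\<^bsub>sec E U\<^esub> s) = restrict b V \<odot>\<^bsub>sec E V\<^esub> res E U V s"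
  using res_properties[OF assms(1-3), THEN conjunct2, THEN conjunct2] assms(4,5) by simp

lemma res_id: "openin X U \<Longrightarrow> s \<in> carrier (sec E U) \<Longrightarrow> res E U U s = s"
  using presheaf[unfolded is_presheaf_def, THEN conjunct2, THEN conjunct2, THEN conjunct1] by blast

lemma res_res:
  assumes "openin X U" "openin X V" "openin X W" "W \<subseteq> V" "V \<subseteq> U" "s \<in> carrier (sec E U)"
  shows "res E V W (res E U V s) = res E U W s"
  using presheaf[unfolded is_presheaf_def, THEN conjunct2, THEN conjunct2, THEN conjunct2] assms by blast

lemma sec_add_closed:
  "openin X U \<Longrightarrow> s \<in> carrier (sec E U) \<Longrightarrow> t \<in> carrier (sec E U) \<Longrightarrow> s \<oplus>\<^bsub>sec E U\<^esub> t \<in> carrier (sec E U)"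
  using left_module_add_closed[OF sec_module] by blast

lemma sec_smult_closed:
  "openin X U \<Longrightarrow> b \<in> locally_constant_on X U (carrier B) \<Longrightarrow> s \<in> carrier (sec E U) \<Longrightarrow>
    b \<odot>\<^bsub>sec E U\<^esub> s \<in> carrier (sec E U)"
  using left_module.smult_closed[OF sec_module] by simp

lemma sec_zero_closed: "openin X U \<Longrightarrow> \<zero>\<^bsub>sec E U\<^esub> \<in> carrier (sec E U)"
  using left_module_zero_closed[OF sec_module] by blast

lemma res_zero:
  assumes "openin X U" "openin X V" "V \<subseteq> U"
  shows "res E U V \<zero>\<^bsub>sec E U\<^esub> = \<zero>\<^bsub>sec E V\<^esub>"
proof -
  interpret U: left_module "const_ring X B U" "sec E U" by (rule sec_module[OF assms(1)])
  interpret V: left_module "const_ring X B V" "sec E V" by (rule sec_module[OF assms(2)])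
  let ?z = "res E U V \<zero>\<^bsub>sec E U\<^esub>"
  have "?z \<oplus>\<^bsub>sec E V\<^esub> ?z = ?z"
    using res_add[OF assms, of "\<zero>\<^bsub>sec E U\<^esub>" "\<zero>\<^bsub>sec E U\<^esub>"] by simp
  then show ?thesis using res_closed[OF assms] by simp
qed

lemma germ_rel_iff:
  "((U, s), (V, t)) \<in> germ_rel X E x \<longleftrightarrow> openin X U \<and> openin X V \<and> x \<in> U \<and> x \<in> V \<and>
     s \<in> carrier (sec E U) \<and> t \<in> carrier (sec E V) \<and>
     (\<exists>W. openin X W \<and> x \<in> W \<and> W \<subseteq> U \<and> W \<subseteq> V \<and> res E U W s = res E V W t)"
  by (auto simp: germ_rel_def)

lemma germ_rel_refl:
  "openin X U \<Longrightarrow> x \<in> U \<Longrightarrow> s \<in> carrier (sec E U) \<Longrightarrow> ((U, s), (U, s)) \<in> germ_rel X E x"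
  by (auto simp: germ_rel_iff)

lemma germ_rel_sym: "(p, q) \<in> germ_rel X E x \<Longrightarrow> (q, p) \<in> germ_rel X E x"
  by (cases p; cases q; simp add: germ_rel_iff; metis)

lemma germ_rel_trans:
  assumes "(p, q) \<in> germ_rel X E x" "(q, r) \<in> germ_rel X E x"
  shows "(p, r) \<in> germ_rel X E x"
proof -
  obtain U s V t Z u where p: "p = (U, s)" and q: "q = (V, t)" and r: "r = (Z, u)"
    by (metis surj_pair)
  obtain W1 where W1: "openin X W1" "x \<in> W1" "W1 \<subseteq> U" "W1 \<subseteq> V" "res E U W1 s = res E V W1 t"
    and 1: "openin X U" "openin X V" "x \<in> U" "x \<in> V" "s \<in> carrier (sec E U)" "t \<in> carrier (sec E V)"
    using assms(1) by (auto simp: p q germ_rel_iff)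
  obtain W2 where W2: "openin X W2" "x \<in> W2" "W2 \<subseteq> V" "W2 \<subseteq> Z" "res E V W2 t = res E Z W2 u"
    and 2: "openin X Z" "x \<in> Z" "u \<in> carrier (sec E Z)"
    using assms(2) by (auto simp: q r germ_rel_iff)
  have W: "openin X (W1 \<inter> W2)" using W1 W2 by blast
  have "res E U (W1 \<inter> W2) s = res E W1 (W1 \<inter> W2) (res E U W1 s)"
    by (rule res_res[symmetric]) (use 1 W1 W in auto)
  also have "\<dots> = res E V (W1 \<inter> W2) t"
    unfolding W1(5) by (rule res_res) (use 1 W1 W in auto)
  also have "\<dots> = res E W2 (W1 \<inter> W2) (res E V W2 t)"
    by (rule res_res[symmetric]) (use 1 W2 W in auto)
  also have "\<dots> = res E Z (W1 \<inter> W2) u"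
    unfolding W2(5) by (rule res_res) (use 2 W2 W in auto)
  finally show ?thesis
    using 1 2 W W1 W2 unfolding p r germ_rel_iff by (intro conjI exI[of _ "W1 \<inter> W2"]) auto
qed

lemma germ_representative:
  assumes "openin X U" "x \<in> U" "s \<in> carrier (sec E U)"
  obtains V t where "germ X E x U s = Germ V t" "((U, s), (V, t)) \<in> germ_rel X E x"
proof -
  let ?p = "SOME p. p \<in> germ_rel X E x `` {(U, s)}"
  have "?p \<in> germ_rel X E x `` {(U, s)}"
    by (rule someI[of _ "(U, s)"]) (use germ_rel_refl[OF assms] in blast)
  then show ?thesis using that by (cases ?p) (auto simp: germ_def)
qed

text \<open>The germ of \<open>s\<close> is a representative chosen from its class. Equivalent pairs have the same class,
  hence the same chosen representative; conversely a chosen representative determines its class.\<close>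

lemma germ_eq_iff:
  assumes "openin X U" "x \<in> U" "s \<in> carrier (sec E U)" "openin X V" "x \<in> V" "t \<in> carrier (sec E V)"
  shows "germ X E x U s = germ X E x V t \<longleftrightarrow>
    (\<exists>W. openin X W \<and> x \<in> W \<and> W \<subseteq> U \<and> W \<subseteq> V \<and> res E U W s = res E V W t)" (is "_ \<longleftrightarrow> ?R")
proof
  assume eq: "germ X E x U s = germ X E x V t"
  obtain Z u where "germ X E x U s = Germ Z u" "((U, s), (Z, u)) \<in> germ_rel X E x"
    using germ_representative[OF assms(1-3)] .
  moreover obtain Z' u' where "germ X E x V t = Germ Z' u'" "((V, t), (Z', u')) \<in> germ_rel X E x"
    using germ_representative[OF assms(4-6)] .
  ultimately have "((U, s), (V, t)) \<in> germ_rel X E x"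
    using eq germ_rel_sym germ_rel_trans by (metis univ.inject(2))
  then show ?R by (simp add: germ_rel_iff)
next
  assume ?R
  then have r: "((U, s), (V, t)) \<in> germ_rel X E x" using assms by (auto simp: germ_rel_iff)
  have "germ_rel X E x `` {(U, s)} = germ_rel X E x `` {(V, t)}"
    using r by (auto intro: germ_rel_trans germ_rel_sym)
  then show "germ X E x U s = germ X E x V t" by (simp add: germ_def)
qed

lemma germ_in_stalk:
  "openin X U \<Longrightarrow> x \<in> U \<Longrightarrow> s \<in> carrier (sec E U) \<Longrightarrow> germ X E x U s \<in> carrier (stalk X E x)"
  by (auto simp: stalk_def)

lemma stalkE:
  assumes "g \<in> carrier (stalk X E x)"
  obtains U s where "openin X U" "x \<in> U" "s \<in> carrier (sec E U)" "g = germ X E x U s"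
  using assms by (auto simp: stalk_def)

lemma germ_nbhd_section:
  assumes "g \<in> carrier (stalk X E x)"
  shows "openin X (germ_nbhd g)" "x \<in> germ_nbhd g" "germ_section g \<in> carrier (sec E (germ_nbhd g))"
    "germ X E x (germ_nbhd g) (germ_section g) = g"
proof -
  obtain U s where U: "openin X U" "x \<in> U" "s \<in> carrier (sec E U)" and g: "g = germ X E x U s"
    using assms by (rule stalkE)
  obtain V t where V: "g = Germ V t" "((U, s), (V, t)) \<in> germ_rel X E x"
    using germ_representative[OF U] g by metis
  then have *: "openin X V" "x \<in> V" "t \<in> carrier (sec E V)" by (simp_all add: germ_rel_iff)
  have e: "germ_nbhd g = V" "germ_section g = t" using V(1) by simp_all
  have "germ X E x V t = g" using V(2) U * by (simp add: g germ_eq_iff germ_rel_iff, metis)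
  with * show "openin X (germ_nbhd g)" "x \<in> germ_nbhd g" "germ_section g \<in> carrier (sec E (germ_nbhd g))"
    "germ X E x (germ_nbhd g) (germ_section g) = g"
    unfolding e by simp_all
qed

lemma germ_res:
  assumes "openin X U" "openin X V" "V \<subseteq> U" "x \<in> V" "s \<in> carrier (sec E U)"
  shows "germ X E x V (res E U V s) = germ X E x U s"
  using assms res_closed[OF assms(1,2,3,5)]
  by (subst germ_eq_iff) (auto intro!: exI[of _ V] simp: res_id)

text \<open>This reduces the algebra of stalks to the algebra of sections over one open set.\<close>

lemma stalk_common_nbhd:
  assumes "g \<in> carrier (stalk X E x)" "h \<in> carrier (stalk X E x)"
  obtains U s t where "openin X U" "x \<in> U" "s \<in> carrier (sec E U)" "t \<in> carrier (sec E U)"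
    "g = germ X E x U s" "h = germ X E x U t"
proof -
  obtain U s where U: "openin X U" "x \<in> U" "s \<in> carrier (sec E U)" "g = germ X E x U s"
    using assms(1) by (rule stalkE)
  obtain V t where V: "openin X V" "x \<in> V" "t \<in> carrier (sec E V)" "h = germ X E x V t"
    using assms(2) by (rule stalkE)
  have "openin X (U \<inter> V)" using U V by blast
  with U V show ?thesis
    by (intro that[of "U \<inter> V" "res E U (U \<inter> V) s" "res E V (U \<inter> V) t"]) (simp_all add: res_closed germ_res)
qed

lemma germ_add:
  assumes U: "openin X U" "x \<in> U" and s: "s \<in> carrier (sec E U)" and t: "t \<in> carrier (sec E U)"
  shows "germ X E x U s \<oplus>\<^bsub>stalk X E x\<^esub> germ X E x U t = germ X E x U (s \<oplus>\<^bsub>sec E U\<^esub> t)"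
proof -
  let ?g = "germ X E x U s" and ?h = "germ X E x U t"
  let ?V = "germ_nbhd ?g" and ?W = "germ_nbhd ?h"
  note g = germ_nbhd_section[OF germ_in_stalk[OF U s]]
  note h = germ_nbhd_section[OF germ_in_stalk[OF U t]]
  obtain Z1 where Z1: "openin X Z1" "x \<in> Z1" "Z1 \<subseteq> ?V" "Z1 \<subseteq> U" "res E ?V Z1 (germ_section ?g) = res E U Z1 s"
    using g(4) germ_eq_iff[OF g(1-3) U s] by auto
  obtain Z2 where Z2: "openin X Z2" "x \<in> Z2" "Z2 \<subseteq> ?W" "Z2 \<subseteq> U" "res E ?W Z2 (germ_section ?h) = res E U Z2 t"
    using h(4) germ_eq_iff[OF h(1-3) U t] by auto
  let ?Z = "Z1 \<inter> Z2"
  have Z: "openin X ?Z" "x \<in> ?Z" using Z1 Z2 by auto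
  have VW: "openin X (?V \<inter> ?W)" "x \<in> ?V \<inter> ?W" using g h by auto
  have 1: "res E ?V ?Z (germ_section ?g) = res E U ?Z s"
    using res_res[OF g(1) Z1(1) Z(1) _ Z1(3) g(3)] res_res[OF U(1) Z1(1) Z(1) _ Z1(4) s] Z1(5) by auto
  have 2: "res E ?W ?Z (germ_section ?h) = res E U ?Z t"
    using res_res[OF h(1) Z2(1) Z(1) _ Z2(3) h(3)] res_res[OF U(1) Z2(1) Z(1) _ Z2(4) t] Z2(5) by auto
  let ?sg = "res E ?V (?V \<inter> ?W) (germ_section ?g)" and ?th = "res E ?W (?V \<inter> ?W) (germ_section ?h)"
  have sec: "?sg \<in> carrier (sec E (?V \<inter> ?W))" "?th \<in> carrier (sec E (?V \<inter> ?W))"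
    using g h VW by (simp_all add: res_closed)
  have "res E (?V \<inter> ?W) ?Z (?sg \<oplus>\<^bsub>sec E (?V \<inter> ?W)\<^esub> ?th)
      = res E (?V \<inter> ?W) ?Z ?sg \<oplus>\<^bsub>sec E ?Z\<^esub> res E (?V \<inter> ?W) ?Z ?th"
    by (rule res_add) (use VW Z Z1 Z2 sec in auto)
  also have "res E (?V \<inter> ?W) ?Z ?sg = res E U ?Z s"
    unfolding 1[symmetric] by (rule res_res) (use g VW Z Z1 Z2 in auto)
  also have "res E (?V \<inter> ?W) ?Z ?th = res E U ?Z t"
    unfolding 2[symmetric] by (rule res_res) (use h VW Z Z1 Z2 in auto)
  also have "res E U ?Z s \<oplus>\<^bsub>sec E ?Z\<^esub> res E U ?Z t = res E U ?Z (s \<oplus>\<^bsub>sec E U\<^esub> t)"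
    by (rule res_add[symmetric]) (use U Z Z1 s t in auto)
  finally have "germ X E x (?V \<inter> ?W) (?sg \<oplus>\<^bsub>sec E (?V \<inter> ?W)\<^esub> ?th) = germ X E x U (s \<oplus>\<^bsub>sec E U\<^esub> t)"
    using VW U Z Z1 Z2 sec s t
    by (subst germ_eq_iff) (auto simp: sec_add_closed intro!: exI[of _ ?Z])
  then show ?thesis by (simp add: stalk_def Let_def)
qed

lemma germ_smult:
  assumes U: "openin X U" "x \<in> U" and s: "s \<in> carrier (sec E U)" and b: "b \<in> carrier B"
  shows "b \<odot>\<^bsub>stalk X E x\<^esub> germ X E x U s = germ X E x U ((\<lambda>y\<in>U. b) \<odot>\<^bsub>sec E U\<^esub> s)"
proof -
  let ?g = "germ X E x U s"
  let ?V = "germ_nbhd ?g"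
  note g = germ_nbhd_section[OF germ_in_stalk[OF U s]]
  obtain Z where Z: "openin X Z" "x \<in> Z" "Z \<subseteq> ?V" "Z \<subseteq> U" "res E ?V Z (germ_section ?g) = res E U Z s"
    using g(4) germ_eq_iff[OF g(1-3) U s] by auto
  have c: "(\<lambda>y\<in>V. b) \<in> locally_constant_on X V (carrier B)" if "openin X V" for V
    using that b by (rule locally_constant_on_const)
  have "res E ?V Z ((\<lambda>y\<in>?V. b) \<odot>\<^bsub>sec E ?V\<^esub> germ_section ?g) = res E U Z ((\<lambda>y\<in>U. b) \<odot>\<^bsub>sec E U\<^esub> s)"
    using Z by (simp add: res_smult[OF g(1) Z(1,3) c[OF g(1)] g(3)] res_smult[OF U(1) Z(1,4) c[OF U(1)] s]
        Int_absorb1 Int_absorb2)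
  then have "germ X E x ?V ((\<lambda>y\<in>?V. b) \<odot>\<^bsub>sec E ?V\<^esub> germ_section ?g) = germ X E x U ((\<lambda>y\<in>U. b) \<odot>\<^bsub>sec E U\<^esub> s)"
    using g U s Z by (subst germ_eq_iff) (auto simp: sec_smult_closed c)
  then show ?thesis by (simp add: stalk_def Let_def)
qed

lemma germ_zero:
  assumes "openin X U" "x \<in> U"
  shows "\<zero>\<^bsub>stalk X E x\<^esub> = germ X E x U \<zero>\<^bsub>sec E U\<^esub>"
  using germ_res[OF openin_topspace assms(1) openin_subset[OF assms(1)] assms(2) sec_zero_closed[OF openin_topspace]]
  by (simp add: stalk_def res_zero[OF openin_topspace assms(1) openin_subset[OF assms(1)]])

lemma stalk_add_closed:
  assumes "g \<in> carrier (stalk X E x)" "h \<in> carrier (stalk X E x)"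
  shows "g \<oplus>\<^bsub>stalk X E x\<^esub> h \<in> carrier (stalk X E x)"
  using stalk_common_nbhd[OF assms] by (metis germ_add germ_in_stalk sec_add_closed)

lemma stalk_smult_closed:
  assumes "b \<in> carrier B" "g \<in> carrier (stalk X E x)"
  shows "b \<odot>\<^bsub>stalk X E x\<^esub> g \<in> carrier (stalk X E x)"
proof -
  obtain U s where U: "openin X U" "x \<in> U" "s \<in> carrier (sec E U)" and g: "g = germ X E x U s"
    using assms(2) by (rule stalkE)
  show ?thesis
    unfolding g germ_smult[OF U assms(1)]
    by (rule germ_in_stalk[OF U(1,2) sec_smult_closed[OF U(1) locally_constant_on_const[OF U(1) assms(1)] U(3)]])
qed

lemma stalk_zero_closed: "x \<in> topspace X \<Longrightarrow> \<zero>\<^bsub>stalk X E x\<^esub> \<in> carrier (stalk X E x)"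
  by (simp add: germ_zero[of "topspace X"] germ_in_stalk sec_zero_closed)

end

locale module_sheaf = module_presheaf X B E
  for X :: "'a topology" and B :: "('b, 'x) ring_scheme" and E :: "('a, 'b, ('a, 'c) univ) msheaf" +
  assumes sheaf: "is_sheaf X B E"
begin

lemma sections_glue:
  assumes "\<And>U. U \<in> \<U> \<Longrightarrow> openin X U" "\<And>U. U \<in> \<U> \<Longrightarrow> s U \<in> carrier (sec E U)"
    and "\<And>U V. U \<in> \<U> \<Longrightarrow> V \<in> \<U> \<Longrightarrow> res E U (U \<inter> V) (s U) = res E V (U \<inter> V) (s V)"
  shows "\<exists>!t. t \<in> carrier (sec E (\<Union>\<U>)) \<and> (\<forall>U\<in>\<U>. res E (\<Union>\<U>) U t = s U)"
  by (rule sheaf[unfolded is_sheaf_def, THEN conjunct2, THEN spec, THEN spec, THEN mp])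
    (use assms in blast)

text \<open>Sections with equal germs agree on a neighbourhood of each point, and sections of a sheaf are
  determined by their restrictions to an open cover.\<close>

lemma section_eqI_germs:
  assumes U: "openin X U" and s: "s \<in> carrier (sec E U)" and t: "t \<in> carrier (sec E U)"
    and eq: "\<And>x. x \<in> U \<Longrightarrow> germ X E x U s = germ X E x U t"
  shows "s = t"
proof -
  define \<W> where "\<W> = {W. openin X W \<and> W \<subseteq> U \<and> res E U W s = res E U W t}"
  have open_W: "openin X W" "W \<subseteq> U" if "W \<in> \<W>" for W using that by (auto simp: \<W>_def)
  have "x \<in> \<Union>\<W>" if "x \<in> U" for x
    using eq[OF that] U s t that by (auto simp: germ_eq_iff \<W>_def)
  then have cover: "\<Union>\<W> = U" using open_W by blast
  have "\<exists>!r. r \<in> carrier (sec E (\<Union>\<W>)) \<and> (\<forall>W\<in>\<W>. res E (\<Union>\<W>) W r = res E U W s)"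
  proof (rule sections_glue)
    fix W W' assume W: "W \<in> \<W>" "W' \<in> \<W>"
    have "openin X (W \<inter> W')" using W open_W by blast
    then show "res E W (W \<inter> W') (res E U W s) = res E W' (W \<inter> W') (res E U W' s)"
      using W open_W U s by (simp add: res_res)
  qed (use open_W U s in \<open>auto simp: res_closed\<close>)
  moreover have "\<forall>W\<in>\<W>. res E U W t = res E U W s" by (simp add: \<W>_def)
  ultimately show "s = t" unfolding cover using s t by auto
qed

end


section \<open>Trivialisations\<close>

locale trivialised = module_presheaf X B E
  for X :: "'a topology" and B :: "('b, 'x) ring_scheme" and E :: "('a, 'b, ('a, 'c) univ) msheaf" +
  fixes U :: "'a set" and M :: "('b, ('a, 'c) univ) module"
    and \<phi> :: "'a set \<Rightarrow> ('a, 'c) univ \<Rightarrow> 'a \<Rightarrow> ('a, 'c) univ"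
  assumes triv: "trivialisation X B E U M \<phi>"
begin

lemma openU: "openin X U" and moduleM: "left_module B M"
  and triv_iso: "\<phi> \<in> sheaf_iso (subtopology X U) B E (const_sheaf (subtopology X U) M)"
  using triv by (simp_all add: trivialisation_def)

lemma triv_hom:
  assumes "openin X V" "V \<subseteq> U"
  shows "\<phi> V \<in> module_hom (const_ring (subtopology X U) B V) (sec E V) (sec (const_sheaf (subtopology X U) M) V)"
  using triv_iso assms openU by (auto simp: sheaf_iso_def sheaf_hom_def openin_open_subtopology)

lemma triv_locally_constant:
  assumes "openin X V" "V \<subseteq> U" "s \<in> carrier (sec E V)"
  shows "\<phi> V s \<in> locally_constant_on X V (carrier M)"
  using module_hom_closed[OF triv_hom[OF assms(1,2)] assms(3)] assms(2)
  by (simp add: const_sheaf_def locally_constant_on_subtopology[OF openU])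

lemma triv_add:
  assumes "openin X V" "V \<subseteq> U" "s \<in> carrier (sec E V)" "t \<in> carrier (sec E V)" "y \<in> V"
  shows "\<phi> V (s \<oplus>\<^bsub>sec E V\<^esub> t) y = \<phi> V s y \<oplus>\<^bsub>M\<^esub> \<phi> V t y"
  using module_hom_add[OF triv_hom[OF assms(1,2)] assms(3,4)] assms(5) by (simp add: const_sheaf_def)

lemma triv_smult:
  assumes "openin X V" "V \<subseteq> U" "b \<in> locally_constant_on X V (carrier B)" "s \<in> carrier (sec E V)" "y \<in> V"
  shows "\<phi> V (b \<odot>\<^bsub>sec E V\<^esub> s) y = b y \<odot>\<^bsub>M\<^esub> \<phi> V s y"
  using module_hom_smult[OF triv_hom[OF assms(1,2)], of b s] assms
  by (simp add: const_sheaf_def locally_constant_on_subtopology[OF openU])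

lemma triv_res:
  assumes "openin X V" "V \<subseteq> U" "openin X W" "W \<subseteq> V" "s \<in> carrier (sec E V)"
  shows "\<phi> W (res E V W s) = restrict (\<phi> V s) W"
proof -
  have "openin (subtopology X U) V" "openin (subtopology X U) W"
    using assms openU by (auto simp: openin_open_subtopology)
  then show ?thesis
    using triv_iso assms(4,5) by (auto simp: sheaf_iso_def sheaf_hom_def const_sheaf_def)
qed

lemma triv_bij:
  assumes "openin X V" "V \<subseteq> U"
  shows "bij_betw (\<phi> V) (carrier (sec E V)) (locally_constant_on X V (carrier M))"
proof -
  let ?Y = "subtopology X U"
  have V: "openin ?Y V" using assms openU by (auto simp: openin_open_subtopology)
  have c: "carrier (sec (const_sheaf ?Y M) V) = locally_constant_on X V (carrier M)"
    using assms(2) by (simp add: const_sheaf_def locally_constant_on_subtopology[OF openU])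
  obtain \<psi> where \<psi>: "\<psi> \<in> sheaf_hom ?Y B (const_sheaf ?Y M) E"
    "sheaf_comp ?Y E \<psi> \<phi> = sheaf_id ?Y E"
    "sheaf_comp ?Y (const_sheaf ?Y M) \<phi> \<psi> = sheaf_id ?Y (const_sheaf ?Y M)"
    using triv_iso by (auto simp: sheaf_iso_def)
  have 1: "\<psi> V (\<phi> V s) = s" if "s \<in> carrier (sec E V)" for s
    using fun_cong[OF fun_cong[OF \<psi>(2), of V], of s] that V
    by (simp add: sheaf_comp_def sheaf_id_def compose_eq)
  have 2: "\<phi> V (\<psi> V f) = f" if "f \<in> locally_constant_on X V (carrier M)" for f
    using fun_cong[OF fun_cong[OF \<psi>(3), of V], of f] that V c
    by (simp add: sheaf_comp_def sheaf_id_def compose_eq)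
  have "\<psi> V f \<in> carrier (sec E V)" if "f \<in> locally_constant_on X V (carrier M)" for f
  proof -
    have "\<psi> V \<in> module_hom (const_ring ?Y B V) (sec (const_sheaf ?Y M) V) (sec E V)"
      using \<psi>(1) V by (simp add: sheaf_hom_def)
    from module_hom_closed[OF this, of f] show ?thesis using that c by simp
  qed
  then show ?thesis
    using 1 2 triv_locally_constant[OF assms] by (intro bij_betwI[where g = "\<psi> V"]) auto
qed

text \<open>The definition of the fibre map uses the chosen representative of the germ; any other one agrees
  with it near \<open>x\<close>, and \<open>\<phi>\<close> commutes with restriction.\<close>

lemma triv_fibre_germ:
  assumes V: "openin X V" "x \<in> V" "x \<in> U" and s: "s \<in> carrier (sec E V)"
  shows "triv_fibre E U \<phi> x (germ X E x V s) = \<phi> (V \<inter> U) (res E V (V \<inter> U) s) x"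
proof -
  let ?g = "germ X E x V s"
  let ?N = "germ_nbhd ?g"
  note g = germ_nbhd_section[OF germ_in_stalk[OF V(1,2) s]]
  obtain Z where Z: "openin X Z" "x \<in> Z" "Z \<subseteq> ?N" "Z \<subseteq> V" "res E ?N Z (germ_section ?g) = res E V Z s"
    using g(4) germ_eq_iff[OF g(1-3) V(1,2) s] by auto
  have *: "\<phi> (W \<inter> U) (res E W (W \<inter> U) r) x = \<phi> (Z \<inter> U) (res E W (Z \<inter> U) r) x"
    if "openin X W" "r \<in> carrier (sec E W)" "Z \<subseteq> W" for W r
  proof -
    have o: "openin X (Z \<inter> U)" "openin X (W \<inter> U)" using Z(1) openU that(1) by auto
    have "\<phi> (Z \<inter> U) (res E W (Z \<inter> U) r) = \<phi> (Z \<inter> U) (res E (W \<inter> U) (Z \<inter> U) (res E W (W \<inter> U) r))"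
      using that o by (subst res_res) auto
    also have "\<dots> = restrict (\<phi> (W \<inter> U) (res E W (W \<inter> U) r)) (Z \<inter> U)"
      using that o by (intro triv_res) (auto simp: res_closed)
    finally show ?thesis using V Z by simp
  qed
  have ZU: "openin X (Z \<inter> U)" using Z openU by auto
  have "res E ?N (Z \<inter> U) (germ_section ?g) = res E Z (Z \<inter> U) (res E ?N Z (germ_section ?g))"
    by (rule res_res[symmetric]) (use g Z ZU in auto)
  also have "\<dots> = res E V (Z \<inter> U) s"
    unfolding Z(5) by (rule res_res) (use V s Z ZU in auto)
  finally show ?thesis
    using *[OF g(1,3) Z(3)] *[OF V(1) s Z(4)] by (simp add: triv_fibre_def Let_def)
qed

lemma triv_fibre_germ_inside:
  assumes "openin X V" "V \<subseteq> U" "x \<in> V" "s \<in> carrier (sec E V)"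
  shows "triv_fibre E U \<phi> x (germ X E x V s) = \<phi> V s x"
proof -
  have "V \<inter> U = V" using assms(2) by blast
  then show ?thesis using assms triv_fibre_germ[of V x s] by (auto simp: res_id)
qed

lemma stalk_section_inside:
  assumes x: "x \<in> U" and g: "g \<in> carrier (stalk X E x)"
  obtains V s where "openin X V" "V \<subseteq> U" "x \<in> V" "s \<in> carrier (sec E V)" "g = germ X E x V s"
proof -
  obtain V s where V: "openin X V" "x \<in> V" "s \<in> carrier (sec E V)" "g = germ X E x V s"
    using g by (rule stalkE)
  have "openin X (V \<inter> U)" using V openU by blast
  with V x show ?thesis
    by (intro that[of "V \<inter> U" "res E V (V \<inter> U) s"]) (auto simp: res_closed germ_res)
qed

text \<open>Under the trivialisation the two germs become locally constant functions; equal values at \<open>x\<close>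
  make these functions, and with them the sections, agree near \<open>x\<close>.\<close>

lemma triv_fibre_inj:
  assumes x: "x \<in> U" and g: "g \<in> carrier (stalk X E x)" and h: "h \<in> carrier (stalk X E x)"
    and eq: "triv_fibre E U \<phi> x g = triv_fibre E U \<phi> x h"
  shows "g = h"
proof -
  obtain V s where V: "openin X V" "V \<subseteq> U" "x \<in> V" "s \<in> carrier (sec E V)" "g = germ X E x V s"
    using stalk_section_inside[OF x g] .
  obtain W t where W: "openin X W" "W \<subseteq> U" "x \<in> W" "t \<in> carrier (sec E W)" "h = germ X E x W t"
    using stalk_section_inside[OF x h] .
  obtain V' where V': "openin X V'" "x \<in> V'" "V' \<subseteq> V" "\<And>y. y \<in> V' \<Longrightarrow> \<phi> V s y = \<phi> V s x"
    using locally_constant_onE[OF triv_locally_constant[OF V(1,2,4)] V(3)] by metis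
  obtain W' where W': "openin X W'" "x \<in> W'" "W' \<subseteq> W" "\<And>y. y \<in> W' \<Longrightarrow> \<phi> W t y = \<phi> W t x"
    using locally_constant_onE[OF triv_locally_constant[OF W(1,2,4)] W(3)] by metis
  let ?Z = "V' \<inter> W'"
  have Z: "openin X ?Z" "?Z \<subseteq> V" "?Z \<subseteq> W" "?Z \<subseteq> U" using V' W' V by auto
  have "\<phi> V s x = \<phi> W t x"
    using eq V W by (simp add: triv_fibre_germ_inside)
  then have "\<phi> V s y = \<phi> W t y" if "y \<in> ?Z" for y
    using that V'(4)[of y] W'(4)[of y] by simp
  then have "restrict (\<phi> V s) ?Z = restrict (\<phi> W t) ?Z" by (rule restrict_ext)
  then have "\<phi> ?Z (res E V ?Z s) = \<phi> ?Z (res E W ?Z t)"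
    by (simp only: triv_res[OF V(1,2) Z(1,2) V(4)] triv_res[OF W(1,2) Z(1,3) W(4)])
  with bij_betw_imp_inj_on[OF triv_bij[OF Z(1,4)]] have "res E V ?Z s = res E W ?Z t"
    by (rule inj_onD) (use V W Z in \<open>simp_all add: res_closed\<close>)
  then show "g = h"
    unfolding V(5) W(5) using V W Z V'(2) W'(2) by (subst germ_eq_iff) auto
qed

text \<open>The sections over all of \<open>U\<close> that correspond to constant functions. Each germ at a point of \<open>U\<close>
  extends to one of them, and the constant identification of two stalks follows it.\<close>

definition constant_section :: "('a, 'c) univ \<Rightarrow> ('a, 'c) univ \<Rightarrow> bool" where
  "constant_section m s \<longleftrightarrow> s \<in> carrier (sec E U) \<and> (\<forall>y\<in>U. \<phi> U s y = m)"

lemma constant_section_exists: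
  assumes "m \<in> carrier M"
  obtains s where "constant_section m s"
proof -
  have "(\<lambda>y\<in>U. m) \<in> locally_constant_on X U (carrier M)"
    by (rule locally_constant_on_const[OF openU assms])
  then have "(\<lambda>y\<in>U. m) \<in> \<phi> U ` carrier (sec E U)"
    by (simp only: bij_betw_imp_surj_on[OF triv_bij[OF openU order_refl]])
  then obtain s where "s \<in> carrier (sec E U)" "(\<lambda>y\<in>U. m) = \<phi> U s" by (rule imageE)
  then have "s \<in> carrier (sec E U)" "\<phi> U s = (\<lambda>y\<in>U. m)" by simp_all
  then have "constant_section m s" by (simp add: constant_section_def)
  then show ?thesis by (rule that)
qed

lemma germ_of_constant_section:
  assumes x: "x \<in> U" and g: "g \<in> carrier (stalk X E x)"
  obtains m s where "constant_section m s" "g = germ X E x U s"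
proof -
  obtain V t where V: "openin X V" "V \<subseteq> U" "x \<in> V" "t \<in> carrier (sec E V)" "g = germ X E x V t"
    using stalk_section_inside[OF x g] .
  have "\<phi> V t x \<in> carrier M"
    by (rule locally_constant_on_closed[OF triv_locally_constant[OF V(1,2,4)] V(3)])
  then obtain s where s: "constant_section (\<phi> V t x) s" by (rule constant_section_exists)
  then have sU: "s \<in> carrier (sec E U)" "\<phi> U s x = \<phi> V t x" using x by (simp_all add: constant_section_def)
  have "triv_fibre E U \<phi> x g = \<phi> V t x"
    unfolding V(5) by (rule triv_fibre_germ_inside[OF V(1-4)])
  also have "\<dots> = triv_fibre E U \<phi> x (germ X E x U s)"
    unfolding sU(2)[symmetric] by (rule triv_fibre_germ_inside[OF openU order_refl x sU(1), symmetric])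
  finally have "g = germ X E x U s"
    by (rule triv_fibre_inj[OF x g germ_in_stalk[OF openU x sU(1)]])
  with s show ?thesis using that by blast
qed

lemma constant_identification_germ:
  assumes x: "x \<in> U" and y: "y \<in> U" and s: "constant_section m s"
  shows "constant_identification X E U \<phi> x y (germ X E x U s) = germ X E y U s"
proof -
  have sU: "s \<in> carrier (sec E U)" "\<phi> U s x = m" "\<phi> U s y = m"
    using s x y by (simp_all add: constant_section_def)
  have "inj_on (triv_fibre E U \<phi> y) (carrier (stalk X E y))"
    by (rule inj_onI) (rule triv_fibre_inj[OF y])
  moreover have "triv_fibre E U \<phi> x (germ X E x U s) = triv_fibre E U \<phi> y (germ X E y U s)"
    using sU x y openU by (simp add: triv_fibre_germ_inside)
  ultimately show ?thesis
    using germ_in_stalk[OF openU y sU(1)] by (simp add: constant_identification_def)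
qed

text \<open>Sums and multiples of constant sections are constant, so the constant identification of two
  stalks is a homomorphism; its inverse is the identification in the other direction.\<close>

lemma constant_identification_module_iso:
  assumes x: "x \<in> U" and y: "y \<in> U"
  shows "restrict (constant_identification X E U \<phi> x y) (carrier (stalk X E x))
    \<in> module_iso B (stalk X E x) (stalk X E y)"
proof -
  have closed: "constant_identification X E U \<phi> p q g \<in> carrier (stalk X E q)"
    and inverse: "constant_identification X E U \<phi> q p (constant_identification X E U \<phi> p q g) = g"
    if pq: "p \<in> U" "q \<in> U" "g \<in> carrier (stalk X E p)" for p q g
  proof -
    obtain m s where s: "constant_section m s" "g = germ X E p U s"
      using germ_of_constant_section[OF pq(1,3)] .
    then show "constant_identification X E U \<phi> p q g \<in> carrier (stalk X E q)"
      and "constant_identification X E U \<phi> q p (constant_identification X E U \<phi> p q g) = g"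
      using pq germ_in_stalk[OF openU]
      by (simp_all add: constant_identification_germ[OF _ _ s(1)] constant_section_def)
  qed
  have "bij_betw (constant_identification X E U \<phi> x y) (carrier (stalk X E x)) (carrier (stalk X E y))"
    using closed inverse x y by (intro bij_betwI[where g = "constant_identification X E U \<phi> y x"]) auto
  then have "bij_betw (restrict (constant_identification X E U \<phi> x y) (carrier (stalk X E x)))
      (carrier (stalk X E x)) (carrier (stalk X E y))"
    by (rule iffD1[OF bij_betw_cong, rotated]) simp
  moreover have "restrict (constant_identification X E U \<phi> x y) (carrier (stalk X E x))
    \<in> module_hom B (stalk X E x) (stalk X E y)"
  proof (rule module_homI)
    fix g h assume g: "g \<in> carrier (stalk X E x)" and h: "h \<in> carrier (stalk X E x)"
    obtain m s where s: "constant_section m s" "g = germ X E x U s"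
      using germ_of_constant_section[OF x g] .
    obtain n t where t: "constant_section n t" "h = germ X E x U t"
      using germ_of_constant_section[OF x h] .
    have sec: "s \<in> carrier (sec E U)" "t \<in> carrier (sec E U)" using s t by (simp_all add: constant_section_def)
    have st: "constant_section (m \<oplus>\<^bsub>M\<^esub> n) (s \<oplus>\<^bsub>sec E U\<^esub> t)"
      using s t openU by (simp add: constant_section_def sec_add_closed triv_add)
    have "g \<oplus>\<^bsub>stalk X E x\<^esub> h = germ X E x U (s \<oplus>\<^bsub>sec E U\<^esub> t)"
      by (simp add: s t germ_add[OF openU x sec])
    then show "restrict (constant_identification X E U \<phi> x y) (carrier (stalk X E x)) (g \<oplus>\<^bsub>stalk X E x\<^esub> h)
      = restrict (constant_identification X E U \<phi> x y) (carrier (stalk X E x)) g \<oplus>\<^bsub>stalk X E y\<^esub>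
        restrict (constant_identification X E U \<phi> x y) (carrier (stalk X E x)) h"
      using g h stalk_add_closed[OF g h] constant_identification_germ[OF x y s(1)]
        constant_identification_germ[OF x y t(1)] constant_identification_germ[OF x y st]
      by (simp add: s(2) t(2) germ_add[OF openU y sec])
  next
    fix b g assume b: "b \<in> carrier B" and g: "g \<in> carrier (stalk X E x)"
    obtain m s where s: "constant_section m s" "g = germ X E x U s"
      using germ_of_constant_section[OF x g] .
    have sec: "s \<in> carrier (sec E U)" using s by (simp add: constant_section_def)
    have c: "(\<lambda>y\<in>U. b) \<in> locally_constant_on X U (carrier B)" by (rule locally_constant_on_const[OF openU b])
    have bs: "constant_section (b \<odot>\<^bsub>M\<^esub> m) ((\<lambda>y\<in>U. b) \<odot>\<^bsub>sec E U\<^esub> s)"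
      using s openU c by (simp add: constant_section_def sec_smult_closed triv_smult)
    have "b \<odot>\<^bsub>stalk X E x\<^esub> g = germ X E x U ((\<lambda>y\<in>U. b) \<odot>\<^bsub>sec E U\<^esub> s)"
      by (simp add: s germ_smult[OF openU x sec b])
    then show "restrict (constant_identification X E U \<phi> x y) (carrier (stalk X E x)) (b \<odot>\<^bsub>stalk X E x\<^esub> g)
      = b \<odot>\<^bsub>stalk X E y\<^esub> restrict (constant_identification X E U \<phi> x y) (carrier (stalk X E x)) g"
      using g stalk_smult_closed[OF b g] constant_identification_germ[OF x y s(1)]
        constant_identification_germ[OF x y bs]
      by (simp add: s(2) germ_smult[OF openU y sec b])
  qed (use closed x y in auto)
  ultimately show ?thesis by (simp add: module_iso_def)
qed

text \<open>The fibre values of the two sections are locally constant, so they stay different near a point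
  where they differ. This is the Hausdorff property of the space of germs.\<close>

lemma germs_locally_differ:
  assumes V: "openin X V" "s \<in> carrier (sec E V)" and W: "openin X W" "t \<in> carrier (sec E W)"
    and x: "x \<in> V" "x \<in> W" "x \<in> U" and neq: "germ X E x V s \<noteq> germ X E x W t"
  obtains Z where "openin X Z" "x \<in> Z" "Z \<subseteq> V" "Z \<subseteq> W"
    "\<And>z. z \<in> Z \<Longrightarrow> germ X E z V s \<noteq> germ X E z W t"
proof -
  let ?f = "\<phi> (V \<inter> U) (res E V (V \<inter> U) s)" and ?g = "\<phi> (W \<inter> U) (res E W (W \<inter> U) t)"
  have VU: "openin X (V \<inter> U)" and WU: "openin X (W \<inter> U)" using V W openU by auto
  have lf: "?f \<in> locally_constant_on X (V \<inter> U) (carrier M)"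
    by (rule triv_locally_constant) (use V VU in \<open>auto simp: res_closed\<close>)
  have lg: "?g \<in> locally_constant_on X (W \<inter> U) (carrier M)"
    by (rule triv_locally_constant) (use W WU in \<open>auto simp: res_closed\<close>)
  have f: "triv_fibre E U \<phi> z (germ X E z V s) = ?f z" if "z \<in> V" "z \<in> U" for z
    using that V by (simp add: triv_fibre_germ)
  have g: "triv_fibre E U \<phi> z (germ X E z W t) = ?g z" if "z \<in> W" "z \<in> U" for z
    using that W by (simp add: triv_fibre_germ)
  have ne: "?f x \<noteq> ?g x"
    using neq triv_fibre_inj[OF x(3) germ_in_stalk[OF V(1) x(1) V(2)] germ_in_stalk[OF W(1) x(2) W(2)]]
      f g x by auto
  obtain P where P: "openin X P" "x \<in> P" "P \<subseteq> V \<inter> U" "\<And>y. y \<in> P \<Longrightarrow> ?f y = ?f x"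
    using locally_constant_onE[OF lf, of x] x by blast
  obtain Q where Q: "openin X Q" "x \<in> Q" "Q \<subseteq> W \<inter> U" "\<And>y. y \<in> Q \<Longrightarrow> ?g y = ?g x"
    using locally_constant_onE[OF lg, of x] x by blast
  show ?thesis
  proof (rule that[of "P \<inter> Q"])
    fix z assume z: "z \<in> P \<inter> Q"
    then have "?f z \<noteq> ?g z" using P(4)[of z] Q(4)[of z] ne by simp
    moreover have zin: "z \<in> V" "z \<in> W" "z \<in> U" using z P(3) Q(3) by auto
    ultimately show "germ X E z V s \<noteq> germ X E z W t"
      using f[OF zin(1,3)] g[OF zin(2,3)] by metis
  qed (use P(1-3) Q(1-3) in auto)
qed

end


section \<open>Flat sections along a map\<close>

context module_presheaf
begin

lemma germs_locally_agree:
  assumes V: "openin X V" "s \<in> carrier (sec E V)" and W: "openin X W" "t \<in> carrier (sec E W)"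
    and x: "x \<in> V" "x \<in> W" and eq: "germ X E x V s = germ X E x W t"
  obtains Z where "openin X Z" "x \<in> Z" "Z \<subseteq> V" "Z \<subseteq> W"
    "\<And>z. z \<in> Z \<Longrightarrow> germ X E z V s = germ X E z W t"
proof -
  obtain Z where Z: "openin X Z" "x \<in> Z" "Z \<subseteq> V" "Z \<subseteq> W" "res E V Z s = res E W Z t"
    using eq germ_eq_iff[OF V(1) x(1) V(2) W(1) x(2) W(2)] by auto
  have "germ X E z V s = germ X E z W t" if z: "z \<in> Z" for z
    using germ_res[OF V(1) Z(1,3) z V(2)] germ_res[OF W(1) Z(1,4) z W(2)] Z(5) by simp
  with Z show ?thesis using that by blast
qed

text \<open>A section of the pullback of \<open>E\<close> along \<open>f\<close>: a choice of germs at the points \<open>f z\<close> that locally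
  comes from one section of \<open>E\<close>. Parallel transport along a path \<open>f\<close> is the comparison of the ends of
  such a section; taking \<open>f\<close> to be a homotopy compares the transports along its two sides.\<close>

definition flat_along :: "'z::topological_space set \<Rightarrow> ('z \<Rightarrow> 'a) \<Rightarrow> ('z \<Rightarrow> ('a, 'c) univ) \<Rightarrow> bool" where
  "flat_along A f \<sigma> \<longleftrightarrow> continuous_map (top_of_set A) X f \<and>
    (\<forall>z\<in>A. \<exists>N W s. openin (top_of_set A) N \<and> z \<in> N \<and> openin X W \<and> s \<in> carrier (sec E W) \<and>
      (\<forall>y\<in>N. f y \<in> W \<and> \<sigma> y = germ X E (f y) W s))"

lemma flat_alongI:
  assumes "continuous_map (top_of_set A) X f"
    and "\<And>z. z \<in> A \<Longrightarrow> \<exists>N W s. openin (top_of_set A) N \<and> z \<in> N \<and> openin X W \<and>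
      s \<in> carrier (sec E W) \<and> (\<forall>y\<in>N. f y \<in> W \<and> \<sigma> y = germ X E (f y) W s)"
  shows "flat_along A f \<sigma>"
  using assms by (simp add: flat_along_def)

lemma flat_along_continuous: "flat_along A f \<sigma> \<Longrightarrow> continuous_map (top_of_set A) X f"
  by (simp add: flat_along_def)

lemma flat_alongE:
  assumes "flat_along A f \<sigma>" "z \<in> A"
  obtains N W s where "openin (top_of_set A) N" "z \<in> N" "openin X W" "s \<in> carrier (sec E W)"
    "\<And>y. y \<in> N \<Longrightarrow> f y \<in> W" "\<And>y. y \<in> N \<Longrightarrow> \<sigma> y = germ X E (f y) W s"
proof -
  have "\<exists>N W s. openin (top_of_set A) N \<and> z \<in> N \<and> openin X W \<and> s \<in> carrier (sec E W) \<and>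
      (\<forall>y\<in>N. f y \<in> W \<and> \<sigma> y = germ X E (f y) W s)"
    using assms by (simp add: flat_along_def)
  then show ?thesis using that by (elim exE conjE) blast
qed

lemma flat_along_in_stalk:
  assumes "flat_along A f \<sigma>" "z \<in> A"
  shows "\<sigma> z \<in> carrier (stalk X E (f z))"
  using flat_alongE[OF assms] germ_in_stalk by metis

lemma flat_along_section:
  assumes "continuous_map (top_of_set A) X f" "openin X W" "s \<in> carrier (sec E W)"
    and "\<And>z. z \<in> A \<Longrightarrow> f z \<in> W"
  shows "flat_along A f (\<lambda>z. germ X E (f z) W s)"
proof (rule flat_alongI[OF assms(1)])
  fix z assume "z \<in> A"
  then show "\<exists>N W' s'. openin (top_of_set A) N \<and> z \<in> N \<and> openin X W' \<and> s' \<in> carrier (sec E W') \<and>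
      (\<forall>y\<in>N. f y \<in> W' \<and> germ X E (f y) W s = germ X E (f y) W' s')"
    using assms by (intro exI[of _ A] exI[of _ W] exI[of _ s]) auto
qed

lemma flat_along_cong:
  assumes "flat_along A f \<sigma>" "\<And>z. z \<in> A \<Longrightarrow> g z = f z"
  shows "flat_along A g \<sigma>"
proof (rule flat_alongI)
  show "continuous_map (top_of_set A) X g"
    by (rule continuous_map_eq[OF flat_along_continuous[OF assms(1)]]) (simp add: assms(2))
  fix z assume "z \<in> A"
  with assms(1) obtain N W s where N: "openin (top_of_set A) N" "z \<in> N" "openin X W" "s \<in> carrier (sec E W)"
    "\<And>y. y \<in> N \<Longrightarrow> f y \<in> W" "\<And>y. y \<in> N \<Longrightarrow> \<sigma> y = germ X E (f y) W s"
    by (rule flat_alongE) blast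
  have "N \<subseteq> A" using N(1) by (rule openin_imp_subset)
  then have "g y = f y" if "y \<in> N" for y using that assms(2) by blast
  then show "\<exists>N W s. openin (top_of_set A) N \<and> z \<in> N \<and> openin X W \<and> s \<in> carrier (sec E W) \<and>
      (\<forall>y\<in>N. g y \<in> W \<and> \<sigma> y = germ X E (g y) W s)"
    using N by (intro exI[of _ N] exI[of _ W] exI[of _ s]) simp
qed

lemma flat_along_compose:
  fixes A :: "'z::topological_space set" and A' :: "'w::topological_space set"
  assumes fl: "flat_along A f \<sigma>" and k: "continuous_on A' k" "k \<in> A' \<rightarrow> A"
  shows "flat_along A' (\<lambda>z. f (k z)) (\<lambda>z. \<sigma> (k z))"
proof (rule flat_alongI)
  have km: "continuous_map (top_of_set A') (top_of_set A) k" using k by simp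
  from continuous_map_compose[OF this flat_along_continuous[OF fl]]
  show "continuous_map (top_of_set A') X (\<lambda>z. f (k z))" by (simp add: o_def)
  fix z assume z: "z \<in> A'"
  then have "k z \<in> A" using k(2) by blast
  with fl obtain N W s where N: "openin (top_of_set A) N" "k z \<in> N" "openin X W" "s \<in> carrier (sec E W)"
    "\<And>y. y \<in> N \<Longrightarrow> f y \<in> W" "\<And>y. y \<in> N \<Longrightarrow> \<sigma> y = germ X E (f y) W s"
    by (rule flat_alongE) blast
  have "openin (top_of_set A') {y \<in> A'. k y \<in> N}"
    using openin_continuous_map_preimage[OF km N(1)] by simp
  then show "\<exists>N W s. openin (top_of_set A') N \<and> z \<in> N \<and> openin X W \<and> s \<in> carrier (sec E W) \<and>
      (\<forall>y\<in>N. f (k y) \<in> W \<and> \<sigma> (k y) = germ X E (f (k y)) W s)"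
    using N z by (intro exI[of _ "{y \<in> A'. k y \<in> N}"] exI[of _ W] exI[of _ s]) simp
qed

lemma flat_along_subset: "flat_along A f \<sigma> \<Longrightarrow> A' \<subseteq> A \<Longrightarrow> flat_along A' f \<sigma>"
  by (rule flat_along_compose[where k = "\<lambda>z. z"]) auto

lemma flat_along_paste:
  fixes A :: "'z::topological_space set"
  assumes f: "continuous_map (top_of_set A) X f"
    and A: "A = A1 \<union> A2" "closedin (top_of_set A) A1" "closedin (top_of_set A) A2"
    and \<sigma>1: "flat_along A1 f \<sigma>1" and \<sigma>2: "flat_along A2 f \<sigma>2"
    and agree: "\<And>z. z \<in> A1 \<Longrightarrow> z \<in> A2 \<Longrightarrow> \<sigma>1 z = \<sigma>2 z"
  shows "flat_along A f (\<lambda>z. if z \<in> A1 then \<sigma>1 z else \<sigma>2 z)"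
proof (rule flat_alongI[OF f])
  fix z assume z: "z \<in> A"
  let ?\<sigma> = "\<lambda>z. if z \<in> A1 then \<sigma>1 z else \<sigma>2 z"
  have \<sigma>eq2: "?\<sigma> y = \<sigma>2 y" if "y \<in> A2" for y using that agree by simp
  \<comment> \<open>Off the other piece, a piece is open, and its own local section serves.\<close>
  have off: "\<exists>N W s. openin (top_of_set A) N \<and> z \<in> N \<and> openin X W \<and> s \<in> carrier (sec E W) \<and>
      (\<forall>y\<in>N. f y \<in> W \<and> ?\<sigma> y = germ X E (f y) W s)"
    if fl: "flat_along P f \<tau>" and z: "z \<in> P" "z \<notin> Q" and PQ: "A = P \<union> Q" "closedin (top_of_set A) Q"
      and eq: "\<And>y. y \<in> P \<Longrightarrow> ?\<sigma> y = \<tau> y" for P Q \<tau>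
  proof -
    obtain N W s where N: "openin (top_of_set P) N" "z \<in> N" "openin X W" "s \<in> carrier (sec E W)"
      "\<And>y. y \<in> N \<Longrightarrow> f y \<in> W" "\<And>y. y \<in> N \<Longrightarrow> \<tau> y = germ X E (f y) W s"
      using fl z(1) by (rule flat_alongE) blast
    obtain T where T: "open T" "N = P \<inter> T" using N(1) by (auto simp: openin_open)
    have "openin (top_of_set A) (A - Q)" using PQ(2) by (simp add: closedin_def)
    then have "openin (top_of_set A) ((A - Q) \<inter> T)" using T(1) by (simp add: openin_Int_open)
    moreover have "z \<in> (A - Q) \<inter> T" using N(2) z T(2) PQ(1) by blast
    moreover have "f y \<in> W \<and> ?\<sigma> y = germ X E (f y) W s" if "y \<in> (A - Q) \<inter> T" for y
    proof -
      have "y \<in> P" "y \<in> N" using that T(2) PQ(1) by auto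
      then show ?thesis using N(5) trans[OF eq N(6)] by blast
    qed
    ultimately show ?thesis
      using N(3,4) by (intro exI[of _ "(A - Q) \<inter> T"] exI[of _ W] exI[of _ s]) blast
  qed
  consider "z \<in> A1" "z \<notin> A2" | "z \<in> A2" "z \<notin> A1" | "z \<in> A1" "z \<in> A2" using z A(1) by blast
  then show "\<exists>N W s. openin (top_of_set A) N \<and> z \<in> N \<and> openin X W \<and> s \<in> carrier (sec E W) \<and>
      (\<forall>y\<in>N. f y \<in> W \<and> ?\<sigma> y = germ X E (f y) W s)"
  proof cases
    case 1
    show ?thesis by (rule off[OF \<sigma>1 1 A(1,3)]) simp
  next
    case 2
    show ?thesis
      by (rule off[OF \<sigma>2 2 _ A(2) \<sigma>eq2]) (simp_all add: A(1) Un_commute)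
  next
    case 3
    obtain N1 V s where N1: "openin (top_of_set A1) N1" "z \<in> N1" "openin X V" "s \<in> carrier (sec E V)"
      "\<And>y. y \<in> N1 \<Longrightarrow> f y \<in> V" "\<And>y. y \<in> N1 \<Longrightarrow> \<sigma>1 y = germ X E (f y) V s"
      using \<sigma>1 3(1) by (rule flat_alongE) blast
    obtain N2 W t where N2: "openin (top_of_set A2) N2" "z \<in> N2" "openin X W" "t \<in> carrier (sec E W)"
      "\<And>y. y \<in> N2 \<Longrightarrow> f y \<in> W" "\<And>y. y \<in> N2 \<Longrightarrow> \<sigma>2 y = germ X E (f y) W t"
      using \<sigma>2 3(2) by (rule flat_alongE) blast
    have "germ X E (f z) V s = germ X E (f z) W t"
      using agree[OF 3] N1(6)[OF N1(2)] N2(6)[OF N2(2)] by simp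
    then obtain Z where Z: "openin X Z" "f z \<in> Z" "Z \<subseteq> V" "Z \<subseteq> W"
      "\<And>x. x \<in> Z \<Longrightarrow> germ X E x V s = germ X E x W t"
      using germs_locally_agree[OF N1(3,4) N2(3,4) N1(5)[OF N1(2)] N2(5)[OF N2(2)]] by blast
    obtain T1 where T1: "open T1" "N1 = A1 \<inter> T1" using N1(1) by (auto simp: openin_open)
    obtain T2 where T2: "open T2" "N2 = A2 \<inter> T2" using N2(1) by (auto simp: openin_open)
    let ?N = "{y \<in> A. f y \<in> Z} \<inter> (T1 \<inter> T2)"
    have "openin (top_of_set A) {y \<in> A. f y \<in> Z}"
      using openin_continuous_map_preimage[OF f Z(1)] by simp
    then have oN: "openin (top_of_set A) ?N" using T1(1) T2(1) by (simp add: openin_Int_open open_Int)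
    have "f y \<in> V \<and> ?\<sigma> y = germ X E (f y) V s" if y: "y \<in> ?N" for y
    proof (cases "y \<in> A1")
      case True
      then have "y \<in> N1" using y T1 by blast
      then show ?thesis using True N1(5,6) by simp
    next
      case False
      then have "y \<in> N2" using y T2 A(1) by blast
      then show ?thesis using False N2(6)[of y] Z(3) Z(5)[of "f y"] y by auto
    qed
    then show ?thesis
      using oN z Z(2) N1 N2 T1 T2 by (intro exI[of _ ?N] exI[of _ V] exI[of _ s]) blast
  qed
qed

end

locale locally_constant_module_sheaf = module_sheaf X B E
  for X :: "'a topology" and B :: "('b, 'x) ring_scheme" and E :: "('a, 'b, ('a, 'c) univ) msheaf" +
  assumes locally_constant: "locally_constant_sheaf X B E"
begin

lemma trivialised_at:
  assumes "x \<in> topspace X"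
  obtains U M \<phi> where "x \<in> U" "trivialised X B E U M \<phi>"
proof -
  obtain U and M :: "('b, ('a, 'c) univ) module" and \<phi> where "x \<in> U" "trivialisation X B E U M \<phi>"
    using locally_constant assms unfolding locally_constant_sheaf_def by blast
  moreover have "trivialised X B E U M \<phi>"
    using calculation(2) by (intro trivialised.intro trivialised_axioms.intro module_presheaf_axioms)
  ultimately show ?thesis using that by blast
qed

text \<open>Two sections given near a point have germs that agree throughout a neighbourhood of it or
  differ throughout one. Hence flat sections over a connected set are equal once they meet.\<close>

lemma flat_along_unique:
  assumes A: "connected A" and \<sigma>: "flat_along A f \<sigma>" and \<tau>: "flat_along A f \<tau>"
    and a: "a \<in> A" "\<sigma> a = \<tau> a" and b: "b \<in> A"
  shows "\<sigma> b = \<tau> b"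
proof (rule connected_induction_simple[where P = "\<lambda>z. \<sigma> z = \<tau> z", OF A a(1) b])
  fix z assume z: "z \<in> A"
  obtain N1 V s where N1: "openin (top_of_set A) N1" "z \<in> N1" "openin X V" "s \<in> carrier (sec E V)"
    "\<And>y. y \<in> N1 \<Longrightarrow> f y \<in> V" "\<And>y. y \<in> N1 \<Longrightarrow> \<sigma> y = germ X E (f y) V s"
    using \<sigma> z by (rule flat_alongE) blast
  obtain N2 W t where N2: "openin (top_of_set A) N2" "z \<in> N2" "openin X W" "t \<in> carrier (sec E W)"
    "\<And>y. y \<in> N2 \<Longrightarrow> f y \<in> W" "\<And>y. y \<in> N2 \<Longrightarrow> \<tau> y = germ X E (f y) W t"
    using \<tau> z by (rule flat_alongE) blast
  have fz: "f z \<in> V" "f z \<in> W" using N1 N2 by auto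
  then have "f z \<in> topspace X" using N1(3) openin_subset by blast
  then obtain U M \<phi> where U: "f z \<in> U" "trivialised X B E U M \<phi>" by (rule trivialised_at)
  have "\<exists>Z. openin X Z \<and> f z \<in> Z \<and>
      ((\<forall>x\<in>Z. germ X E x V s = germ X E x W t) \<or> (\<forall>x\<in>Z. germ X E x V s \<noteq> germ X E x W t))"
  proof (cases "germ X E (f z) V s = germ X E (f z) W t")
    case True
    show ?thesis using germs_locally_agree[OF N1(3,4) N2(3,4) fz True] by metis
  next
    case False
    show ?thesis using trivialised.germs_locally_differ[OF U(2) N1(3,4) N2(3,4) fz U(1) False] by metis
  qed
  then obtain Z where Z: "openin X Z" "f z \<in> Z"
    "(\<forall>x\<in>Z. germ X E x V s = germ X E x W t) \<or> (\<forall>x\<in>Z. germ X E x V s \<noteq> germ X E x W t)" by blast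
  let ?N = "N1 \<inter> N2 \<inter> {y \<in> A. f y \<in> Z}"
  have "openin (top_of_set A) {y \<in> A. f y \<in> Z}"
    using openin_continuous_map_preimage[OF flat_along_continuous[OF \<sigma>] Z(1)] by simp
  then have "openin (top_of_set A) ?N" using N1(1) N2(1) by blast
  moreover have "\<forall>x\<in>?N. \<forall>y\<in>?N. \<sigma> x = \<tau> x \<longrightarrow> \<sigma> y = \<tau> y"
    using Z(3) N1(6) N2(6) by auto
  ultimately show "\<exists>T. openin (top_of_set A) T \<and> z \<in> T \<and> (\<forall>x\<in>T. \<forall>y\<in>T. \<sigma> x = \<tau> x \<longrightarrow> \<sigma> y = \<tau> y)"
    using z N1(2) N2(2) Z(2) by (intro exI[of _ ?N]) blast
qed (rule a(2))

text \<open>The pullback of \<open>E\<close> along \<open>f\<close> has a global section through each germ. For connected \<open>A\<close> this says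
  that the pullback is a constant sheaf.\<close>

definition germs_extend :: "'z::topological_space set \<Rightarrow> ('z \<Rightarrow> 'a) \<Rightarrow> bool" where
  "germs_extend A f \<longleftrightarrow>
    (\<forall>z\<in>A. \<forall>g\<in>carrier (stalk X E (f z)). \<exists>\<sigma>. flat_along A f \<sigma> \<and> \<sigma> z = g)"

lemma germs_extend_trivialised:
  assumes f: "continuous_map (top_of_set A) X f" and U: "trivialised X B E U M \<phi>" and fU: "f \<in> A \<rightarrow> U"
  shows "germs_extend A f"
  unfolding germs_extend_def
proof (intro ballI)
  fix z g assume z: "z \<in> A" and g: "g \<in> carrier (stalk X E (f z))"
  interpret U: trivialised X B E U M \<phi> by (rule U)
  have "f z \<in> U" using z fU by blast
  then obtain m s where s: "U.constant_section m s" "g = germ X E (f z) U s"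
    using U.germ_of_constant_section g by metis
  have "flat_along A f (\<lambda>z. germ X E (f z) U s)"
    by (rule flat_along_section[OF f U.openU]) (use s fU in \<open>auto simp: U.constant_section_def\<close>)
  then show "\<exists>\<sigma>. flat_along A f \<sigma> \<and> \<sigma> z = g" using s(2) by metis
qed

text \<open>Extend the germ over the piece that contains its point, and the germ so obtained at the common
  point \<open>c\<close> over the other piece. By uniqueness the two extensions agree on the connected overlap.\<close>

lemma germs_extend_union:
  fixes A :: "'z::topological_space set"
  assumes f: "continuous_map (top_of_set A) X f"
    and A: "A = A1 \<union> A2" "closedin (top_of_set A) A1" "closedin (top_of_set A) A2"
    and conn: "connected (A1 \<inter> A2)" and ne: "c \<in> A1" "c \<in> A2"
    and ext: "germs_extend A1 f" "germs_extend A2 f"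
  shows "germs_extend A f"
  unfolding germs_extend_def
proof (intro ballI)
  fix z g assume z: "z \<in> A" and g: "g \<in> carrier (stalk X E (f z))"
  have extE: "\<exists>\<sigma>. flat_along P f \<sigma> \<and> \<sigma> y = h"
    if "germs_extend P f" "y \<in> P" "h \<in> carrier (stalk X E (f y))" for P y h
    using that by (simp add: germs_extend_def)
  have "\<exists>\<sigma>1 \<sigma>2. flat_along A1 f \<sigma>1 \<and> flat_along A2 f \<sigma>2 \<and> \<sigma>1 c = \<sigma>2 c \<and>
      (if z \<in> A1 then \<sigma>1 z else \<sigma>2 z) = g"
  proof (cases "z \<in> A1")
    case True
    obtain \<sigma>1 where 1: "flat_along A1 f \<sigma>1" "\<sigma>1 z = g" using extE[OF ext(1) True g] by blast
    obtain \<sigma>2 where "flat_along A2 f \<sigma>2" "\<sigma>2 c = \<sigma>1 c"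
      using extE[OF ext(2) ne(2) flat_along_in_stalk[OF 1(1) ne(1)]] by blast
    with 1 True show ?thesis by metis
  next
    case False
    then have "z \<in> A2" using z A(1) by blast
    then obtain \<sigma>2 where 2: "flat_along A2 f \<sigma>2" "\<sigma>2 z = g" using extE[OF ext(2) _ g] by blast
    obtain \<sigma>1 where "flat_along A1 f \<sigma>1" "\<sigma>1 c = \<sigma>2 c"
      using extE[OF ext(1) ne(1) flat_along_in_stalk[OF 2(1) ne(2)]] by blast
    with 2 False show ?thesis by metis
  qed
  then obtain \<sigma>1 \<sigma>2 where \<sigma>: "flat_along A1 f \<sigma>1" "flat_along A2 f \<sigma>2" "\<sigma>1 c = \<sigma>2 c"
    "(if z \<in> A1 then \<sigma>1 z else \<sigma>2 z) = g" by blast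
  have "\<sigma>1 y = \<sigma>2 y" if "y \<in> A1" "y \<in> A2" for y
    by (rule flat_along_unique[OF conn flat_along_subset[OF \<sigma>(1)] flat_along_subset[OF \<sigma>(2)], where a = c])
      (use that ne \<sigma>(3) in auto)
  from flat_along_paste[OF f A \<sigma>(1,2) this] show "\<exists>\<sigma>. flat_along A f \<sigma> \<and> \<sigma> z = g"
    using \<sigma>(4) by (intro exI conjI)
qed

text \<open>Cut the square into rectangles so small that each is mapped into a trivialising set, and
  assemble the rectangles to columns and the columns to the square.\<close>

lemma germs_extend_square:
  fixes f :: "real \<times> real \<Rightarrow> 'a"
  assumes f: "continuous_map (top_of_set ({0..1} \<times> {0..1})) X f"
  shows "germs_extend ({0..1} \<times> {0..1}) f"
proof -
  let ?Q = "{0..1::real} \<times> {0..1::real}"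
  define \<C> where "\<C> = {T. open T \<and> (\<exists>U M \<phi>. trivialised X B E U M \<phi> \<and> f \<in> ?Q \<inter> T \<rightarrow> U)}"
  have "z \<in> \<Union>\<C>" if z: "z \<in> ?Q" for z
  proof -
    have "f z \<in> topspace X" using f z by (auto simp: continuous_map_def)
    then obtain U M \<phi> where U: "f z \<in> U" "trivialised X B E U M \<phi>" by (rule trivialised_at)
    have "openin (top_of_set ?Q) {y \<in> ?Q. f y \<in> U}"
      using openin_continuous_map_preimage[OF f trivialised.openU[OF U(2)]] by simp
    then obtain T where T: "open T" "{y \<in> ?Q. f y \<in> U} = ?Q \<inter> T" unfolding openin_open by blast
    have "z \<in> T" "f \<in> ?Q \<inter> T \<rightarrow> U" using T(2) z U(1) by blast+
    then show ?thesis using T(1) U(2) unfolding \<C>_def by blast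
  qed
  then have "?Q \<subseteq> \<Union>\<C>" by (rule subsetI)
  moreover have "compact ?Q" by (intro compact_Times compact_Icc)
  moreover have "open T" if "T \<in> \<C>" for T using that by (simp add: \<C>_def)
  ultimately obtain e where e: "0 < e" "\<And>z. z \<in> ?Q \<Longrightarrow> \<exists>T\<in>\<C>. ball z e \<subseteq> T"
    using Heine_Borel_lemma[of ?Q \<C>] by metis
  have cont: "continuous_map (top_of_set R) X f" if "R \<subseteq> ?Q" for R
    using continuous_map_from_subtopology[OF f, of R] that by (simp add: subtopology_subtopology Int_absorb1)
  \<comment> \<open>With sides shorter than \<open>e/2\<close>, a rectangle lies in the ball of radius \<open>e\<close> about its corner.\<close>
  have small: "germs_extend ({a..b} \<times> {c..d}) f"
    if "0 \<le> a" "a \<le> b" "b \<le> 1" "0 \<le> c" "c \<le> d" "d \<le> 1" "b - a < e/2" "d - c < e/2" for a b c d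
  proof -
    have R: "{a..b} \<times> {c..d} \<subseteq> ?Q" using that by auto
    have "(a, c) \<in> ?Q" using that by simp
    then obtain T where T: "T \<in> \<C>" "ball (a, c) e \<subseteq> T" using e(2) by blast
    have "{a..b} \<times> {c..d} \<subseteq> ball (a, c) e"
    proof
      fix z assume "z \<in> {a..b} \<times> {c..d}"
      then obtain x y where z: "z = (x, y)" "a \<le> x" "x \<le> b" "c \<le> y" "y \<le> d" by auto
      have "dist (a, c) (x, y) \<le> \<bar>dist a x\<bar> + \<bar>dist c y\<bar>"
        unfolding dist_Pair_Pair by (rule sqrt_sum_squares_le_sum_abs)
      also have "\<dots> < e" using z that by (simp add: dist_real_def)
      finally show "z \<in> ball (a, c) e" by (simp add: z(1))
    qed
    then have "{a..b} \<times> {c..d} \<subseteq> ?Q \<inter> T" using T(2) R by blast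
    moreover obtain U M \<phi> where U: "trivialised X B E U M \<phi>" "f \<in> ?Q \<inter> T \<rightarrow> U"
      using T(1) unfolding \<C>_def by blast
    ultimately have "f \<in> {a..b} \<times> {c..d} \<rightarrow> U" by blast
    then show ?thesis by (rule germs_extend_trivialised[OF cont[OF R] U(1)])
  qed
  have closed: "closedin (top_of_set R) S" if "closed S" "S \<subseteq> R" for R S :: "(real \<times> real) set"
    using that by (simp add: closed_subset)
  have column: "germs_extend ({a..b} \<times> {0..1}) f" if ab: "0 \<le> a" "a \<le> b" "b \<le> 1" "b - a < e/2" for a b
  proof -
    have "0 \<le> (0::real) \<and> (0::real) \<le> 1 \<and> (1::real) \<le> 1 \<longrightarrow> germs_extend ({a..b} \<times> {0..1}) f"
    proof (rule Bolzano[where P = "\<lambda>c d. 0 \<le> c \<and> c \<le> d \<and> d \<le> 1 \<longrightarrow> germs_extend ({a..b} \<times> {c..d}) f"])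
      fix c d d' :: real assume *: "0 \<le> c \<and> c \<le> d \<and> d \<le> 1 \<longrightarrow> germs_extend ({a..b} \<times> {c..d}) f"
        "0 \<le> d \<and> d \<le> d' \<and> d' \<le> 1 \<longrightarrow> germs_extend ({a..b} \<times> {d..d'}) f" "c \<le> d" "d \<le> d'"
      show "0 \<le> c \<and> c \<le> d' \<and> d' \<le> 1 \<longrightarrow> germs_extend ({a..b} \<times> {c..d'}) f"
      proof (intro impI)
        assume c: "0 \<le> c \<and> c \<le> d' \<and> d' \<le> 1"
        have un: "{a..b} \<times> {c..d'} = {a..b} \<times> {c..d} \<union> {a..b} \<times> {d..d'}" using *(3,4) by auto
        have int: "{a..b} \<times> {c..d} \<inter> {a..b} \<times> {d..d'} = {a..b} \<times> {d..d}" using *(3,4) by auto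
        show "germs_extend ({a..b} \<times> {c..d'}) f"
        proof (rule germs_extend_union[OF cont un, where c = "(a, d)"])
          show "connected ({a..b} \<times> {c..d} \<inter> {a..b} \<times> {d..d'})"
            unfolding int by (intro connected_Times connected_Icc)
          show "closedin (top_of_set ({a..b} \<times> {c..d'})) ({a..b} \<times> {c..d})"
            "closedin (top_of_set ({a..b} \<times> {c..d'})) ({a..b} \<times> {d..d'})"
            using *(3,4) by (auto intro!: closed closed_Times)
        qed (use * ab c in auto)
      qed
    next
      fix x :: real
      show "\<exists>\<delta>>0. \<forall>c d. c \<le> x \<and> x \<le> d \<and> d - c < \<delta> \<longrightarrow>
          0 \<le> c \<and> c \<le> d \<and> d \<le> 1 \<longrightarrow> germs_extend ({a..b} \<times> {c..d}) f"
        by (rule exI[of _ "e/2"]) (use e(1) small ab in auto)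
    qed simp
    then show ?thesis by simp
  qed
  have "0 \<le> (0::real) \<and> (0::real) \<le> 1 \<and> (1::real) \<le> 1 \<longrightarrow> germs_extend ({0..1} \<times> {0..1}) f"
  proof (rule Bolzano[where P = "\<lambda>a b. 0 \<le> a \<and> a \<le> b \<and> b \<le> 1 \<longrightarrow> germs_extend ({a..b} \<times> {0..1}) f"])
    fix a b b' :: real assume *: "0 \<le> a \<and> a \<le> b \<and> b \<le> 1 \<longrightarrow> germs_extend ({a..b} \<times> {0..1}) f"
      "0 \<le> b \<and> b \<le> b' \<and> b' \<le> 1 \<longrightarrow> germs_extend ({b..b'} \<times> {0..1}) f" "a \<le> b" "b \<le> b'"
    show "0 \<le> a \<and> a \<le> b' \<and> b' \<le> 1 \<longrightarrow> germs_extend ({a..b'} \<times> {0..1}) f"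
    proof (intro impI)
      assume a: "0 \<le> a \<and> a \<le> b' \<and> b' \<le> 1"
      have un: "{a..b'} \<times> {0..1} = {a..b} \<times> {0..1} \<union> {b..b'} \<times> {0..1::real}" using *(3,4) by auto
      have int: "{a..b} \<times> {0..1} \<inter> {b..b'} \<times> {0..1} = {b..b} \<times> {0..1::real}" using *(3,4) by auto
      show "germs_extend ({a..b'} \<times> {0..1}) f"
      proof (rule germs_extend_union[OF cont un, where c = "(b, 0)"])
        show "connected ({a..b} \<times> {0..1::real} \<inter> {b..b'} \<times> {0..1})"
          unfolding int by (intro connected_Times connected_Icc)
        show "closedin (top_of_set ({a..b'} \<times> {0..1})) ({a..b} \<times> {0..1::real})"
          "closedin (top_of_set ({a..b'} \<times> {0..1})) ({b..b'} \<times> {0..1::real})"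
          using *(3,4) by (auto intro!: closed closed_Times)
      qed (use * a in auto)
    qed
  next
    fix x :: real
    show "\<exists>\<delta>>0. \<forall>a b. a \<le> x \<and> x \<le> b \<and> b - a < \<delta> \<longrightarrow>
        0 \<le> a \<and> a \<le> b \<and> b \<le> 1 \<longrightarrow> germs_extend ({a..b} \<times> {0..1}) f"
      by (rule exI[of _ "e/2"]) (use e(1) column in auto)
  qed simp
  then show ?thesis by simp
qed

text \<open>A flat section along a constant map is a locally constant family of germs at one point.\<close>

lemma flat_along_constant_map:
  assumes A: "connected A" "a \<in> A" "b \<in> A" and f: "\<And>z. z \<in> A \<Longrightarrow> f z = x" and fl: "flat_along A f \<sigma>"
  shows "\<sigma> a = \<sigma> b"
proof -
  have fl': "flat_along A (\<lambda>_. x) \<sigma>" by (rule flat_along_cong[OF fl]) (simp add: f)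
  have "\<sigma> a \<in> carrier (stalk X E x)" by (rule flat_along_in_stalk[OF fl' A(2)])
  then obtain W s where W: "openin X W" "x \<in> W" "s \<in> carrier (sec E W)" "\<sigma> a = germ X E x W s"
    by (rule stalkE)
  have "flat_along A (\<lambda>_. x) (\<lambda>_. germ X E x W s)"
    by (rule flat_along_section[OF flat_along_continuous[OF fl'] W(1,3) W(2)])
  from flat_along_unique[OF A(1) fl' this A(2) W(4) A(3)] show ?thesis by (simp add: W(4))
qed

text \<open>A flat section over the whole homotopy restricts to flat sections along both paths, and it is
  constant on the two sides where the homotopy stands still.\<close>

lemma flat_along_homotopic:
  assumes hom: "path_homotopic X \<gamma> \<delta>"
    and \<sigma>: "flat_along {0..1} \<gamma> \<sigma>" and \<tau>: "flat_along {0..1} \<delta> \<tau>" and start: "\<sigma> 0 = \<tau> 0"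
  shows "\<sigma> 1 = \<tau> 1"
proof -
  obtain H where H: "continuous_map (top_of_set ({0..1::real} \<times> {0..1::real})) X H"
    "\<And>t. H (0, t) = \<gamma> t" "\<And>t. H (1, t) = \<delta> t"
    "\<And>s. s \<in> {0..1} \<Longrightarrow> H (s, 0) = \<gamma> 0" "\<And>s. s \<in> {0..1} \<Longrightarrow> H (s, 1) = \<gamma> 1"
    using hom by (rule path_homotopicE) blast
  have "\<sigma> 0 \<in> carrier (stalk X E (H (0, 0)))" using flat_along_in_stalk[OF \<sigma>, of 0] by (simp add: H)
  then obtain \<Sigma> where \<Sigma>: "flat_along ({0..1} \<times> {0..1}) H \<Sigma>" "\<Sigma> (0, 0) = \<sigma> 0"
    using germs_extend_square[OF H(1)] unfolding germs_extend_def by fastforce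
  have edge: "flat_along {0..1::real} (\<lambda>t. H (k t)) (\<lambda>t. \<Sigma> (k t))"
    if "continuous_on {0..1} k" "k \<in> {0..1} \<rightarrow> {0..1} \<times> {0..1}" for k
    by (rule flat_along_compose[OF \<Sigma>(1) that])
  have left: "flat_along {0..1} \<gamma> (\<lambda>t. \<Sigma> (0, t))"
    using edge[of "\<lambda>t. (0, t)"] by (simp add: H continuous_intros)
  have right: "flat_along {0..1} \<delta> (\<lambda>t. \<Sigma> (1, t))"
    using edge[of "\<lambda>t. (1, t)"] by (simp add: H continuous_intros)
  have "flat_along {0..1} (\<lambda>t. H (t, 0)) (\<lambda>t. \<Sigma> (t, 0))"
    using edge[of "\<lambda>t. (t, 0)"] by (simp add: continuous_intros)
  then have bottom: "\<Sigma> (0, 0) = \<Sigma> (1, 0)"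
    by (rule flat_along_constant_map[OF connected_Icc, rotated 3]) (simp_all add: H(4))
  have "flat_along {0..1} (\<lambda>t. H (t, 1)) (\<lambda>t. \<Sigma> (t, 1))"
    using edge[of "\<lambda>t. (t, 1)"] by (simp add: continuous_intros)
  then have top: "\<Sigma> (0, 1) = \<Sigma> (1, 1)"
    by (rule flat_along_constant_map[OF connected_Icc, rotated 3]) (simp_all add: H(5))
  have "\<Sigma> (0, 1) = \<sigma> 1"
    by (rule flat_along_unique[OF connected_Icc left \<sigma>, where a = 0]) (simp_all add: \<Sigma>)
  moreover have "\<Sigma> (1, 1) = \<tau> 1"
    by (rule flat_along_unique[OF connected_Icc right \<tau>, where a = 0]) (use \<Sigma>(2) bottom start in simp_all)
  ultimately show ?thesis using top by simp
qed

end


section \<open>Parallel transport\<close>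

locale local_system = locally_constant_module_sheaf X B E
  for X :: "'a topology" and B :: "('b, 'x) ring_scheme" and E :: "('a, 'b, ('a, 'c) univ) msheaf" +
  assumes stalk_fg_projective: "x \<in> topspace X \<Longrightarrow> fg_projective B (stalk X E x)"
begin

lemma stalk_module: "x \<in> topspace X \<Longrightarrow> left_module B (stalk X E x)"
  by (rule fg_projective_left_module[OF stalk_fg_projective])

text \<open>One step of the transport extends a flat section by a constant section over the trivialising
  set.\<close>

lemma transport_upto_flat:
  assumes T: "transport_upto X B E \<gamma> t T" and \<gamma>: "pathin X \<gamma>"
  shows "0 \<le> t \<and> t \<le> 1 \<and> T \<in> module_iso B (stalk X E (\<gamma> 0)) (stalk X E (\<gamma> t)) \<and>
    (\<forall>g\<in>carrier (stalk X E (\<gamma> 0)). \<exists>\<sigma>. flat_along {0..t} \<gamma> \<sigma> \<and> \<sigma> 0 = g \<and> \<sigma> t = T g)"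
  using T
proof (induction rule: transport_upto.induct)
  case start
  have M: "left_module B (stalk X E (\<gamma> 0))" by (rule stalk_module[OF path_start_in_topspace[OF \<gamma>]])
  have "\<exists>\<sigma>. flat_along {0..0} \<gamma> \<sigma> \<and> \<sigma> 0 = g" if g: "g \<in> carrier (stalk X E (\<gamma> 0))" for g
  proof -
    obtain W s where W: "openin X W" "\<gamma> 0 \<in> W" "s \<in> carrier (sec E W)" "g = germ X E (\<gamma> 0) W s"
      using g by (rule stalkE)
    have "flat_along {0..0} \<gamma> (\<lambda>z. germ X E (\<gamma> z) W s)"
      by (rule flat_along_section[OF pathin_continuous_on_subset[OF \<gamma>] W(1,3)]) (use W(2) in auto)
    then show ?thesis using W(4) by blast
  qed
  note ex = this
  show ?case
  proof (intro conjI ballI)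
    show "(\<lambda>g\<in>carrier (stalk X E (\<gamma> 0)). g) \<in> module_iso B (stalk X E (\<gamma> 0)) (stalk X E (\<gamma> 0))"
      by (rule module_iso_ident[OF M])
  qed (use ex in auto)
next
  case (step t T t' U M \<phi>)
  let ?S = "\<lambda>t. stalk X E (\<gamma> t)"
  interpret U: trivialised X B E U M \<phi>
    by (rule trivialised.intro[OF module_presheaf_axioms trivialised_axioms.intro[OF step(4)]])
  have t: "0 \<le> t" "t \<le> 1" and T: "T \<in> module_iso B (?S 0) (?S t)"
    and flat: "\<And>g. g \<in> carrier (?S 0) \<Longrightarrow> \<exists>\<sigma>. flat_along {0..t} \<gamma> \<sigma> \<and> \<sigma> 0 = g \<and> \<sigma> t = T g"
    using step.IH by auto
  have U: "\<gamma> z \<in> U" if "z \<in> {t..t'}" for z using that step(5) by blast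
  have Ut: "\<gamma> t \<in> U" "\<gamma> t' \<in> U" using U step(2) by simp_all
  let ?c = "constant_identification X E U \<phi> (\<gamma> t) (\<gamma> t')"
  have "compose (carrier (?S 0)) (restrict ?c (carrier (?S t))) T \<in> module_iso B (?S 0) (?S t')"
    by (rule module_iso_comp[OF stalk_module[OF path_start_in_topspace[OF \<gamma>]] T
          U.constant_identification_module_iso[OF Ut]])
  moreover have "compose (carrier (?S 0)) (restrict ?c (carrier (?S t))) T = compose (carrier (?S 0)) ?c T"
    by (auto simp: compose_def module_iso_closed[OF T])
  moreover have "\<exists>\<sigma>. flat_along {0..t'} \<gamma> \<sigma> \<and> \<sigma> 0 = g \<and> \<sigma> t' = compose (carrier (?S 0)) ?c T g"
    if g: "g \<in> carrier (?S 0)" for g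
  proof -
    obtain \<sigma> where \<sigma>: "flat_along {0..t} \<gamma> \<sigma>" "\<sigma> 0 = g" "\<sigma> t = T g" using flat[OF g] by blast
    obtain m s where s: "U.constant_section m s" "T g = germ X E (\<gamma> t) U s"
      using U.germ_of_constant_section[OF Ut(1) module_iso_closed[OF T g]] .
    have sU: "s \<in> carrier (sec E U)" using s(1) by (simp add: U.constant_section_def)
    have cont: "continuous_map (top_of_set A) X \<gamma>" if "A \<subseteq> {0..t'}" for A
      by (rule pathin_continuous_on_subset[OF \<gamma>]) (use that step(3) in auto)
    have fl: "flat_along {t..t'} \<gamma> (\<lambda>z. germ X E (\<gamma> z) U s)"
      by (rule flat_along_section[OF cont U.openU sU U]) (use t in auto)
    have un: "{0..t'} = {0..t} \<union> {t..t'}" using t step(2) by auto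
    let ?\<tau> = "\<lambda>z. if z \<in> {0..t} then \<sigma> z else germ X E (\<gamma> z) U s"
    have "flat_along {0..t'} \<gamma> ?\<tau>"
    proof (rule flat_along_paste[OF cont un _ _ \<sigma>(1) fl])
      show "closedin (top_of_set {0..t'}) {0..t}" "closedin (top_of_set {0..t'}) {t..t'}"
        using t step(2) by (auto intro: closed_subset)
      show "\<sigma> z = germ X E (\<gamma> z) U s" if "z \<in> {0..t}" "z \<in> {t..t'}" for z
      proof -
        have "z = t" using that by simp
        then show ?thesis using \<sigma>(3) s(2) by simp
      qed
    qed simp
    moreover have "?c (T g) = germ X E (\<gamma> t') U s"
      unfolding s(2) by (rule U.constant_identification_germ[OF Ut s(1)])
    ultimately show ?thesis
      using \<sigma>(2) t step(2) g by (intro exI[of _ ?\<tau>] conjI) (simp_all add: compose_eq)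
  qed
  ultimately show ?case using t step(2,3) by simp
qed

text \<open>Bisection: a chain up to \<open>a\<close> that can be continued to \<open>b\<close>, and from there to \<open>c\<close>, can be continued
  from \<open>a\<close> to \<open>c\<close>, and over a short interval the path stays in one trivialising set.\<close>

lemma transport_exists:
  assumes \<gamma>: "pathin X \<gamma>"
  obtains T where "transport_upto X B E \<gamma> 1 T"
proof -
  let ?P = "\<lambda>a b. 0 \<le> a \<and> a \<le> b \<and> b \<le> 1 \<longrightarrow>
    (\<forall>T. transport_upto X B E \<gamma> a T \<longrightarrow> (\<exists>T'. transport_upto X B E \<gamma> b T'))"
  have "?P 0 1"
  proof (rule Bolzano[where P = ?P])
    fix x :: real assume "0 \<le> x" "x \<le> 1"
    then have x: "x \<in> {0..1}" by simp
    obtain U M \<phi> where U: "\<gamma> x \<in> U" "trivialised X B E U M \<phi>"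
      by (rule trivialised_at[OF pathin_in_topspace[OF \<gamma> x]])
    have "openin (top_of_set {0..1}) {y \<in> {0..1}. \<gamma> y \<in> U}"
      using openin_continuous_map_preimage[OF \<gamma>[unfolded pathin_def] trivialised.openU[OF U(2)]] by simp
    then obtain d where d: "d > 0" "\<And>y. y \<in> {0..1} \<Longrightarrow> dist y x < d \<Longrightarrow> \<gamma> y \<in> U"
      using U(1) x unfolding openin_euclidean_subtopology_iff by blast
    show "\<exists>d>0. \<forall>a b. a \<le> x \<and> x \<le> b \<and> b - a < d \<longrightarrow> ?P a b"
    proof (intro exI[of _ d] conjI allI impI, fact d(1))
      fix a b T assume ab: "a \<le> x \<and> x \<le> b \<and> b - a < d" "0 \<le> a \<and> a \<le> b \<and> b \<le> 1"
        and T: "transport_upto X B E \<gamma> a T"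
      have "\<gamma> ` {a..b} \<subseteq> U"
      proof (rule image_subsetI)
        fix y assume "y \<in> {a..b}"
        then show "\<gamma> y \<in> U" using ab by (intro d(2)) (auto simp: dist_real_def)
      qed
      then show "\<exists>T'. transport_upto X B E \<gamma> b T'"
        using transport_upto.step[OF T _ _ trivialised.triv[OF U(2)], of b] T ab by (cases "a = b") auto
    qed
  qed auto
  with transport_upto.start[of X B E \<gamma>] have "\<exists>T. transport_upto X B E \<gamma> 1 T" by force
  then show ?thesis using that by blast
qed

text \<open>The description that defines \<open>parallel_transport\<close> is legitimate: any chain along any path of the
  class maps the initial value of a flat section to its final value, and flat sections along
  homotopic paths with the same start have the same end.\<close>

lemma parallel_transport_transport_upto:
  assumes \<gamma>: "pathin X \<gamma>" and T: "transport_upto X B E \<gamma> 1 T"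
  shows "parallel_transport X B E (path_class X \<gamma>) = T"
  unfolding parallel_transport_def
proof (rule the_equality)
  show "\<exists>\<delta>\<in>path_class X \<gamma>. transport_upto X B E \<delta> 1 T"
    using T \<gamma> by (auto simp: path_class_def intro: path_homotopic_refl)
  fix T' assume "\<exists>\<delta>\<in>path_class X \<gamma>. transport_upto X B E \<delta> 1 T'"
  then obtain \<delta> where hom: "path_homotopic X \<gamma> \<delta>" and T': "transport_upto X B E \<delta> 1 T'"
    by (auto simp: path_class_def)
  have \<delta>: "pathin X \<delta>" "\<delta> 0 = \<gamma> 0" "\<delta> 1 = \<gamma> 1"
    using path_homotopic_pathin[OF hom] path_homotopic_ends[OF hom] by auto
  note 1 = transport_upto_flat[OF T \<gamma>] and 2 = transport_upto_flat[OF T' \<delta>(1), unfolded \<delta>(2,3)]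
  show "T' = T"
  proof (rule extensionalityI)
    show "T' \<in> extensional (carrier (stalk X E (\<gamma> 0)))" "T \<in> extensional (carrier (stalk X E (\<gamma> 0)))"
      using 1 2 by (auto dest: module_iso_extensional)
    fix g assume "g \<in> carrier (stalk X E (\<gamma> 0))"
    then obtain \<sigma> \<tau> where "flat_along {0..1} \<gamma> \<sigma>" "\<sigma> 0 = g" "\<sigma> 1 = T g"
      "flat_along {0..1} \<delta> \<tau>" "\<tau> 0 = g" "\<tau> 1 = T' g"
      using 1 2 by blast
    then show "T' g = T g" using flat_along_homotopic[OF hom] by metis
  qed
qed

lemma parallel_transport_module_iso:
  assumes "pathin X \<gamma>"
  shows "parallel_transport X B E (path_class X \<gamma>) \<in> module_iso B (stalk X E (\<gamma> 0)) (stalk X E (\<gamma> 1))"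
proof -
  obtain T where T: "transport_upto X B E \<gamma> 1 T" by (rule transport_exists[OF assms])
  show ?thesis
    using transport_upto_flat[OF T assms] parallel_transport_transport_upto[OF assms T] by simp
qed

lemma flat_along_path_exists:
  assumes "pathin X \<gamma>" "g \<in> carrier (stalk X E (\<gamma> 0))"
  obtains \<sigma> where "flat_along {0..1} \<gamma> \<sigma>" "\<sigma> 0 = g"
proof -
  obtain T where T: "transport_upto X B E \<gamma> 1 T" by (rule transport_exists[OF assms(1)])
  show ?thesis using transport_upto_flat[OF T assms(1)] assms(2) that by blast
qed

lemma parallel_transport_flat:
  assumes \<sigma>: "flat_along {0..1} \<gamma> \<sigma>"
  shows "parallel_transport X B E (path_class X \<gamma>) (\<sigma> 0) = \<sigma> 1"
proof -
  have \<gamma>: "pathin X \<gamma>" using flat_along_continuous[OF \<sigma>] by (simp add: pathin_def)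
  obtain T where T: "transport_upto X B E \<gamma> 1 T" by (rule transport_exists[OF \<gamma>])
  have "\<sigma> 0 \<in> carrier (stalk X E (\<gamma> 0))" by (rule flat_along_in_stalk[OF \<sigma>]) simp
  then obtain \<tau> where \<tau>: "flat_along {0..1} \<gamma> \<tau>" "\<tau> 0 = \<sigma> 0" "\<tau> 1 = T (\<sigma> 0)"
    using transport_upto_flat[OF T \<gamma>] by blast
  have "\<tau> 1 = \<sigma> 1"
    by (rule flat_along_unique[OF connected_Icc \<tau>(1) \<sigma>, where a = 0]) (use \<tau>(2) in simp_all)
  then show ?thesis using \<tau>(3) parallel_transport_transport_upto[OF \<gamma> T] by simp
qed

lemma parallel_transport_const:
  assumes x: "x \<in> topspace X"
  shows "parallel_transport X B E (path_class X (\<lambda>_. x)) = (\<lambda>g\<in>carrier (stalk X E x). g)"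
proof (rule extensionalityI)
  have p: "pathin X (\<lambda>_. x)" using x by simp
  show "parallel_transport X B E (path_class X (\<lambda>_. x)) \<in> extensional (carrier (stalk X E x))"
    using module_iso_extensional[OF parallel_transport_module_iso[OF p]] by simp
  fix g assume g: "g \<in> carrier (stalk X E x)"
  obtain \<sigma> where \<sigma>: "flat_along {0..1::real} (\<lambda>_. x) \<sigma>" "\<sigma> 0 = g"
    using flat_along_path_exists[OF p, of g] g by auto
  have "\<sigma> 0 = \<sigma> 1" by (rule flat_along_constant_map[OF connected_Icc _ _ _ \<sigma>(1)]) simp_all
  then show "parallel_transport X B E (path_class X (\<lambda>_. x)) g = (\<lambda>g\<in>carrier (stalk X E x). g) g"
    using parallel_transport_flat[OF \<sigma>(1)] \<sigma>(2) g by simp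
qed simp

text \<open>The two halves of a flat section along the joined path are flat along its two parts.\<close>

lemma parallel_transport_join:
  assumes \<gamma>: "pathin X \<gamma>" and \<delta>: "pathin X \<delta>" and ends: "\<gamma> 1 = \<delta> 0"
  shows "parallel_transport X B E (path_class X (path_join \<gamma> \<delta>))
    = compose (carrier (stalk X E (\<gamma> 0))) (parallel_transport X B E (path_class X \<delta>))
        (parallel_transport X B E (path_class X \<gamma>))"
proof (rule extensionalityI)
  let ?j = "path_join \<gamma> \<delta>"
  have j: "pathin X ?j" "?j 0 = \<gamma> 0" by (simp_all add: pathin_join[OF assms])
  show "parallel_transport X B E (path_class X ?j) \<in> extensional (carrier (stalk X E (\<gamma> 0)))"
    using module_iso_extensional[OF parallel_transport_module_iso[OF j(1)]] j(2) by simp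
  fix g assume g: "g \<in> carrier (stalk X E (\<gamma> 0))"
  obtain \<sigma> where \<sigma>: "flat_along {0..1::real} ?j \<sigma>" "\<sigma> 0 = g"
    using flat_along_path_exists[OF j(1), of g] g j(2) by auto
  have "flat_along {0..1::real} (\<lambda>t. ?j (t / 2)) (\<lambda>t. \<sigma> (t / 2))"
    by (rule flat_along_compose[OF \<sigma>(1)]) (auto intro!: continuous_intros)
  then have "flat_along {0..1::real} \<gamma> (\<lambda>t. \<sigma> (t / 2))"
    by (rule flat_along_cong) (simp add: path_join_def)
  from parallel_transport_flat[OF this]
  have 1: "parallel_transport X B E (path_class X \<gamma>) g = \<sigma> (1 / 2)" using \<sigma>(2) by simp
  have "flat_along {0..1::real} (\<lambda>t. ?j ((t + 1) / 2)) (\<lambda>t. \<sigma> ((t + 1) / 2))"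
    by (rule flat_along_compose[OF \<sigma>(1)]) (auto intro!: continuous_intros)
  then have "flat_along {0..1::real} \<delta> (\<lambda>t. \<sigma> ((t + 1) / 2))"
  proof (rule flat_along_cong)
    \<comment> \<open>At parameter \<open>1/2\<close> the joined path is defined by \<open>\<gamma>\<close>, so \<open>t = 0\<close> uses that the ends meet.\<close>
    fix t :: real assume t: "t \<in> {0..1}"
    have "2 * ((t + 1) / 2) - 1 = t" by (simp add: field_simps)
    then show "\<delta> t = ?j ((t + 1) / 2)" using t ends by (cases "t = 0") (simp_all add: path_join_def)
  qed
  from parallel_transport_flat[OF this]
  have 2: "parallel_transport X B E (path_class X \<delta>) (\<sigma> (1 / 2)) = \<sigma> 1" by simp
  show "parallel_transport X B E (path_class X ?j) g
    = compose (carrier (stalk X E (\<gamma> 0))) (parallel_transport X B E (path_class X \<delta>))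
        (parallel_transport X B E (path_class X \<gamma>)) g"
    using parallel_transport_flat[OF \<sigma>(1)] \<sigma>(2) 1 2 g by (simp add: compose_eq)
qed simp

lemma Mon_ob_functor: "is_functor (fundamental_groupoid X) (core (Proj B)) (Mon_ob X B E)"
proof (rule functorI)
  fix x assume "x \<in> Ob (fundamental_groupoid X)"
  then show "on_ob (Mon_ob X B E) x \<in> Ob (core (Proj B))"
    and "on_hom (Mon_ob X B E) x x (Ident (fundamental_groupoid X) x) = Ident (core (Proj B)) (on_ob (Mon_ob X B E) x)"
    by (simp_all add: Mon_ob_def stalk_fg_projective parallel_transport_const)
next
  fix x y f assume f: "f \<in> Hom (fundamental_groupoid X) x y" and x: "x \<in> Ob (fundamental_groupoid X)"
  then obtain \<gamma> where \<gamma>: "pathin X \<gamma>" "\<gamma> 0 = x" "\<gamma> 1 = y" "f = path_class X \<gamma>" by auto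
  then show "on_hom (Mon_ob X B E) x y f \<in> Hom (core (Proj B)) (on_ob (Mon_ob X B E) x) (on_ob (Mon_ob X B E) y)"
    using parallel_transport_module_iso[OF \<gamma>(1)] x by (simp add: Mon_ob_def is_iso_Proj stalk_module)
next
  fix x y z f g assume "f \<in> Hom (fundamental_groupoid X) x y" "g \<in> Hom (fundamental_groupoid X) y z"
  then obtain \<gamma> \<delta> where \<gamma>: "pathin X \<gamma>" "\<gamma> 0 = x" "\<gamma> 1 = y" "f = path_class X \<gamma>"
    and \<delta>: "pathin X \<delta>" "\<delta> 0 = y" "\<delta> 1 = z" "g = path_class X \<delta>" by auto
  have "\<gamma> 1 = \<delta> 0" by (simp add: \<gamma> \<delta>)
  from path_class_join[OF \<gamma>(1) \<delta>(1) this] parallel_transport_join[OF \<gamma>(1) \<delta>(1) this]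
  show "on_hom (Mon_ob X B E) x z (Comp (fundamental_groupoid X) x y z g f)
    = Comp (core (Proj B)) (on_ob (Mon_ob X B E) x) (on_ob (Mon_ob X B E) y) (on_ob (Mon_ob X B E) z)
        (on_hom (Mon_ob X B E) y z g) (on_hom (Mon_ob X B E) x y f)"
    by (simp add: Mon_ob_def \<gamma>(2,4) \<delta>(4))
qed

end


section \<open>Morphisms of sheaves and their stalk maps\<close>

lemma sheaf_hom_module_hom:
  "\<phi> \<in> sheaf_hom X B E E' \<Longrightarrow> openin X U \<Longrightarrow> \<phi> U \<in> module_hom (const_ring X B U) (sec E U) (sec E' U)"
  by (simp add: sheaf_hom_def)

lemma sheaf_hom_res:
  "\<phi> \<in> sheaf_hom X B E E' \<Longrightarrow> openin X U \<Longrightarrow> openin X V \<Longrightarrow> V \<subseteq> U \<Longrightarrow> s \<in> carrier (sec E U) \<Longrightarrow>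
    res E' U V (\<phi> U s) = \<phi> V (res E U V s)"
  by (simp add: sheaf_hom_def)

lemma sheaf_hom_extensional: "\<phi> \<in> sheaf_hom X B E E' \<Longrightarrow> \<phi> \<in> extensional {U. openin X U}"
  by (simp add: sheaf_hom_def)

lemma sheaf_homI:
  assumes "\<phi> \<in> extensional {U. openin X U}"
    and "\<And>U. openin X U \<Longrightarrow> \<phi> U \<in> module_hom (const_ring X B U) (sec E U) (sec E' U)"
    and "\<And>U V s. openin X U \<Longrightarrow> openin X V \<Longrightarrow> V \<subseteq> U \<Longrightarrow> s \<in> carrier (sec E U) \<Longrightarrow>
      res E' U V (\<phi> U s) = \<phi> V (res E U V s)"
  shows "\<phi> \<in> sheaf_hom X B E E'"
  using assms by (simp add: sheaf_hom_def)

lemma sheaf_comp_apply: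
  "openin X U \<Longrightarrow> s \<in> carrier (sec E U) \<Longrightarrow> sheaf_comp X E \<psi> \<phi> U s = \<psi> U (\<phi> U s)"
  by (simp add: sheaf_comp_def compose_eq)

lemma sheaf_id_apply: "openin X U \<Longrightarrow> s \<in> carrier (sec E U) \<Longrightarrow> sheaf_id X E U s = s"
  by (simp add: sheaf_id_def)

context module_presheaf
begin

lemma sheaf_id_hom: "sheaf_id X E \<in> sheaf_hom X B E E"
proof (rule sheaf_homI)
  fix U assume U: "openin X U"
  show "sheaf_id X E U \<in> module_hom (const_ring X B U) (sec E U) (sec E U)"
    by (rule module_homI) (use U in \<open>simp_all add: sheaf_id_def sec_add_closed sec_smult_closed\<close>)
qed (simp_all add: sheaf_id_def res_closed)

lemma sheaf_comp_hom:
  assumes \<phi>: "\<phi> \<in> sheaf_hom X B E E'" and \<psi>: "\<psi> \<in> sheaf_hom X B E' E''"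
  shows "sheaf_comp X E \<psi> \<phi> \<in> sheaf_hom X B E E''"
proof (rule sheaf_homI)
  fix U assume U: "openin X U"
  show "sheaf_comp X E \<psi> \<phi> U \<in> module_hom (const_ring X B U) (sec E U) (sec E'' U)"
    using module_hom_compose[OF sheaf_hom_module_hom[OF \<phi> U] sheaf_hom_module_hom[OF \<psi> U]] U
    by (simp add: sheaf_comp_def sec_add_closed sec_smult_closed)
next
  fix U V s assume UV: "openin X U" "openin X V" "V \<subseteq> U" and s: "s \<in> carrier (sec E U)"
  have "\<phi> U s \<in> carrier (sec E' U)" by (rule module_hom_closed[OF sheaf_hom_module_hom[OF \<phi> UV(1)] s])
  then show "res E'' U V (sheaf_comp X E \<psi> \<phi> U s) = sheaf_comp X E \<psi> \<phi> V (res E U V s)"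
    using UV s by (simp add: sheaf_comp_apply res_closed sheaf_hom_res[OF \<phi>] sheaf_hom_res[OF \<psi>])
qed (simp add: sheaf_comp_def)

text \<open>Sectionwise inverses commute with restrictions because the morphism does.\<close>

lemma sheaf_isoI:
  assumes \<phi>: "\<phi> \<in> sheaf_hom X B E E'"
    and bij: "\<And>U. openin X U \<Longrightarrow> bij_betw (\<phi> U) (carrier (sec E U)) (carrier (sec E' U))"
  shows "\<phi> \<in> sheaf_iso X B E E'"
proof -
  define \<psi> where "\<psi> = (\<lambda>U\<in>{U. openin X U}. restrict (inv_into (carrier (sec E U)) (\<phi> U)) (carrier (sec E' U)))"
  have \<psi>: "\<psi> U = restrict (inv_into (carrier (sec E U)) (\<phi> U)) (carrier (sec E' U))" if "openin X U" for U
    using that by (simp add: \<psi>_def)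
  have closed: "\<phi> U s \<in> carrier (sec E' U)" if "openin X U" "s \<in> carrier (sec E U)" for U s
    by (rule module_hom_closed[OF sheaf_hom_module_hom[OF \<phi> that(1)] that(2)])
  have \<psi>\<phi>: "\<psi> U (\<phi> U s) = s" if "openin X U" "s \<in> carrier (sec E U)" for U s
    using that bij[OF that(1)] closed by (simp add: \<psi> bij_betw_def)
  have surj: "\<exists>s\<in>carrier (sec E U). u = \<phi> U s" if "openin X U" "u \<in> carrier (sec E' U)" for U u
    using bij[OF that(1)] that(2) by (auto simp: bij_betw_def)
  have "\<psi> \<in> sheaf_hom X B E' E"
  proof (rule sheaf_homI)
    fix U assume U: "openin X U"
    show "\<psi> U \<in> module_hom (const_ring X B U) (sec E' U) (sec E U)"
      unfolding \<psi>[OF U]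
      by (rule module_hom_inverse[OF sheaf_hom_module_hom[OF \<phi> U] bij[OF U]])
        (use U in \<open>simp_all add: sec_add_closed sec_smult_closed\<close>)
  next
    fix U V u assume UV: "openin X U" "openin X V" "V \<subseteq> U" and u: "u \<in> carrier (sec E' U)"
    then obtain s where s: "s \<in> carrier (sec E U)" "u = \<phi> U s" using surj by blast
    then show "res E U V (\<psi> U u) = \<psi> V (res E' U V u)"
      using UV by (simp add: sheaf_hom_res[OF \<phi>] \<psi>\<phi> res_closed)
  qed (simp add: \<psi>_def)
  moreover have "sheaf_comp X E \<psi> \<phi> = sheaf_id X E"
    unfolding sheaf_comp_def sheaf_id_def
    by (intro restrict_ext) (auto simp: compose_def \<psi>\<phi>)
  moreover have "sheaf_comp X E' \<phi> \<psi> = sheaf_id X E'"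
  proof -
    have "\<phi> U (\<psi> U u) = u" if "openin X U" "u \<in> carrier (sec E' U)" for U u
      using surj[OF that] \<psi>\<phi>[OF that(1)] by auto
    then show ?thesis
      unfolding sheaf_comp_def sheaf_id_def by (intro restrict_ext) (auto simp: compose_def)
  qed
  ultimately show ?thesis using \<phi> by (auto simp: sheaf_iso_def)
qed

lemma presheaf_subtopology:
  assumes U: "openin X U"
  shows "module_presheaf (subtopology X U) B E"
proof
  have ring: "const_ring (subtopology X U) B V = const_ring X B V" if "V \<subseteq> U" for V
    using that by (simp add: const_ring_def locally_constant_on_subtopology[OF U])
  have op: "openin (subtopology X U) V \<longleftrightarrow> openin X V \<and> V \<subseteq> U" for V
    using U by (auto simp: openin_open_subtopology)
  show "is_presheaf (subtopology X U) B E"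
    unfolding is_presheaf_def op
    using sec_module res_properties by (auto simp: ring res_id res_res)
qed

end

locale presheaf_morphism = E: module_presheaf X B E + E': module_presheaf X B E'
  for X :: "'a topology" and B :: "('b, 'x) ring_scheme"
    and E E' :: "('a, 'b, ('a, 'c) univ) msheaf" +
  fixes \<phi> :: "'a set \<Rightarrow> ('a, 'c) univ \<Rightarrow> ('a, 'c) univ"
  assumes hom: "\<phi> \<in> sheaf_hom X B E E'"
begin

lemma hom_closed: "openin X U \<Longrightarrow> s \<in> carrier (sec E U) \<Longrightarrow> \<phi> U s \<in> carrier (sec E' U)"
  using module_hom_closed[OF sheaf_hom_module_hom[OF hom]] .

lemma stalk_map_germ:
  assumes U: "openin X U" "x \<in> U" and s: "s \<in> carrier (sec E U)"
  shows "stalk_map X E E' \<phi> x (germ X E x U s) = germ X E' x U (\<phi> U s)"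
proof -
  let ?g = "germ X E x U s"
  let ?N = "germ_nbhd ?g"
  note g = E.germ_nbhd_section[OF E.germ_in_stalk[OF U s]]
  obtain Z where Z: "openin X Z" "x \<in> Z" "Z \<subseteq> ?N" "Z \<subseteq> U" "res E ?N Z (germ_section ?g) = res E U Z s"
    using g(4) E.germ_eq_iff[OF g(1-3) U s] by auto
  have "germ X E' x ?N (\<phi> ?N (germ_section ?g)) = germ X E' x Z (res E' ?N Z (\<phi> ?N (germ_section ?g)))"
    by (rule E'.germ_res[symmetric]) (use g Z hom_closed in auto)
  also have "res E' ?N Z (\<phi> ?N (germ_section ?g)) = res E' U Z (\<phi> U s)"
    using sheaf_hom_res[OF hom g(1) Z(1,3) g(3)] sheaf_hom_res[OF hom U(1) Z(1,4) s] Z(5) by simp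
  also have "germ X E' x Z (res E' U Z (\<phi> U s)) = germ X E' x U (\<phi> U s)"
    by (rule E'.germ_res) (use U s Z hom_closed in auto)
  finally show ?thesis using E.germ_in_stalk[OF U s] by (simp add: stalk_map_def)
qed

lemma stalk_map_closed: "g \<in> carrier (stalk X E x) \<Longrightarrow> stalk_map X E E' \<phi> x g \<in> carrier (stalk X E' x)"
  by (erule E.stalkE) (simp add: stalk_map_germ E'.germ_in_stalk hom_closed)

lemma stalk_map_module_hom: "stalk_map X E E' \<phi> x \<in> module_hom B (stalk X E x) (stalk X E' x)"
proof (rule module_homI)
  show "stalk_map X E E' \<phi> x \<in> extensional (carrier (stalk X E x))" by (simp add: stalk_map_def)
  fix g assume g: "g \<in> carrier (stalk X E x)"
  then show "stalk_map X E E' \<phi> x g \<in> carrier (stalk X E' x)" by (rule stalk_map_closed)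
  fix h assume "h \<in> carrier (stalk X E x)"
  with g obtain U s t where U: "openin X U" "x \<in> U" and s: "s \<in> carrier (sec E U)" and t: "t \<in> carrier (sec E U)"
    and gh: "g = germ X E x U s" "h = germ X E x U t"
    by (rule E.stalk_common_nbhd)
  show "stalk_map X E E' \<phi> x (g \<oplus>\<^bsub>stalk X E x\<^esub> h)
    = stalk_map X E E' \<phi> x g \<oplus>\<^bsub>stalk X E' x\<^esub> stalk_map X E E' \<phi> x h"
    using module_hom_add[OF sheaf_hom_module_hom[OF hom U(1)] s t]
    by (simp add: gh E.germ_add[OF U s t] stalk_map_germ[OF U] s t E.sec_add_closed[OF U(1)]
        E'.germ_add[OF U hom_closed[OF U(1) s] hom_closed[OF U(1) t]])
next
  fix b g assume b: "b \<in> carrier B" and "g \<in> carrier (stalk X E x)"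
  then obtain U s where U: "openin X U" "x \<in> U" and s: "s \<in> carrier (sec E U)" and g: "g = germ X E x U s"
    by (auto elim: E.stalkE)
  have c: "(\<lambda>y\<in>U. b) \<in> locally_constant_on X U (carrier B)" by (rule locally_constant_on_const[OF U(1) b])
  show "stalk_map X E E' \<phi> x (b \<odot>\<^bsub>stalk X E x\<^esub> g) = b \<odot>\<^bsub>stalk X E' x\<^esub> stalk_map X E E' \<phi> x g"
    using module_hom_smult[OF sheaf_hom_module_hom[OF hom U(1)], of "\<lambda>y\<in>U. b" s] c s
    by (simp add: g E.germ_smult[OF U s b] stalk_map_germ[OF U] s E.sec_smult_closed[OF U(1) c s]
        E'.germ_smult[OF U hom_closed[OF U(1) s] b])
qed

lemma stalk_map_flat_along:
  assumes "E.flat_along A f \<sigma>"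
  shows "E'.flat_along A f (\<lambda>z. stalk_map X E E' \<phi> (f z) (\<sigma> z))"
proof (rule E'.flat_alongI[OF E.flat_along_continuous[OF assms]])
  fix z assume "z \<in> A"
  with assms obtain N W s where N: "openin (top_of_set A) N" "z \<in> N" "openin X W" "s \<in> carrier (sec E W)"
    "\<And>y. y \<in> N \<Longrightarrow> f y \<in> W" "\<And>y. y \<in> N \<Longrightarrow> \<sigma> y = germ X E (f y) W s"
    by (rule E.flat_alongE) blast
  then show "\<exists>N W s. openin (top_of_set A) N \<and> z \<in> N \<and> openin X W \<and> s \<in> carrier (sec E' W) \<and>
      (\<forall>y\<in>N. f y \<in> W \<and> stalk_map X E E' \<phi> (f y) (\<sigma> y) = germ X E' (f y) W s)"
    by (intro exI[of _ N] exI[of _ W] exI[of _ "\<phi> W s"]) (simp add: hom_closed stalk_map_germ)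
qed

end

lemma stalk_map_id:
  assumes "module_presheaf X B E"
  shows "stalk_map X E E (sheaf_id X E) x = (\<lambda>g\<in>carrier (stalk X E x). g)"
  unfolding stalk_map_def
  by (rule restrict_ext) (simp add: sheaf_id_apply module_presheaf.germ_nbhd_section[OF assms])

lemma stalk_map_comp:
  assumes \<phi>: "presheaf_morphism X B E E' \<phi>" and \<psi>: "presheaf_morphism X B E' E'' \<psi>"
  shows "stalk_map X E E'' (sheaf_comp X E \<psi> \<phi>) x
    = compose (carrier (stalk X E x)) (stalk_map X E' E'' \<psi> x) (stalk_map X E E' \<phi> x)"
proof -
  interpret \<phi>: presheaf_morphism X B E E' \<phi> by (rule \<phi>)
  interpret \<psi>: presheaf_morphism X B E' E'' \<psi> by (rule \<psi>)
  interpret c: presheaf_morphism X B E E'' "sheaf_comp X E \<psi> \<phi>"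
    by unfold_locales (rule \<phi>.E.sheaf_comp_hom[OF \<phi>.hom \<psi>.hom])
  show ?thesis
  proof (rule extensionalityI)
    fix g assume "g \<in> carrier (stalk X E x)"
    then show "stalk_map X E E'' (sheaf_comp X E \<psi> \<phi>) x g
      = compose (carrier (stalk X E x)) (stalk_map X E' E'' \<psi> x) (stalk_map X E E' \<phi> x) g"
      by (elim \<phi>.E.stalkE)
        (simp add: compose_eq \<phi>.stalk_map_germ \<psi>.stalk_map_germ c.stalk_map_germ \<phi>.hom_closed sheaf_comp_apply
          \<phi>.E.germ_in_stalk)
  qed (simp_all add: stalk_map_def)
qed


section \<open>The monodromy functor\<close>

text \<open>The category whose core is \<open>LCS\<close>.\<close>

definition local_systems :: "'a topology \<Rightarrow> ('b, 'x) ring_scheme \<Rightarrow>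
    (('a, 'b, ('a, 'c) univ) msheaf, 'a set \<Rightarrow> ('a, 'c) univ \<Rightarrow> ('a, 'c) univ) category" where
  "local_systems X B = \<lparr>Ob = {E. local_system X B E}, Hom = sheaf_hom X B, Ident = sheaf_id X,
     Comp = (\<lambda>E E' E'' \<psi> \<phi>. sheaf_comp X E \<psi> \<phi>)\<rparr>"

lemma local_system_iff:
  "local_system X B E \<longleftrightarrow> locally_constant_sheaf X B E \<and> (\<forall>x\<in>topspace X. fg_projective B (stalk X E x))"
proof
  assume "local_system X B E"
  then interpret local_system X B E .
  show "locally_constant_sheaf X B E \<and> (\<forall>x\<in>topspace X. fg_projective B (stalk X E x))"
    using locally_constant stalk_fg_projective by blast
next
  assume *: "locally_constant_sheaf X B E \<and> (\<forall>x\<in>topspace X. fg_projective B (stalk X E x))"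
  then have sh: "is_sheaf X B E" by (simp only: locally_constant_sheaf_def)
  then have "is_presheaf X B E" by (simp only: is_sheaf_def)
  with sh * show "local_system X B E" by unfold_locales blast+
qed

lemma LCS_core: "LCS X B = core (local_systems X B)"
  unfolding LCS_def local_systems_def local_system_iff ..

lemma local_systems_simps [simp]:
  "Ob (local_systems X B) = {E. local_system X B E}" "Hom (local_systems X B) = sheaf_hom X B"
  "Ident (local_systems X B) = sheaf_id X" "Comp (local_systems X B) E E' E'' \<psi> \<phi> = sheaf_comp X E \<psi> \<phi>"
  by (simp_all add: local_systems_def)

lemma local_system_presheaf: "local_system X B E \<Longrightarrow> module_presheaf X B E"
  by (simp add: local_system_def locally_constant_module_sheaf_def module_sheaf_def)

lemma sheaf_hom_eqI:
  assumes \<phi>: "\<phi> \<in> sheaf_hom X B E E'" and \<psi>: "\<psi> \<in> sheaf_hom X B E E'"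
    and eq: "\<And>U s. openin X U \<Longrightarrow> s \<in> carrier (sec E U) \<Longrightarrow> \<phi> U s = \<psi> U s"
  shows "\<phi> = \<psi>"
proof (rule extensionalityI[OF sheaf_hom_extensional[OF \<phi>] sheaf_hom_extensional[OF \<psi>]])
  fix U assume "U \<in> {U. openin X U}"
  then have U: "openin X U" by simp
  show "\<phi> U = \<psi> U"
    by (rule extensionalityI[OF module_hom_ext[OF sheaf_hom_module_hom[OF \<phi> U]]
          module_hom_ext[OF sheaf_hom_module_hom[OF \<psi> U]]]) (rule eq[OF U])
qed

lemma is_category_local_systems:
  "is_category (local_systems X B :: (('a, 'b, ('a, 'c) univ) msheaf, _) category)"
  unfolding is_category_def local_systems_simps mem_Collect_eq Ball_def
proof (intro conjI allI impI)
  fix E :: "('a, 'b, ('a, 'c) univ) msheaf" assume "local_system X B E"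
  then interpret E: module_presheaf X B E by (rule local_system_presheaf)
  show "sheaf_id X E \<in> sheaf_hom X B E E" by (rule E.sheaf_id_hom)
  fix E' :: "('a, 'b, ('a, 'c) univ) msheaf" assume "local_system X B E'"
  then interpret E': module_presheaf X B E' by (rule local_system_presheaf)
  have closed: "\<phi> U s \<in> carrier (sec F' U)" if "\<phi> \<in> sheaf_hom X B F F'" "openin X U" "s \<in> carrier (sec F U)"
    for \<phi> U s and F F' :: "('a, 'b, ('a, 'c) univ) msheaf"
    by (rule module_hom_closed[OF sheaf_hom_module_hom[OF that(1,2)] that(3)])
  {
    fix \<phi> assume \<phi>: "\<phi> \<in> sheaf_hom X B E E'"
    show "sheaf_comp X E \<phi> (sheaf_id X E) = \<phi>"
      by (rule sheaf_hom_eqI[OF E.sheaf_comp_hom[OF E.sheaf_id_hom \<phi>] \<phi>])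
        (simp add: sheaf_comp_apply sheaf_id_apply)
    show "sheaf_comp X E (sheaf_id X E') \<phi> = \<phi>"
      by (rule sheaf_hom_eqI[OF E.sheaf_comp_hom[OF \<phi> E'.sheaf_id_hom] \<phi>])
        (simp add: sheaf_comp_apply sheaf_id_apply closed[OF \<phi>])
  }
  fix E'' :: "('a, 'b, ('a, 'c) univ) msheaf" assume "local_system X B E''"
  {
    fix \<phi> \<psi> assume "\<phi> \<in> sheaf_hom X B E E'" "\<psi> \<in> sheaf_hom X B E' E''"
    then show "sheaf_comp X E \<psi> \<phi> \<in> sheaf_hom X B E E''" by (rule E.sheaf_comp_hom)
  }
  fix D :: "('a, 'b, ('a, 'c) univ) msheaf" and \<phi> \<psi> \<omega>
  assume \<phi>: "\<phi> \<in> sheaf_hom X B E E'" and \<psi>: "\<psi> \<in> sheaf_hom X B E' E''" and \<omega>: "\<omega> \<in> sheaf_hom X B E'' D"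
  show "sheaf_comp X E \<omega> (sheaf_comp X E \<psi> \<phi>) = sheaf_comp X E (sheaf_comp X E' \<omega> \<psi>) \<phi>"
    by (rule sheaf_hom_eqI[OF E.sheaf_comp_hom[OF E.sheaf_comp_hom[OF \<phi> \<psi>] \<omega>]
          E.sheaf_comp_hom[OF \<phi> E'.sheaf_comp_hom[OF \<psi> \<omega>]]])
      (simp add: sheaf_comp_apply closed[OF \<phi>] closed[OF \<psi>])
qed

lemma is_iso_local_systems: "is_iso (local_systems X B) E E' \<phi> \<longleftrightarrow> \<phi> \<in> sheaf_iso X B E E'"
  by (auto simp: is_iso_def sheaf_iso_def)

lemma Mon_ob_simps [simp]:
  "on_ob (Mon_ob X B E) = stalk X E"
  "on_hom (Mon_ob X B E) x y c = parallel_transport X B E c"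
  by (simp_all add: Mon_ob_def)

lemma Mon_simps [simp]:
  "on_ob (Mon X B) = Mon_ob X B"
  "on_hom (Mon X B) E E' \<phi> = (\<lambda>x\<in>topspace X. stalk_map X E E' \<phi> x)"
  by (simp_all add: Mon_def)

text \<open>Stalk maps carry flat sections to flat sections, hence commute with parallel transport.\<close>

lemma stalk_map_nat_iso:
  assumes E: "local_system X B E" and E': "local_system X B E'" and iso: "\<phi> \<in> sheaf_iso X B E E'"
  shows "is_nat_iso (fundamental_groupoid X) (core (Proj B)) (Mon_ob X B E) (Mon_ob X B E')
    (\<lambda>x\<in>topspace X. stalk_map X E E' \<phi> x)"
proof -
  interpret E: local_system X B E by (rule E)
  interpret E': local_system X B E' by (rule E')
  obtain \<psi> where \<phi>: "\<phi> \<in> sheaf_hom X B E E'" and \<psi>: "\<psi> \<in> sheaf_hom X B E' E"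
    and inv: "sheaf_comp X E \<psi> \<phi> = sheaf_id X E" "sheaf_comp X E' \<phi> \<psi> = sheaf_id X E'"
    using iso by (auto simp: sheaf_iso_def)
  interpret \<phi>: presheaf_morphism X B E E' \<phi> by unfold_locales (rule \<phi>)
  interpret \<psi>: presheaf_morphism X B E' E \<psi> by unfold_locales (rule \<psi>)
  show ?thesis
  proof (rule nat_isoI)
    fix x assume x: "x \<in> Ob (fundamental_groupoid X)"
    have "is_iso (Proj B) (stalk X E x) (stalk X E' x) (stalk_map X E E' \<phi> x)"
    proof (rule is_isoI)
      show "stalk_map X E E' \<phi> x \<in> Hom (Proj B) (stalk X E x) (stalk X E' x)"
        "stalk_map X E' E \<psi> x \<in> Hom (Proj B) (stalk X E' x) (stalk X E x)"
        by (simp_all add: \<phi>.stalk_map_module_hom \<psi>.stalk_map_module_hom)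
      show "Comp (Proj B) (stalk X E x) (stalk X E' x) (stalk X E x) (stalk_map X E' E \<psi> x) (stalk_map X E E' \<phi> x)
          = Ident (Proj B) (stalk X E x)"
        using stalk_map_comp[OF \<phi>.presheaf_morphism_axioms \<psi>.presheaf_morphism_axioms, of x]
        by (simp add: inv stalk_map_id[OF E.module_presheaf_axioms])
      show "Comp (Proj B) (stalk X E' x) (stalk X E x) (stalk X E' x) (stalk_map X E E' \<phi> x) (stalk_map X E' E \<psi> x)
          = Ident (Proj B) (stalk X E' x)"
        using stalk_map_comp[OF \<psi>.presheaf_morphism_axioms \<phi>.presheaf_morphism_axioms, of x]
        by (simp add: inv stalk_map_id[OF E'.module_presheaf_axioms])
    qed
    then show "is_iso (core (Proj B)) (on_ob (Mon_ob X B E) x) (on_ob (Mon_ob X B E') x)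
        ((\<lambda>x\<in>topspace X. stalk_map X E E' \<phi> x) x)"
      using x by (simp add: is_iso_core)
  next
    fix x y f assume x: "x \<in> Ob (fundamental_groupoid X)" and y: "y \<in> Ob (fundamental_groupoid X)"
      and "f \<in> Hom (fundamental_groupoid X) x y"
    then obtain \<gamma> where \<gamma>: "pathin X \<gamma>" "\<gamma> 0 = x" "\<gamma> 1 = y" "f = path_class X \<gamma>" by auto
    have "stalk_map X E E' \<phi> y (parallel_transport X B E f g) = parallel_transport X B E' f (stalk_map X E E' \<phi> x g)"
      if g: "g \<in> carrier (stalk X E x)" for g
    proof -
      obtain \<sigma> where \<sigma>: "E.flat_along {0..1} \<gamma> \<sigma>" "\<sigma> 0 = g"
        using E.flat_along_path_exists[OF \<gamma>(1)] g \<gamma>(2) by blast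
      show ?thesis
        using E.parallel_transport_flat[OF \<sigma>(1)] E'.parallel_transport_flat[OF \<phi>.stalk_map_flat_along[OF \<sigma>(1)]]
        by (simp add: \<gamma> \<sigma>(2))
    qed
    then show "Comp (core (Proj B)) (on_ob (Mon_ob X B E) x) (on_ob (Mon_ob X B E) y) (on_ob (Mon_ob X B E') y)
        ((\<lambda>x\<in>topspace X. stalk_map X E E' \<phi> x) y) (on_hom (Mon_ob X B E) x y f)
      = Comp (core (Proj B)) (on_ob (Mon_ob X B E) x) (on_ob (Mon_ob X B E') x) (on_ob (Mon_ob X B E') y)
        (on_hom (Mon_ob X B E') x y f) ((\<lambda>x\<in>topspace X. stalk_map X E E' \<phi> x) x)"
      using x y by (auto simp: compose_def)
  qed simp
qed

lemma Mon_functor: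
  "is_functor (LCS X B) (Fun_groupoid (fundamental_groupoid X) (core (Proj B))) (Mon X B)"
  unfolding LCS_core
proof (rule functorI)
  fix E assume "E \<in> Ob (core (local_systems X B))"
  then have E: "local_system X B E" by simp
  then show "on_ob (Mon X B) E \<in> Ob (Fun_groupoid (fundamental_groupoid X) (core (Proj B)))"
    by (simp add: local_system.Mon_ob_functor)
  show "on_hom (Mon X B) E E (Ident (core (local_systems X B)) E)
    = Ident (Fun_groupoid (fundamental_groupoid X) (core (Proj B))) (on_ob (Mon X B) E)"
    by (simp add: stalk_map_id[OF local_system_presheaf[OF E]])
next
  fix E E' \<phi> assume "E \<in> Ob (core (local_systems X B))" "E' \<in> Ob (core (local_systems X B))"
    "\<phi> \<in> Hom (core (local_systems X B)) E E'"
  then show "on_hom (Mon X B) E E' \<phi>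
      \<in> Hom (Fun_groupoid (fundamental_groupoid X) (core (Proj B))) (on_ob (Mon X B) E) (on_ob (Mon X B) E')"
    by (simp add: is_iso_local_systems stalk_map_nat_iso)
next
  fix E E' E'' \<phi> \<psi>
  assume "E \<in> Ob (core (local_systems X B))" "E' \<in> Ob (core (local_systems X B))"
    "E'' \<in> Ob (core (local_systems X B))"
    "\<phi> \<in> Hom (core (local_systems X B)) E E'" "\<psi> \<in> Hom (core (local_systems X B)) E' E''"
  then have "presheaf_morphism X B E E' \<phi>" "presheaf_morphism X B E' E'' \<psi>"
    by (simp_all add: presheaf_morphism_def presheaf_morphism_axioms_def local_system_presheaf is_iso_def)
  note comp = stalk_map_comp[OF this]
  show "on_hom (Mon X B) E E'' (Comp (core (local_systems X B)) E E' E'' \<psi> \<phi>)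
    = Comp (Fun_groupoid (fundamental_groupoid X) (core (Proj B))) (on_ob (Mon X B) E) (on_ob (Mon X B) E')
        (on_ob (Mon X B) E'') (on_hom (Mon X B) E' E'' \<psi>) (on_hom (Mon X B) E E' \<phi>)"
    by (simp, rule restrict_ext) (simp add: comp)
qed


section \<open>Functors on the fundamental groupoid\<close>

text \<open>A functor on the fundamental groupoid is handled through the modules \<open>fib x\<close> and the action
  \<open>act \<gamma>\<close> of paths, which need no mention of endpoints and classes.\<close>

locale path_representation = R?: ring B
  for X :: "'a topology" and B :: "('b, 'x) ring_scheme"
    and F :: "('a, (real \<Rightarrow> 'a) set, ('b, ('a, 'c) univ) module, ('a, 'c) univ \<Rightarrow> ('a, 'c) univ) cfunctor" +
  assumes representation: "is_functor (fundamental_groupoid X) (core (Proj B)) F"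
begin

abbreviation fib :: "'a \<Rightarrow> ('b, ('a, 'c) univ) module" where "fib \<equiv> on_ob F"

definition act :: "(real \<Rightarrow> 'a) \<Rightarrow> ('a, 'c) univ \<Rightarrow> ('a, 'c) univ" where
  "act \<gamma> = on_hom F (\<gamma> 0) (\<gamma> 1) (path_class X \<gamma>)"

lemma fib_fg_projective: "x \<in> topspace X \<Longrightarrow> fg_projective B (fib x)"
  using functor_ob[OF representation] by simp

lemma fib_module: "x \<in> topspace X \<Longrightarrow> left_module B (fib x)"
  by (rule fg_projective_left_module[OF fib_fg_projective])

lemma act_module_iso:
  assumes "pathin X \<gamma>"
  shows "act \<gamma> \<in> module_iso B (fib (\<gamma> 0)) (fib (\<gamma> 1))"
proof -
  have ob: "\<gamma> 0 \<in> topspace X" "\<gamma> 1 \<in> topspace X"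
    using assms by (auto intro: path_start_in_topspace path_finish_in_topspace)
  have "act \<gamma> \<in> Hom (core (Proj B)) (fib (\<gamma> 0)) (fib (\<gamma> 1))"
    unfolding act_def by (rule functor_hom[OF representation]) (use assms ob in auto)
  then show ?thesis by (simp add: is_iso_Proj[OF fib_module[OF ob(1)]])
qed

lemma act_closed: "pathin X \<gamma> \<Longrightarrow> m \<in> carrier (fib (\<gamma> 0)) \<Longrightarrow> act \<gamma> m \<in> carrier (fib (\<gamma> 1))"
  by (rule module_iso_closed[OF act_module_iso])

lemma act_module_hom: "pathin X \<gamma> \<Longrightarrow> act \<gamma> \<in> module_hom B (fib (\<gamma> 0)) (fib (\<gamma> 1))"
  using act_module_iso by (simp add: module_iso_def)

lemma act_homotopic:
  assumes "path_homotopic X \<gamma> \<delta>"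
  shows "act \<gamma> = act \<delta>"
  using path_homotopic_ends[OF assms] path_class_eq[OF assms] by (simp add: act_def)

lemma act_const:
  assumes "x \<in> topspace X" "m \<in> carrier (fib x)"
  shows "act (\<lambda>_. x) m = m"
  using functor_ident[OF representation, of x] assms by (simp add: act_def)

lemma act_join:
  assumes \<gamma>: "pathin X \<gamma>" and \<delta>: "pathin X \<delta>" and ends: "\<gamma> 1 = \<delta> 0" and m: "m \<in> carrier (fib (\<gamma> 0))"
  shows "act (path_join \<gamma> \<delta>) m = act \<delta> (act \<gamma> m)"
proof -
  have ob: "\<gamma> 0 \<in> topspace X" "\<gamma> 1 \<in> topspace X" "\<delta> 1 \<in> topspace X"
    using \<gamma> \<delta> by (auto intro: path_start_in_topspace path_finish_in_topspace)
  have "on_hom F (\<gamma> 0) (\<delta> 1) (Comp (fundamental_groupoid X) (\<gamma> 0) (\<gamma> 1) (\<delta> 1) (path_class X \<delta>) (path_class X \<gamma>))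
    = Comp (core (Proj B)) (fib (\<gamma> 0)) (fib (\<gamma> 1)) (fib (\<delta> 1))
        (on_hom F (\<gamma> 1) (\<delta> 1) (path_class X \<delta>)) (act \<gamma>)"
    unfolding act_def by (rule functor_comp[OF representation]) (use \<gamma> \<delta> ends ob in auto)
  moreover have "act (path_join \<gamma> \<delta>) = on_hom F (\<gamma> 0) (\<delta> 1) (path_class X (path_join \<gamma> \<delta>))"
    "act \<delta> = on_hom F (\<gamma> 1) (\<delta> 1) (path_class X \<delta>)"
    by (simp_all add: act_def ends)
  ultimately show ?thesis using m by (simp add: path_class_join[OF \<gamma> \<delta> ends] compose_eq)
qed

lemma act_subpath_between:
  assumes \<gamma>: "pathin X \<gamma>" and abc: "a \<in> {0..1}" "b \<in> {0..1}" "c \<in> {0..1}" and m: "m \<in> carrier (fib (\<gamma> a))"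
  shows "act (subpath_between b c \<gamma>) (act (subpath_between a b \<gamma>) m) = act (subpath_between a c \<gamma>) m"
proof -
  have "act (path_join (subpath_between a b \<gamma>) (subpath_between b c \<gamma>)) = act (subpath_between a c \<gamma>)"
    by (rule act_homotopic[OF path_homotopic_subpath_join[OF \<gamma> abc]])
  then show ?thesis
    using act_join[OF pathin_subpath_between[OF \<gamma> abc(1,2)] pathin_subpath_between[OF \<gamma> abc(2,3)]] m by simp
qed

lemma act_subpath_same:
  assumes "pathin X \<gamma>" "a \<in> {0..1}" "m \<in> carrier (fib (\<gamma> a))"
  shows "act (subpath_between a a \<gamma>) m = m"
  unfolding subpath_between_same using act_const[OF pathin_in_topspace[OF assms(1,2)] assms(3)] .

lemma act_reverse:
  assumes "pathin X \<gamma>" "m \<in> carrier (fib (\<gamma> 0))"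
  shows "act (subpath_between 1 0 \<gamma>) (act \<gamma> m) = m"
  using act_subpath_between[OF assms(1), of 0 1 0 m] act_subpath_same[OF assms(1), of 0 m] assms(2) by simp

text \<open>Over such a set \<open>F\<close> is trivial: its values at any two points are identified in exactly one way.\<close>

definition path_independent :: "'a set \<Rightarrow> bool" where
  "path_independent U \<longleftrightarrow> openin X U \<and> path_connectedin X U \<and>
    (\<forall>\<gamma> \<delta>. pathin (subtopology X U) \<gamma> \<and> pathin (subtopology X U) \<delta> \<and> \<gamma> 0 = \<delta> 0 \<and> \<gamma> 1 = \<delta> 1 \<longrightarrow>
      (\<forall>m\<in>carrier (fib (\<gamma> 0)). act \<gamma> m = act \<delta> m))"

text \<open>Two paths \<open>\<gamma>\<close> and \<open>\<delta>\<close> with common ends close up to a loop at \<open>p\<close>, via a path \<open>\<alpha>\<close> from \<open>p\<close> to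
  their start. This loop acts trivially, and the action of \<open>\<alpha>\<close> can be cancelled.\<close>

lemma path_independentI:
  assumes U: "openin X U" "path_connectedin X U" and p: "p \<in> U"
    and loops: "\<And>\<gamma>. pathin (subtopology X U) \<gamma> \<Longrightarrow> \<gamma> 0 = p \<Longrightarrow> \<gamma> 1 = p \<Longrightarrow> path_homotopic X \<gamma> (\<lambda>_. p)"
  shows "path_independent U"
  unfolding path_independent_def
proof (intro conjI allI impI ballI U)
  fix \<gamma> \<delta> m
  assume paths: "pathin (subtopology X U) \<gamma> \<and> pathin (subtopology X U) \<delta> \<and> \<gamma> 0 = \<delta> 0 \<and> \<gamma> 1 = \<delta> 1"
    and m: "m \<in> carrier (fib (\<gamma> 0))"
  let ?Y = "subtopology X U"
  have inX: "pathin X \<epsilon>" if "pathin ?Y \<epsilon>" for \<epsilon> using that by (simp add: pathin_subtopology)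
  have \<gamma>: "pathin ?Y \<gamma>" and \<delta>: "pathin ?Y \<delta>" "\<delta> 0 = \<gamma> 0" "\<delta> 1 = \<gamma> 1" using paths by auto
  have "\<gamma> 0 \<in> U" using \<gamma> by (auto simp: pathin_subtopology)
  then obtain \<alpha> where \<alpha>: "pathin ?Y \<alpha>" "\<alpha> 0 = p" "\<alpha> 1 = \<gamma> 0"
    by (rule path_between_in[OF U(2) p])
  have "m \<in> act \<alpha> ` carrier (fib (\<alpha> 0))"
    using act_module_iso[OF inX[OF \<alpha>(1)]] m \<alpha>(3) by (simp add: module_iso_def bij_betw_def)
  then obtain n where n: "n \<in> carrier (fib (\<alpha> 0))" "act \<alpha> n = m" by blast
  let ?j = "path_join \<alpha> \<gamma>" and ?k = "path_join \<alpha> \<delta>"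
  have j: "pathin ?Y ?j" "?j 0 = p" "?j 1 = \<gamma> 1" and k: "pathin ?Y ?k" "?k 0 = p" "?k 1 = \<gamma> 1"
    using pathin_join[OF \<alpha>(1) \<gamma>] pathin_join[OF \<alpha>(1) \<delta>(1)] \<alpha> \<delta> by simp_all
  \<comment> \<open>The reverse of \<open>?k\<close>, which closes \<open>?j\<close> up to a loop.\<close>
  let ?r = "subpath_between 1 0 ?k"
  have r: "pathin ?Y ?r" by (rule pathin_subpath_between[OF k(1)]) auto
  have rk: "act ?r (act ?k n) = n" by (rule act_reverse[OF inX[OF k(1)]]) (use n \<alpha>(2) k(2) in simp)
  have "path_homotopic X (path_join ?j ?r) (\<lambda>_. p)"
    by (rule loops[OF pathin_join[OF j(1) r]]) (use j k in simp_all)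
  then have "act (path_join ?j ?r) n = n"
    using act_homotopic act_const[of p n] n \<alpha>(2) p openin_subset[OF U(1)] by auto
  moreover have "act (path_join ?j ?r) n = act ?r (act ?j n)"
    by (rule act_join[OF inX[OF j(1)] inX[OF r]]) (use j k n \<alpha>(2) in simp_all)
  ultimately have rj: "act ?r (act ?j n) = n" by simp
  have "inj_on (act ?r) (carrier (fib (?r 0)))"
    using act_module_iso[OF inX[OF r]] by (simp add: module_iso_def bij_betw_def)
  then have "act ?j n = act ?k n"
  proof (rule inj_onD)
    show "act ?r (act ?j n) = act ?r (act ?k n)" by (simp only: rj rk)
    show "act ?j n \<in> carrier (fib (?r 0))" "act ?k n \<in> carrier (fib (?r 0))"
      using act_closed[OF inX[OF j(1)], of n] act_closed[OF inX[OF k(1)], of n] n(1) j k \<alpha>(2) by simp_all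
  qed
  moreover have "act ?j n = act \<gamma> m"
    using act_join[OF inX[OF \<alpha>(1)] inX[OF \<gamma>] \<alpha>(3) n(1)] n(2) by simp
  moreover have "act ?k n = act \<delta> m"
    using act_join[OF inX[OF \<alpha>(1)] inX[OF \<delta>(1)] _ n(1)] \<alpha>(3) \<delta>(2) n(2) by simp
  ultimately show "act \<gamma> m = act \<delta> m" by simp
qed

lemma path_independentD:
  assumes "path_independent U"
  shows "openin X U" "path_connectedin X U"
    and "\<And>\<gamma> \<delta> m. pathin (subtopology X U) \<gamma> \<Longrightarrow> pathin (subtopology X U) \<delta> \<Longrightarrow> \<gamma> 0 = \<delta> 0 \<Longrightarrow> \<gamma> 1 = \<delta> 1 \<Longrightarrow>
      m \<in> carrier (fib (\<gamma> 0)) \<Longrightarrow> act \<gamma> m = act \<delta> m"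
  using assms unfolding path_independent_def by blast+

text \<open>By \<open>slide_act\<close> the chosen path does not matter if \<open>U\<close> is path-independent.\<close>

definition slide :: "'a set \<Rightarrow> 'a \<Rightarrow> 'a \<Rightarrow> ('a, 'c) univ \<Rightarrow> ('a, 'c) univ" where
  "slide U x y = act (SOME \<gamma>. pathin (subtopology X U) \<gamma> \<and> \<gamma> 0 = x \<and> \<gamma> 1 = y)"

lemma slide_act:
  assumes U: "path_independent U" and \<gamma>: "pathin (subtopology X U) \<gamma>" and m: "m \<in> carrier (fib (\<gamma> 0))"
  shows "slide U (\<gamma> 0) (\<gamma> 1) m = act \<gamma> m"
proof -
  let ?\<delta> = "SOME \<delta>. pathin (subtopology X U) \<delta> \<and> \<delta> 0 = \<gamma> 0 \<and> \<delta> 1 = \<gamma> 1"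
  have "pathin (subtopology X U) ?\<delta> \<and> ?\<delta> 0 = \<gamma> 0 \<and> ?\<delta> 1 = \<gamma> 1"
    by (rule someI[of _ \<gamma>]) (simp add: \<gamma>)
  then have \<delta>: "pathin (subtopology X U) ?\<delta>" "?\<delta> 0 = \<gamma> 0" "?\<delta> 1 = \<gamma> 1" by blast+
  have m': "m \<in> carrier (fib (?\<delta> 0))" unfolding \<delta>(2) by (rule m)
  show ?thesis unfolding slide_def by (rule path_independentD(3)[OF U \<delta>(1) \<gamma> \<delta>(2,3) m'])
qed

lemma slide_module_hom:
  assumes U: "path_independent U" and xy: "x \<in> U" "y \<in> U"
  shows "slide U x y \<in> module_hom B (fib x) (fib y)"
proof -
  let ?\<gamma> = "SOME \<gamma>. pathin (subtopology X U) \<gamma> \<and> \<gamma> 0 = x \<and> \<gamma> 1 = y"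
  have "pathin (subtopology X U) ?\<gamma> \<and> ?\<gamma> 0 = x \<and> ?\<gamma> 1 = y"
  proof -
    obtain \<delta> where "pathin (subtopology X U) \<delta>" "\<delta> 0 = x" "\<delta> 1 = y"
      by (rule path_between_in[OF path_independentD(2)[OF U] xy])
    then have "pathin (subtopology X U) \<delta> \<and> \<delta> 0 = x \<and> \<delta> 1 = y" by simp
    then show ?thesis by (rule someI[where P = "\<lambda>\<gamma>. pathin (subtopology X U) \<gamma> \<and> \<gamma> 0 = x \<and> \<gamma> 1 = y"])
  qed
  then have \<gamma>: "pathin X ?\<gamma>" "?\<gamma> 0 = x" "?\<gamma> 1 = y" unfolding pathin_subtopology by blast+
  from act_module_hom[OF \<gamma>(1)] show ?thesis unfolding slide_def \<gamma>(2,3) .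
qed

lemma slide_closed:
  "path_independent U \<Longrightarrow> x \<in> U \<Longrightarrow> y \<in> U \<Longrightarrow> m \<in> carrier (fib x) \<Longrightarrow> slide U x y m \<in> carrier (fib y)"
  by (rule module_hom_closed[OF slide_module_hom])

lemma slide_slide:
  assumes U: "path_independent U" and xyz: "x \<in> U" "y \<in> U" "z \<in> U" and m: "m \<in> carrier (fib x)"
  shows "slide U y z (slide U x y m) = slide U x z m"
proof -
  obtain \<gamma> where \<gamma>: "pathin (subtopology X U) \<gamma>" "\<gamma> 0 = x" "\<gamma> 1 = y"
    by (rule path_between_in[OF path_independentD(2)[OF U] xyz(1,2)])
  obtain \<delta> where \<delta>: "pathin (subtopology X U) \<delta>" "\<delta> 0 = y" "\<delta> 1 = z"
    by (rule path_between_in[OF path_independentD(2)[OF U] xyz(2,3)])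
  have p: "pathin X \<gamma>" "pathin X \<delta>" using \<gamma> \<delta> by (simp_all add: pathin_subtopology)
  have ends: "\<gamma> 1 = \<delta> 0" by (simp add: \<gamma> \<delta>)
  have j: "path_join \<gamma> \<delta> 0 = x" "path_join \<gamma> \<delta> 1 = z" by (simp_all add: \<gamma> \<delta>)
  have "slide U x y m = act \<gamma> m" using slide_act[OF U \<gamma>(1)] m \<gamma> by simp
  moreover have "slide U y z (act \<gamma> m) = act \<delta> (act \<gamma> m)"
    using slide_act[OF U \<delta>(1), of "act \<gamma> m"] act_closed[OF p(1), of m] m \<gamma> \<delta> by simp
  moreover have "slide U x z m = act (path_join \<gamma> \<delta>) m"
    using slide_act[OF U pathin_join[OF \<gamma>(1) \<delta>(1) ends], of m] m j by simp
  ultimately show ?thesis using act_join[OF p ends, of m] m \<gamma>(2) by simp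
qed

lemma slide_same:
  assumes U: "path_independent U" and x: "x \<in> U" and m: "m \<in> carrier (fib x)"
  shows "slide U x x m = m"
proof -
  have X: "x \<in> topspace X" using x openin_subset[OF path_independentD(1)[OF U]] by blast
  then have "pathin (subtopology X U) (\<lambda>_. x)" using x by simp
  from slide_act[OF U this] show ?thesis using m act_const[OF X m] by simp
qed


section \<open>The sheaf of path-compatible families\<close>

abbreviation fam :: "('a, 'b, ('a, 'c) univ) msheaf" where "fam \<equiv> family_sheaf X F"

lemma fam_simps [simp]:
  "carrier (sec fam U) = Family ` path_compatible X F U"
  "\<zero>\<^bsub>sec fam U\<^esub> = Family (\<lambda>x\<in>U. \<zero>\<^bsub>fib x\<^esub>)"
  "s \<oplus>\<^bsub>sec fam U\<^esub> t = Family (\<lambda>x\<in>U. members s x \<oplus>\<^bsub>fib x\<^esub> members t x)"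
  "b \<odot>\<^bsub>sec fam U\<^esub> s = Family (\<lambda>x\<in>U. b x \<odot>\<^bsub>fib x\<^esub> members s x)"
  "res fam U V s = Family (restrict (members s) V)"
  by (simp_all add: family_sheaf_def)

lemma path_compatibleI:
  assumes "f \<in> extensional U" "\<And>x. x \<in> U \<Longrightarrow> f x \<in> carrier (fib x)"
    and "\<And>\<gamma>. pathin (subtopology X U) \<gamma> \<Longrightarrow> act \<gamma> (f (\<gamma> 0)) = f (\<gamma> 1)"
  shows "f \<in> path_compatible X F U"
  using assms by (auto simp: path_compatible_def PiE_def act_def)

lemma path_compatible_ext: "f \<in> path_compatible X F U \<Longrightarrow> f \<in> extensional U"
  by (auto simp: path_compatible_def PiE_def)

lemma path_compatible_closed: "f \<in> path_compatible X F U \<Longrightarrow> x \<in> U \<Longrightarrow> f x \<in> carrier (fib x)"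
  by (auto simp: path_compatible_def)

lemma path_compatible_act:
  "f \<in> path_compatible X F U \<Longrightarrow> pathin (subtopology X U) \<gamma> \<Longrightarrow> act \<gamma> (f (\<gamma> 0)) = f (\<gamma> 1)"
  by (simp add: path_compatible_def act_def)

lemma path_compatible_restrict:
  assumes f: "f \<in> path_compatible X F U" and V: "V \<subseteq> U"
  shows "restrict f V \<in> path_compatible X F V"
proof (rule path_compatibleI)
  fix \<gamma> assume \<gamma>: "pathin (subtopology X V) \<gamma>"
  then have "pathin (subtopology X U) \<gamma>" using V by (auto simp: pathin_subtopology)
  then show "act \<gamma> (restrict f V (\<gamma> 0)) = restrict f V (\<gamma> 1)"
    using path_compatible_act[OF f] \<gamma> by (simp add: pathin_subtopology)
qed (use V path_compatible_closed[OF f] in auto)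

lemma path_compatible_add:
  assumes U: "openin X U" and f: "f \<in> path_compatible X F U" and g: "g \<in> path_compatible X F U"
  shows "(\<lambda>x\<in>U. f x \<oplus>\<^bsub>fib x\<^esub> g x) \<in> path_compatible X F U"
proof (rule path_compatibleI)
  fix x assume "x \<in> U"
  then show "(\<lambda>x\<in>U. f x \<oplus>\<^bsub>fib x\<^esub> g x) x \<in> carrier (fib x)"
    using left_module_add_closed[OF fib_module] openin_subset[OF U] path_compatible_closed[OF f]
      path_compatible_closed[OF g] by auto
next
  fix \<gamma> assume \<gamma>: "pathin (subtopology X U) \<gamma>"
  then have "pathin X \<gamma>" and ends: "\<gamma> 0 \<in> U" "\<gamma> 1 \<in> U" by (simp_all add: pathin_subtopology)
  from act_module_hom[OF this(1)]
  show "act \<gamma> ((\<lambda>x\<in>U. f x \<oplus>\<^bsub>fib x\<^esub> g x) (\<gamma> 0)) = (\<lambda>x\<in>U. f x \<oplus>\<^bsub>fib x\<^esub> g x) (\<gamma> 1)"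
    using ends path_compatible_act[OF f \<gamma>] path_compatible_act[OF g \<gamma>]
    by (simp add: module_hom_add path_compatible_closed[OF f] path_compatible_closed[OF g])
qed simp

lemma path_compatible_smult:
  assumes U: "openin X U" and b: "b \<in> locally_constant_on X U (carrier B)" and f: "f \<in> path_compatible X F U"
  shows "(\<lambda>x\<in>U. b x \<odot>\<^bsub>fib x\<^esub> f x) \<in> path_compatible X F U"
proof (rule path_compatibleI)
  fix x assume "x \<in> U"
  then show "(\<lambda>x\<in>U. b x \<odot>\<^bsub>fib x\<^esub> f x) x \<in> carrier (fib x)"
    using left_module.smult_closed[OF fib_module] openin_subset[OF U] locally_constant_on_closed[OF b]
      path_compatible_closed[OF f] by auto
next
  fix \<gamma> assume \<gamma>: "pathin (subtopology X U) \<gamma>"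
  then have "pathin X \<gamma>" and ends: "\<gamma> 0 \<in> U" "\<gamma> 1 \<in> U" by (simp_all add: pathin_subtopology)
  from act_module_hom[OF this(1)]
  show "act \<gamma> ((\<lambda>x\<in>U. b x \<odot>\<^bsub>fib x\<^esub> f x) (\<gamma> 0)) = (\<lambda>x\<in>U. b x \<odot>\<^bsub>fib x\<^esub> f x) (\<gamma> 1)"
    using ends path_compatible_act[OF f \<gamma>] locally_constant_on_path[OF b \<gamma>]
    by (simp add: module_hom_smult locally_constant_on_closed[OF b] path_compatible_closed[OF f])
qed simp

lemma path_compatible_zero:
  assumes U: "openin X U"
  shows "(\<lambda>x\<in>U. \<zero>\<^bsub>fib x\<^esub>) \<in> path_compatible X F U"
proof (rule path_compatibleI)
  fix x assume "x \<in> U"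
  then show "(\<lambda>x\<in>U. \<zero>\<^bsub>fib x\<^esub>) x \<in> carrier (fib x)"
    using left_module_zero_closed[OF fib_module] openin_subset[OF U] by auto
next
  fix \<gamma> assume "pathin (subtopology X U) \<gamma>"
  then have \<gamma>: "pathin X \<gamma>" and ends: "\<gamma> 0 \<in> U" "\<gamma> 1 \<in> U" by (simp_all add: pathin_subtopology)
  then have "\<gamma> 0 \<in> topspace X" "\<gamma> 1 \<in> topspace X" using openin_subset[OF U] by auto
  then show "act \<gamma> ((\<lambda>x\<in>U. \<zero>\<^bsub>fib x\<^esub>) (\<gamma> 0)) = (\<lambda>x\<in>U. \<zero>\<^bsub>fib x\<^esub>) (\<gamma> 1)"
    using ends module_hom_zero[OF act_module_hom[OF \<gamma>] fib_module fib_module] by simp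
qed simp

text \<open>The axioms hold at each point \<open>x\<close> because \<open>fib x\<close> is a module.\<close>

lemma fam_module:
  assumes U: "openin X U"
  shows "left_module (const_ring X B U) (sec fam U)"
proof -
  interpret C: ring "const_ring X B U" by (rule ring_const_ring[OF ring_axioms U])
  have X: "x \<in> topspace X" if "x \<in> U" for x using that openin_subset[OF U] by blast
  have M: "left_module B (fib x)" if "x \<in> U" for x using fib_module[OF X[OF that]] .
  have G: "abelian_group (fib x)" if "x \<in> U" for x using M[OF that] by (simp add: left_module_def)
  note G = abelian_groupE[OF G]
  note cl = path_compatible_closed
  have eqI: "Family f = Family g" if "f \<in> extensional U" "g \<in> extensional U" "\<And>x. x \<in> U \<Longrightarrow> f x = g x"
    for f g :: "'a \<Rightarrow> ('a, 'c) univ"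
    using extensionalityI[OF that] by simp
  have secE: "\<exists>f. s = Family f \<and> f \<in> path_compatible X F U" if "s \<in> carrier (sec fam U)" for s
    using that by auto
  have bcl: "b x \<in> carrier B" if "b \<in> carrier (const_ring X B U)" "x \<in> U" for b x
    using that locally_constant_on_closed[of b X U "carrier B" x] by simp
  have group: "abelian_group (sec fam U)"
  proof (rule abelian_groupI)
    show "\<zero>\<^bsub>sec fam U\<^esub> \<in> carrier (sec fam U)" by (simp add: path_compatible_zero[OF U])
    fix s assume "s \<in> carrier (sec fam U)"
    then obtain f where s: "s = Family f" and f: "f \<in> path_compatible X F U" using secE by blast
    show "\<zero>\<^bsub>sec fam U\<^esub> \<oplus>\<^bsub>sec fam U\<^esub> s = s"
      unfolding s fam_simps univ.sel by (rule eqI) (simp_all add: path_compatible_ext[OF f] G(5) cl[OF f])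
    \<comment> \<open>The inverse is multiplication by the constant \<open>-1\<close>, so it is path-compatible as well.\<close>
    let ?c = "\<lambda>x\<in>U. \<ominus>\<^bsub>B\<^esub> \<one>\<^bsub>B\<^esub>"
    have c: "?c \<in> locally_constant_on X U (carrier B)" by (rule locally_constant_on_const[OF U]) simp
    have neg: "(\<lambda>x\<in>U. ?c x \<odot>\<^bsub>fib x\<^esub> f x) \<in> path_compatible X F U" by (rule path_compatible_smult[OF U c f])
    have inv: "(\<ominus>\<^bsub>B\<^esub> \<one>\<^bsub>B\<^esub>) \<odot>\<^bsub>fib x\<^esub> f x \<oplus>\<^bsub>fib x\<^esub> f x = \<zero>\<^bsub>fib x\<^esub>" if x: "x \<in> U" for x
    proof -
      interpret x: left_module B "fib x" by (rule M[OF x])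
      have fx: "f x \<in> carrier (fib x)" by (rule cl[OF f x])
      have z: "\<zero>\<^bsub>B\<^esub> \<odot>\<^bsub>fib x\<^esub> f x = \<zero>\<^bsub>fib x\<^esub>"
      proof -
        have "\<zero>\<^bsub>B\<^esub> \<odot>\<^bsub>fib x\<^esub> f x \<oplus>\<^bsub>fib x\<^esub> \<zero>\<^bsub>B\<^esub> \<odot>\<^bsub>fib x\<^esub> f x = \<zero>\<^bsub>B\<^esub> \<odot>\<^bsub>fib x\<^esub> f x"
          using x.smult_l_distr[of "\<zero>\<^bsub>B\<^esub>" "\<zero>\<^bsub>B\<^esub>" "f x"] fx by simp
        then show ?thesis using x.smult_closed[of "\<zero>\<^bsub>B\<^esub>" "f x"] fx by simp
      qed
      have "(\<ominus>\<^bsub>B\<^esub> \<one>\<^bsub>B\<^esub>) \<odot>\<^bsub>fib x\<^esub> f x \<oplus>\<^bsub>fib x\<^esub> f x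
          = (\<ominus>\<^bsub>B\<^esub> \<one>\<^bsub>B\<^esub>) \<odot>\<^bsub>fib x\<^esub> f x \<oplus>\<^bsub>fib x\<^esub> \<one>\<^bsub>B\<^esub> \<odot>\<^bsub>fib x\<^esub> f x"
        using fx by (simp add: x.smult_one)
      also have "\<dots> = (\<ominus>\<^bsub>B\<^esub> \<one>\<^bsub>B\<^esub> \<oplus>\<^bsub>B\<^esub> \<one>\<^bsub>B\<^esub>) \<odot>\<^bsub>fib x\<^esub> f x"
        by (rule x.smult_l_distr[symmetric]) (simp_all add: fx)
      also have "\<dots> = \<zero>\<^bsub>fib x\<^esub>" by (simp add: R.l_neg z)
      finally show ?thesis .
    qed
    show "\<exists>t\<in>carrier (sec fam U). t \<oplus>\<^bsub>sec fam U\<^esub> s = \<zero>\<^bsub>sec fam U\<^esub>"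
    proof
      show "Family (\<lambda>x\<in>U. ?c x \<odot>\<^bsub>fib x\<^esub> f x) \<in> carrier (sec fam U)" using neg by simp
      show "Family (\<lambda>x\<in>U. ?c x \<odot>\<^bsub>fib x\<^esub> f x) \<oplus>\<^bsub>sec fam U\<^esub> s = \<zero>\<^bsub>sec fam U\<^esub>"
        unfolding s fam_simps univ.sel by (rule eqI) (simp_all add: inv)
    qed
    fix t assume "t \<in> carrier (sec fam U)"
    then obtain g where t: "t = Family g" and g: "g \<in> path_compatible X F U" using secE by blast
    show "s \<oplus>\<^bsub>sec fam U\<^esub> t \<in> carrier (sec fam U)" by (simp add: s t path_compatible_add[OF U f g])
    show "s \<oplus>\<^bsub>sec fam U\<^esub> t = t \<oplus>\<^bsub>sec fam U\<^esub> s"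
      unfolding s t fam_simps univ.sel by (rule eqI) (simp_all add: G(4) cl[OF f] cl[OF g])
    fix u assume "u \<in> carrier (sec fam U)"
    then obtain h where u: "u = Family h" and h: "h \<in> path_compatible X F U" using secE by blast
    show "s \<oplus>\<^bsub>sec fam U\<^esub> t \<oplus>\<^bsub>sec fam U\<^esub> u = s \<oplus>\<^bsub>sec fam U\<^esub> (t \<oplus>\<^bsub>sec fam U\<^esub> u)"
      unfolding s t u fam_simps univ.sel by (rule eqI) (simp_all add: G(3) cl[OF f] cl[OF g] cl[OF h])
  qed
  show ?thesis
  proof (intro left_module.intro left_module_axioms.intro group C.ring_axioms)
    fix a s assume a: "a \<in> carrier (const_ring X B U)" and "s \<in> carrier (sec fam U)"
    then obtain f where s: "s = Family f" and f: "f \<in> path_compatible X F U" using secE by blast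
    show "a \<odot>\<^bsub>sec fam U\<^esub> s \<in> carrier (sec fam U)"
      using path_compatible_smult[OF U _ f, of a] a by (simp add: s)
    fix b assume b: "b \<in> carrier (const_ring X B U)"
    show "(a \<oplus>\<^bsub>const_ring X B U\<^esub> b) \<odot>\<^bsub>sec fam U\<^esub> s = a \<odot>\<^bsub>sec fam U\<^esub> s \<oplus>\<^bsub>sec fam U\<^esub> b \<odot>\<^bsub>sec fam U\<^esub> s"
      unfolding s fam_simps univ.sel const_ring_simps
      by (rule eqI) (simp_all add: left_module.smult_l_distr[OF M] bcl[OF a] bcl[OF b] cl[OF f])
    show "(a \<otimes>\<^bsub>const_ring X B U\<^esub> b) \<odot>\<^bsub>sec fam U\<^esub> s = a \<odot>\<^bsub>sec fam U\<^esub> (b \<odot>\<^bsub>sec fam U\<^esub> s)"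
      unfolding s fam_simps univ.sel const_ring_simps
      by (rule eqI) (simp_all add: left_module.smult_assoc[OF M] bcl[OF a] bcl[OF b] cl[OF f])
  next
    fix a s t assume a: "a \<in> carrier (const_ring X B U)" and "s \<in> carrier (sec fam U)" "t \<in> carrier (sec fam U)"
    then obtain f g where s: "s = Family f" and f: "f \<in> path_compatible X F U"
      and t: "t = Family g" and g: "g \<in> path_compatible X F U" using secE by metis
    show "a \<odot>\<^bsub>sec fam U\<^esub> (s \<oplus>\<^bsub>sec fam U\<^esub> t) = a \<odot>\<^bsub>sec fam U\<^esub> s \<oplus>\<^bsub>sec fam U\<^esub> a \<odot>\<^bsub>sec fam U\<^esub> t"
      unfolding s t fam_simps univ.sel
      by (rule eqI) (simp_all add: left_module.smult_r_distr[OF M] bcl[OF a] cl[OF f] cl[OF g])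
  next
    fix s assume "s \<in> carrier (sec fam U)"
    then obtain f where s: "s = Family f" and f: "f \<in> path_compatible X F U" using secE by blast
    show "\<one>\<^bsub>const_ring X B U\<^esub> \<odot>\<^bsub>sec fam U\<^esub> s = s"
      unfolding s fam_simps univ.sel const_ring_simps
      by (rule eqI) (simp_all add: left_module.smult_one[OF M] cl[OF f] path_compatible_ext[OF f])
  qed
qed

lemma fam_presheaf: "module_presheaf X B fam"
proof
  show "is_presheaf X B fam"
    unfolding is_presheaf_def
  proof (intro conjI allI impI ballI)
    fix U V assume "openin X U \<and> openin X V \<and> V \<subseteq> U"
    then have V: "V \<subseteq> U" by simp
    show "res fam U V \<in> carrier (sec fam U) \<rightarrow> carrier (sec fam V)"
      by (auto simp: path_compatible_restrict[OF _ V])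
    show "res fam U V (s \<oplus>\<^bsub>sec fam U\<^esub> t) = res fam U V s \<oplus>\<^bsub>sec fam V\<^esub> res fam U V t" for s t
      using V by (auto simp: fun_eq_iff)
    show "res fam U V (b \<odot>\<^bsub>sec fam U\<^esub> s) = restrict b V \<odot>\<^bsub>sec fam V\<^esub> res fam U V s" for b s
      using V by (auto simp: fun_eq_iff)
  next
    fix U s assume "s \<in> carrier (sec fam U)"
    then show "res fam U U s = s"
      by (auto simp: extensional_restrict path_compatible_ext)
  next
    fix U V W s assume "openin X U \<and> openin X V \<and> openin X W \<and> W \<subseteq> V \<and> V \<subseteq> U"
    then show "res fam V W (res fam U V s) = res fam U W s" by (auto simp: fun_eq_iff)
  qed (rule fam_module)
qed

text \<open>A path in the union of a cover can be cut into pieces that each lie in a member of the cover,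
  and compatibility along consecutive pieces composes.\<close>

lemma path_compatible_glue:
  assumes open_U: "\<And>U. U \<in> \<U> \<Longrightarrow> openin X U" and f: "f \<in> extensional (\<Union>\<U>)"
    and loc: "\<And>U. U \<in> \<U> \<Longrightarrow> restrict f U \<in> path_compatible X F U"
  shows "f \<in> path_compatible X F (\<Union>\<U>)"
proof (rule path_compatibleI[OF f])
  fix x assume "x \<in> \<Union>\<U>"
  then obtain U where "U \<in> \<U>" "x \<in> U" by blast
  then show "f x \<in> carrier (fib x)" using path_compatible_closed[OF loc, of U x] by simp
next
  fix \<gamma> assume "pathin (subtopology X (\<Union>\<U>)) \<gamma>"
  then have \<gamma>: "pathin X \<gamma>" "\<And>t. t \<in> {0..1} \<Longrightarrow> \<gamma> t \<in> \<Union>\<U>" by (auto simp: pathin_subtopology)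
  have fcl: "f (\<gamma> t) \<in> carrier (fib (\<gamma> t))" if t: "t \<in> {0..1}" for t
  proof -
    obtain U where "U \<in> \<U>" "\<gamma> t \<in> U" using \<gamma>(2)[OF t] by blast
    then show ?thesis using path_compatible_closed[OF loc, of U "\<gamma> t"] by simp
  qed
  \<comment> \<open>Bisection of the parameter interval; the guard keeps its subintervals inside \<open>[0,1]\<close>.\<close>
  let ?P = "\<lambda>a b. 0 \<le> a \<and> a \<le> b \<and> b \<le> 1 \<longrightarrow> act (subpath_between a b \<gamma>) (f (\<gamma> a)) = f (\<gamma> b)"
  have "?P 0 1"
  proof (rule Bolzano[where P = ?P])
    fix a b c :: real assume *: "?P a b" "?P b c" "a \<le> b" "b \<le> c"
    show "?P a c"
    proof
      assume ac: "0 \<le> a \<and> a \<le> c \<and> c \<le> 1"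
      then have "a \<in> {0..1}" "b \<in> {0..1}" "c \<in> {0..1}" using *(3,4) by auto
      from act_subpath_between[OF \<gamma>(1) this, of "f (\<gamma> a)"] fcl[OF this(1)] * ac
      show "act (subpath_between a c \<gamma>) (f (\<gamma> a)) = f (\<gamma> c)" by auto
    qed
  next
    fix x :: real assume "0 \<le> x" "x \<le> 1"
    then have x: "x \<in> {0..1}" by simp
    then obtain U where U: "U \<in> \<U>" "\<gamma> x \<in> U" using \<gamma>(2) by blast
    have "openin (top_of_set {0..1}) {y \<in> {0..1}. \<gamma> y \<in> U}"
      using openin_continuous_map_preimage[OF \<gamma>(1)[unfolded pathin_def] open_U[OF U(1)]] by simp
    then obtain d where d: "d > 0" "\<And>y. y \<in> {0..1} \<Longrightarrow> dist y x < d \<Longrightarrow> \<gamma> y \<in> U"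
      using U(2) x unfolding openin_euclidean_subtopology_iff by blast
    show "\<exists>d>0. \<forall>a b. a \<le> x \<and> x \<le> b \<and> b - a < d \<longrightarrow> ?P a b"
    proof (intro exI[of _ d] conjI allI impI, fact d(1))
      fix a b assume ab: "a \<le> x \<and> x \<le> b \<and> b - a < d" "0 \<le> a \<and> a \<le> b \<and> b \<le> 1"
      have inU: "\<gamma> y \<in> U" if "y \<in> {a..b}" for y
        using that ab by (intro d(2)) (auto simp: dist_real_def)
      have "pathin X (subpath_between a b \<gamma>)" by (rule pathin_subpath_between[OF \<gamma>(1)]) (use ab in auto)
      moreover have "subpath_between a b \<gamma> t \<in> U" if "t \<in> {0..1}" for t
        unfolding subpath_between_def
        by (rule inU) (use subpath_parameter_in_segment(1)[of a b t] ab that in auto)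
      ultimately have "pathin (subtopology X U) (subpath_between a b \<gamma>)"
        by (simp add: pathin_subtopology)
      from path_compatible_act[OF loc[OF U(1)] this] inU[of a] inU[of b] ab
      show "act (subpath_between a b \<gamma>) (f (\<gamma> a)) = f (\<gamma> b)" by simp
    qed
  qed auto
  then show "act \<gamma> (f (\<gamma> 0)) = f (\<gamma> 1)" by simp
qed

lemma fam_sheaf: "is_sheaf X B fam"
  unfolding is_sheaf_def
proof (intro conjI allI impI)
  show "is_presheaf X B fam" using fam_presheaf by (simp add: module_presheaf_def)
  fix \<U> s
  assume *: "(\<forall>U\<in>\<U>. openin X U \<and> s U \<in> carrier (sec fam U)) \<and>
    (\<forall>U\<in>\<U>. \<forall>V\<in>\<U>. res fam U (U \<inter> V) (s U) = res fam V (U \<inter> V) (s V))"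
  then have open_U: "openin X U" and sec: "s U \<in> carrier (sec fam U)" if "U \<in> \<U>" for U
    using that by auto
  have mem: "members (s U) \<in> path_compatible X F U" "s U = Family (members (s U))" if "U \<in> \<U>" for U
    using sec[OF that] by auto
  have agree: "members (s U) x = members (s V) x" if "U \<in> \<U>" "V \<in> \<U>" "x \<in> U" "x \<in> V" for U V x
  proof -
    have "restrict (members (s U)) (U \<inter> V) = restrict (members (s V)) (U \<inter> V)"
    proof -
      have "res fam U (U \<inter> V) (s U) = res fam V (U \<inter> V) (s V)" using * that(1,2) by blast
      then show ?thesis by simp
    qed
    from fun_cong[OF this, of x] show ?thesis using that by simp
  qed
  define f where "f = (\<lambda>x\<in>\<Union>\<U>. members (s (SOME U. U \<in> \<U> \<and> x \<in> U)) x)"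
  have f: "f x = members (s U) x" if "U \<in> \<U>" "x \<in> U" for U x
  proof -
    let ?V = "SOME U. U \<in> \<U> \<and> x \<in> U"
    have V: "?V \<in> \<U> \<and> x \<in> ?V" by (rule someI[of _ U]) (use that in simp)
    have "f x = members (s ?V) x" unfolding f_def by (rule restrict_apply') (use that in blast)
    also have "\<dots> = members (s U) x" by (rule agree) (use V that in blast)+
    finally show ?thesis .
  qed
  have fres: "restrict f U = members (s U)" if "U \<in> \<U>" for U
    by (rule extensionalityI[OF restrict_extensional path_compatible_ext[OF mem(1)[OF that]]])
      (simp add: f[OF that])
  have fc: "f \<in> path_compatible X F (\<Union>\<U>)"
    by (rule path_compatible_glue[OF open_U]) (simp_all add: fres mem(1), simp add: f_def)
  show "\<exists>!t. t \<in> carrier (sec fam (\<Union>\<U>)) \<and> (\<forall>U\<in>\<U>. res fam (\<Union>\<U>) U t = s U)"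
  proof (rule ex1I[of _ "Family f"])
    show "Family f \<in> carrier (sec fam (\<Union>\<U>)) \<and> (\<forall>U\<in>\<U>. res fam (\<Union>\<U>) U (Family f) = s U)"
      using fc mem(2) by (simp add: fres)
    fix t assume t: "t \<in> carrier (sec fam (\<Union>\<U>)) \<and> (\<forall>U\<in>\<U>. res fam (\<Union>\<U>) U t = s U)"
    then obtain g where g: "t = Family g" "g \<in> path_compatible X F (\<Union>\<U>)" by auto
    have "g x = f x" if x: "x \<in> \<Union>\<U>" for x
    proof -
      obtain U where U: "U \<in> \<U>" "x \<in> U" using x by blast
      have "res fam (\<Union>\<U>) U t = s U" using t U(1) by blast
      then have "s U = Family (restrict g U)" by (simp add: g(1))
      then show ?thesis using f[OF U] U(2) by simp
    qed
    then have "g = f" by (rule extensionalityI[OF path_compatible_ext[OF g(2)] path_compatible_ext[OF fc]])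
    then show "t = Family f" by (simp add: g(1))
  qed
qed

end


section \<open>Local triviality of the sheaf of families\<close>

context path_representation
begin

interpretation fam: module_presheaf X B fam by (rule fam_presheaf)

text \<open>A path-connected neighbourhood of \<open>x\<close> inside one whose loops at \<open>x\<close> are null-homotopic will do, with
  \<open>x\<close> as base point. This is the only place where semilocal simple connectedness enters.\<close>

lemma path_independent_nbhd:
  assumes lpc: "locally_path_connected_space X" and slsc: "semilocally_simply_connected X"
    and V: "openin X V" "x \<in> V"
  obtains U where "path_independent U" "x \<in> U" "U \<subseteq> V"
proof -
  have x: "x \<in> topspace X" using V openin_subset by blast
  obtain W where W0: "openin X W \<and> x \<in> W \<and>
      (\<forall>\<gamma>. pathin (subtopology X W) \<gamma> \<and> \<gamma> 0 = x \<and> \<gamma> 1 = x \<longrightarrow> path_homotopic X \<gamma> (\<lambda>_. x))"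
    using bspec[OF slsc[unfolded semilocally_simply_connected_def] x] by (rule exE)
  then have W: "openin X W" "x \<in> W" by simp_all
  note loops = W0[THEN conjunct2, THEN conjunct2, rule_format]
  have "openin X (V \<inter> W)" "x \<in> V \<inter> W" using V W by auto
  then obtain U where U: "openin X U" "path_connectedin X U" "x \<in> U" "U \<subseteq> V \<inter> W"
    using lpc unfolding locally_path_connected_space by blast
  have "path_independent U"
  proof (rule path_independentI[OF U(1-3)])
    fix \<gamma> assume "pathin (subtopology X U) \<gamma>" "\<gamma> 0 = x" "\<gamma> 1 = x"
    then show "path_homotopic X \<gamma> (\<lambda>_. x)" using U(4) by (intro loops) (auto simp: pathin_subtopology)
  qed
  then show ?thesis using U that by blast
qed

lemma slide_family:
  assumes U: "path_independent U" and x: "x \<in> U" and V: "V \<subseteq> U"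
    and f: "f \<in> locally_constant_on X V (carrier (fib x))"
  shows "(\<lambda>y\<in>V. slide U x y (f y)) \<in> path_compatible X F V"
proof (rule path_compatibleI)
  fix y assume "y \<in> V"
  then show "(\<lambda>y\<in>V. slide U x y (f y)) y \<in> carrier (fib y)"
    using slide_closed[OF U x] V locally_constant_on_closed[OF f] by auto
next
  fix \<gamma> assume \<gamma>: "pathin (subtopology X V) \<gamma>"
  then have ends: "\<gamma> 0 \<in> V" "\<gamma> 1 \<in> V" and \<gamma>U: "pathin (subtopology X U) \<gamma>"
    using V by (auto simp: pathin_subtopology)
  have U01: "\<gamma> 0 \<in> U" "\<gamma> 1 \<in> U" using ends V by auto
  have m: "f (\<gamma> 0) \<in> carrier (fib x)" by (rule locally_constant_on_closed[OF f ends(1)])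
  have "act \<gamma> (slide U x (\<gamma> 0) (f (\<gamma> 0))) = slide U (\<gamma> 0) (\<gamma> 1) (slide U x (\<gamma> 0) (f (\<gamma> 0)))"
    by (rule slide_act[OF U \<gamma>U slide_closed[OF U x U01(1) m], symmetric])
  also have "\<dots> = slide U x (\<gamma> 1) (f (\<gamma> 0))" by (rule slide_slide[OF U x U01 m])
  finally show "act \<gamma> ((\<lambda>y\<in>V. slide U x y (f y)) (\<gamma> 0)) = (\<lambda>y\<in>V. slide U x y (f y)) (\<gamma> 1)"
    using ends locally_constant_on_path[OF f \<gamma>] by simp
qed simp

lemma path_compatible_slide:
  assumes U: "path_independent U" and f: "f \<in> path_compatible X F V" and W: "path_connectedin X W" "W \<subseteq> V" "W \<subseteq> U"
    and xy: "x \<in> W" "y \<in> W"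
  shows "f y = slide U x y (f x)"
proof -
  obtain \<gamma> where \<gamma>: "pathin (subtopology X W) \<gamma>" "\<gamma> 0 = x" "\<gamma> 1 = y"
    by (rule path_between_in[OF W(1) xy])
  then have p: "pathin (subtopology X V) \<gamma>" "pathin (subtopology X U) \<gamma>"
    using W by (auto simp: pathin_subtopology)
  have "x \<in> V" using xy(1) W(2) by blast
  then have "slide U x y (f x) = act \<gamma> (f x)"
    using slide_act[OF U p(2), of "f x"] path_compatible_closed[OF f, of x] \<gamma>(2,3) by simp
  then show ?thesis using path_compatible_act[OF f p(1)] \<gamma>(2,3) by simp
qed

lemma path_compatible_eq_on:
  assumes f: "f \<in> path_compatible X F U" and g: "g \<in> path_compatible X F V"
    and W: "path_connectedin X W" "W \<subseteq> U" "W \<subseteq> V" and xy: "x \<in> W" "y \<in> W" and eq: "f x = g x"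
  shows "f y = g y"
proof -
  obtain \<gamma> where \<gamma>: "pathin (subtopology X W) \<gamma>" "\<gamma> 0 = x" "\<gamma> 1 = y"
    by (rule path_between_in[OF W(1) xy])
  then have "pathin (subtopology X U) \<gamma>" "pathin (subtopology X V) \<gamma>"
    using W by (auto simp: pathin_subtopology)
  from path_compatible_act[OF f this(1)] path_compatible_act[OF g this(2)]
  show ?thesis using \<gamma>(2,3) eq by simp
qed

text \<open>Over a path-independent set \<open>U\<close>, sliding all values to one base point turns path-compatible
  families into locally constant functions; sliding back is the inverse.\<close>

definition fam_triv :: "'a set \<Rightarrow> 'a \<Rightarrow> 'a set \<Rightarrow> ('a, 'c) univ \<Rightarrow> 'a \<Rightarrow> ('a, 'c) univ" where
  "fam_triv U x = (\<lambda>V\<in>{V. openin (subtopology X U) V}. \<lambda>s\<in>carrier (sec fam V).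
     \<lambda>y\<in>V. slide U y x (members s y))"

lemma fam_trivialisation:
  assumes lpc: "locally_path_connected_space X" and U: "path_independent U" and x: "x \<in> U"
  shows "trivialisation X B fam U (fib x) (fam_triv U x)"
  unfolding trivialisation_def
proof (intro conjI)
  note oU = path_independentD(1)[OF U]
  let ?Y = "subtopology X U"
  show "openin X U" by (rule oU)
  show "left_module B (fib x)" using fib_module x openin_subset[OF oU] by blast
  have op: "openin ?Y V \<longleftrightarrow> openin X V \<and> V \<subseteq> U" for V using oU by (auto simp: openin_open_subtopology)
  have t: "fam_triv U x V (Family f) = (\<lambda>y\<in>V. slide U y x (f y))"
    if "openin X V" "V \<subseteq> U" "f \<in> path_compatible X F V" for V f
    using that by (simp add: fam_triv_def op)
  have lc: "(\<lambda>y\<in>V. slide U y x (f y)) \<in> locally_constant_on X V (carrier (fib x))"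
    if V: "openin X V" "V \<subseteq> U" and f: "f \<in> path_compatible X F V" for V f
  proof (rule locally_constant_onI)
    fix y assume y: "y \<in> V"
    obtain W where W: "openin X W" "path_connectedin X W" "y \<in> W" "W \<subseteq> V"
      using lpc V(1) y unfolding locally_path_connected_space by blast
    have "slide U z x (f z) = slide U y x (f y)" if z: "z \<in> W" for z
    proof -
      have zy: "z \<in> U" "y \<in> U" using z y W(4) V(2) by auto
      have "f z = slide U y z (f y)"
        by (rule path_compatible_slide[OF U f W(2,4) _ W(3) z]) (use W(4) V(2) in blast)
      then show ?thesis
        using slide_slide[OF U zy(2,1) x path_compatible_closed[OF f y]] by simp
    qed
    moreover have "z \<in> V" if "z \<in> W" for z using that W(4) by blast
    ultimately have "\<forall>z\<in>W. (\<lambda>y\<in>V. slide U y x (f y)) z = (\<lambda>y\<in>V. slide U y x (f y)) y"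
      using y by simp
    with W show "\<exists>W. openin X W \<and> y \<in> W \<and> W \<subseteq> V \<and>
        (\<forall>z\<in>W. (\<lambda>y\<in>V. slide U y x (f y)) z = (\<lambda>y\<in>V. slide U y x (f y)) y)" by blast
  qed (use slide_closed[OF U _ x] path_compatible_closed[OF f] V in auto)
  have hom: "slide U y x \<in> module_hom B (fib y) (fib x)" if "y \<in> U" for y
    by (rule slide_module_hom[OF U that x])
  show "fam_triv U x \<in> sheaf_iso ?Y B fam (const_sheaf ?Y (fib x))"
  proof (rule module_presheaf.sheaf_isoI[OF fam.presheaf_subtopology[OF oU]])
    show "fam_triv U x \<in> sheaf_hom ?Y B fam (const_sheaf ?Y (fib x))"
    proof (rule sheaf_homI)
      fix V assume "openin ?Y V"
      then have V: "openin X V" "V \<subseteq> U" by (simp_all add: op)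
      show "fam_triv U x V \<in> module_hom (const_ring ?Y B V) (sec fam V) (sec (const_sheaf ?Y (fib x)) V)"
      proof (rule module_homI)
        show "fam_triv U x V \<in> extensional (carrier (sec fam V))" using V by (simp add: fam_triv_def op)
        fix s assume "s \<in> carrier (sec fam V)"
        then obtain f where s: "s = Family f" and f: "f \<in> path_compatible X F V" by auto
        show "fam_triv U x V s \<in> carrier (sec (const_sheaf ?Y (fib x)) V)"
          using lc[OF V f] V by (simp add: s t f locally_constant_on_subtopology[OF oU])
        fix s' assume "s' \<in> carrier (sec fam V)"
        then obtain g where s': "s' = Family g" and g: "g \<in> path_compatible X F V" by auto
        show "fam_triv U x V (s \<oplus>\<^bsub>sec fam V\<^esub> s')
          = fam_triv U x V s \<oplus>\<^bsub>sec (const_sheaf ?Y (fib x)) V\<^esub> fam_triv U x V s'"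
          unfolding s s' fam_simps univ.sel const_sheaf_simps t[OF V f] t[OF V g]
            t[OF V path_compatible_add[OF V(1) f g]]
          by (rule restrict_ext) (use V in \<open>simp add: subset_iff module_hom_add[OF hom]
            path_compatible_closed[OF f] path_compatible_closed[OF g]\<close>)
      next
        fix b s assume "b \<in> carrier (const_ring ?Y B V)" "s \<in> carrier (sec fam V)"
        then obtain f where s: "s = Family f" and f: "f \<in> path_compatible X F V"
          and b: "b \<in> locally_constant_on X V (carrier B)"
          using V by (auto simp: locally_constant_on_subtopology[OF oU])
        show "fam_triv U x V (b \<odot>\<^bsub>sec fam V\<^esub> s) = b \<odot>\<^bsub>sec (const_sheaf ?Y (fib x)) V\<^esub> fam_triv U x V s"
          unfolding s fam_simps univ.sel const_sheaf_simps t[OF V f] t[OF V path_compatible_smult[OF V(1) b f]]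
          by (rule restrict_ext) (use V in \<open>simp add: subset_iff module_hom_smult[OF hom]
            path_compatible_closed[OF f] locally_constant_on_closed[OF b]\<close>)
      qed
    next
      fix V W s assume "openin ?Y V" "openin ?Y W" "W \<subseteq> V" "s \<in> carrier (sec fam V)"
      then obtain f where V: "openin X V" "V \<subseteq> U" "openin X W" "W \<subseteq> U" "W \<subseteq> V"
        and s: "s = Family f" and f: "f \<in> path_compatible X F V" by (auto simp: op)
      show "res (const_sheaf ?Y (fib x)) V W (fam_triv U x V s) = fam_triv U x W (res fam V W s)"
        unfolding s fam_simps univ.sel const_sheaf_simps t[OF V(1,2) f]
          t[OF V(3,4) path_compatible_restrict[OF f V(5)]]
        using V(5) by (auto simp: fun_eq_iff)
    qed (simp add: fam_triv_def)
    fix V assume "openin ?Y V"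
    then have V: "openin X V" "V \<subseteq> U" by (simp_all add: op)
    have "bij_betw (fam_triv U x V) (carrier (sec fam V)) (locally_constant_on X V (carrier (fib x)))"
    proof (rule bij_betwI[where g = "\<lambda>h. Family (\<lambda>y\<in>V. slide U x y (h y))"])
      show "fam_triv U x V \<in> carrier (sec fam V) \<rightarrow> locally_constant_on X V (carrier (fib x))"
        using lc[OF V] t[OF V] by auto
      show "(\<lambda>h. Family (\<lambda>y\<in>V. slide U x y (h y))) \<in> locally_constant_on X V (carrier (fib x)) \<rightarrow> carrier (sec fam V)"
        using slide_family[OF U x V(2)] by auto
    next
      fix s assume "s \<in> carrier (sec fam V)"
      then obtain f where s: "s = Family f" and f: "f \<in> path_compatible X F V" by auto
      have "(\<lambda>y\<in>V. slide U x y ((\<lambda>y\<in>V. slide U y x (f y)) y)) = f"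
      proof (rule extensionalityI[OF restrict_extensional path_compatible_ext[OF f]])
        fix y assume y: "y \<in> V"
        then have "y \<in> U" using V(2) by blast
        then show "(\<lambda>y\<in>V. slide U x y ((\<lambda>y\<in>V. slide U y x (f y)) y)) y = f y"
          using y slide_slide[OF U _ x, of y y "f y"] slide_same[OF U, of y "f y"]
            path_compatible_closed[OF f y] by simp
      qed
      then show "Family (\<lambda>y\<in>V. slide U x y (fam_triv U x V s y)) = s" by (simp only: s t[OF V f])
    next
      fix h assume h: "h \<in> locally_constant_on X V (carrier (fib x))"
      show "fam_triv U x V (Family (\<lambda>y\<in>V. slide U x y (h y))) = h"
        unfolding t[OF V slide_family[OF U x V(2) h]]
      proof (rule extensionalityI)
        show "h \<in> extensional V" using locally_constant_on_PiE[OF h] by (simp add: PiE_def)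
        fix y assume y: "y \<in> V"
        then have "y \<in> U" using V(2) by blast
        then show "(\<lambda>y\<in>V. slide U y x ((\<lambda>y\<in>V. slide U x y (h y)) y)) y = h y"
          using y slide_slide[OF U x _ x, of y "h y"] slide_same[OF U x, of "h y"]
            locally_constant_on_closed[OF h y] by simp
      qed simp
    qed
    then show "bij_betw (fam_triv U x V) (carrier (sec fam V)) (carrier (sec (const_sheaf ?Y (fib x)) V))"
      using V by (simp add: locally_constant_on_subtopology[OF oU])
  qed
qed

text \<open>This identifies the stalk of the sheaf of families at \<open>x\<close> with \<open>fib x\<close>; it is the component at
  \<open>x\<close> of the counit.\<close>

definition stalk_eval :: "'a \<Rightarrow> ('a, 'c) univ \<Rightarrow> ('a, 'c) univ" where
  "stalk_eval x = (\<lambda>g\<in>carrier (stalk X fam x). members (germ_section g) x)"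

lemma stalk_eval_germ:
  assumes U: "openin X U" "x \<in> U" and f: "f \<in> path_compatible X F U"
  shows "stalk_eval x (germ X fam x U (Family f)) = f x"
proof -
  let ?g = "germ X fam x U (Family f)"
  have s: "Family f \<in> carrier (sec fam U)" using f by simp
  note g = fam.germ_nbhd_section[OF fam.germ_in_stalk[OF U s]]
  obtain Z where Z: "x \<in> Z" "res fam (germ_nbhd ?g) Z (germ_section ?g) = res fam U Z (Family f)"
    using g(4) fam.germ_eq_iff[OF g(1-3) U s] by auto
  from Z(2) have "restrict (members (germ_section ?g)) Z = restrict f Z" by simp
  from fun_cong[OF this, of x] show ?thesis
    using Z(1) fam.germ_in_stalk[OF U s] by (simp add: stalk_eval_def)
qed

lemma stalk_famE:
  assumes "g \<in> carrier (stalk X fam x)"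
  obtains U f where "openin X U" "x \<in> U" "f \<in> path_compatible X F U" "g = germ X fam x U (Family f)"
  using assms by (auto elim!: fam.stalkE)

lemma stalk_eval_module_hom: "stalk_eval x \<in> module_hom B (stalk X fam x) (fib x)"
proof (rule module_homI)
  show "stalk_eval x \<in> extensional (carrier (stalk X fam x))" by (simp add: stalk_eval_def)
  fix g assume g: "g \<in> carrier (stalk X fam x)"
  then show "stalk_eval x g \<in> carrier (fib x)"
    by (elim stalk_famE) (simp add: stalk_eval_germ path_compatible_closed)
  fix h assume "h \<in> carrier (stalk X fam x)"
  with g obtain U s t where U: "openin X U" "x \<in> U" and s: "s \<in> carrier (sec fam U)"
    and t: "t \<in> carrier (sec fam U)" and gh: "g = germ X fam x U s" "h = germ X fam x U t"
    by (rule fam.stalk_common_nbhd)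
  obtain p q where p: "s = Family p" "p \<in> path_compatible X F U" and q: "t = Family q" "q \<in> path_compatible X F U"
    using s t by auto
  have "g \<oplus>\<^bsub>stalk X fam x\<^esub> h = germ X fam x U (Family (\<lambda>x\<in>U. p x \<oplus>\<^bsub>fib x\<^esub> q x))"
    unfolding gh fam.germ_add[OF U s t] by (simp add: p(1) q(1))
  then show "stalk_eval x (g \<oplus>\<^bsub>stalk X fam x\<^esub> h) = stalk_eval x g \<oplus>\<^bsub>fib x\<^esub> stalk_eval x h"
    using stalk_eval_germ[OF U p(2)] stalk_eval_germ[OF U q(2)]
      stalk_eval_germ[OF U path_compatible_add[OF U(1) p(2) q(2)]] U(2)
    by (simp add: gh p(1) q(1))
next
  fix b g assume b: "b \<in> carrier B" and "g \<in> carrier (stalk X fam x)"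
  then obtain U f where U: "openin X U" "x \<in> U" and f: "f \<in> path_compatible X F U"
    and g: "g = germ X fam x U (Family f)" by (elim stalk_famE)
  have c: "(\<lambda>y\<in>U. b) \<in> locally_constant_on X U (carrier B)" by (rule locally_constant_on_const[OF U(1) b])
  have "b \<odot>\<^bsub>stalk X fam x\<^esub> g = germ X fam x U ((\<lambda>y\<in>U. b) \<odot>\<^bsub>sec fam U\<^esub> Family f)"
    unfolding g by (rule fam.germ_smult[OF U _ b]) (simp add: f)
  then show "stalk_eval x (b \<odot>\<^bsub>stalk X fam x\<^esub> g) = b \<odot>\<^bsub>fib x\<^esub> stalk_eval x g"
    using stalk_eval_germ[OF U f] stalk_eval_germ[OF U path_compatible_smult[OF U(1) c f]] U(2)
    by (simp add: g)
qed

text \<open>The value at \<open>x\<close> determines a path-compatible family on any path-connected neighbourhood of \<open>x\<close>.\<close>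

lemma stalk_eval_inj:
  assumes lpc: "locally_path_connected_space X"
    and g: "g \<in> carrier (stalk X fam x)" and h: "h \<in> carrier (stalk X fam x)"
    and eq: "stalk_eval x g = stalk_eval x h"
  shows "g = h"
proof -
  obtain U p where U: "openin X U" "x \<in> U" and p: "p \<in> path_compatible X F U" "g = germ X fam x U (Family p)"
    using g by (rule stalk_famE)
  obtain V q where V: "openin X V" "x \<in> V" and q: "q \<in> path_compatible X F V" "h = germ X fam x V (Family q)"
    using h by (rule stalk_famE)
  have "openin X (U \<inter> V)" "x \<in> U \<inter> V" using U V by auto
  then obtain W where W: "openin X W" "path_connectedin X W" "x \<in> W" "W \<subseteq> U \<inter> V"
    using lpc unfolding locally_path_connected_space by blast
  have "p x = q x" using eq stalk_eval_germ[OF U p(1)] stalk_eval_germ[OF V q(1)] by (simp add: p q)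
  then have "p y = q y" if "y \<in> W" for y
    using path_compatible_eq_on[OF p(1) q(1) W(2) _ _ W(3) that] W(4) by simp
  then have "restrict p W = restrict q W" by (rule restrict_ext)
  then show "g = h"
    unfolding p(2) q(2) using U V W p(1) q(1) by (subst fam.germ_eq_iff) auto
qed

text \<open>Every value at \<open>x\<close> is attained, by the family that slides it about a path-independent
  neighbourhood.\<close>

lemma stalk_eval_bij:
  assumes lpc: "locally_path_connected_space X" and slsc: "semilocally_simply_connected X"
    and x: "x \<in> topspace X"
  shows "bij_betw (stalk_eval x) (carrier (stalk X fam x)) (carrier (fib x))"
  unfolding bij_betw_def
proof
  show "inj_on (stalk_eval x) (carrier (stalk X fam x))"
    by (rule inj_onI) (rule stalk_eval_inj[OF lpc])
  obtain U where U: "path_independent U" "x \<in> U" and "U \<subseteq> topspace X"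
    by (rule path_independent_nbhd[OF lpc slsc openin_topspace x])
  note oU = path_independentD(1)[OF U(1)]
  show "stalk_eval x ` carrier (stalk X fam x) = carrier (fib x)"
  proof
    show "stalk_eval x ` carrier (stalk X fam x) \<subseteq> carrier (fib x)"
      using module_hom_closed[OF stalk_eval_module_hom] by blast
    show "carrier (fib x) \<subseteq> stalk_eval x ` carrier (stalk X fam x)"
    proof
      fix m assume m: "m \<in> carrier (fib x)"
      let ?f = "\<lambda>y\<in>U. slide U x y ((\<lambda>y\<in>U. m) y)"
      have f: "?f \<in> path_compatible X F U"
        by (rule slide_family[OF U order_refl locally_constant_on_const[OF oU m]])
      have "stalk_eval x (germ X fam x U (Family ?f)) = m"
        using stalk_eval_germ[OF oU U(2) f] slide_same[OF U m] U(2) by simp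
      moreover have "germ X fam x U (Family ?f) \<in> carrier (stalk X fam x)"
        by (rule fam.germ_in_stalk[OF oU U(2)]) (use f in simp)
      ultimately show "m \<in> stalk_eval x ` carrier (stalk X fam x)" by (rule image_eqI[OF sym])
    qed
  qed
qed

lemma stalk_fam_fg_projective:
  assumes lpc: "locally_path_connected_space X" and slsc: "semilocally_simply_connected X"
    and x: "x \<in> topspace X"
  shows "fg_projective B (stalk X fam x)"
proof -
  note bij = stalk_eval_bij[OF assms]
  have zero: "stalk_eval x \<zero>\<^bsub>stalk X fam x\<^esub> = \<zero>\<^bsub>fib x\<^esub>"
    using stalk_eval_germ[OF openin_topspace x path_compatible_zero[OF openin_topspace]] x
    by (simp add: fam.germ_zero[OF openin_topspace x])
  have "left_module B (stalk X fam x)"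
    by (rule left_module_transfer[OF fib_module[OF x] stalk_eval_module_hom bij
          fam.stalk_add_closed fam.stalk_smult_closed fam.stalk_zero_closed[OF x] zero])
  then show ?thesis
    by (rule fg_projective_transfer[OF fib_fg_projective[OF x] _ stalk_eval_module_hom bij])
qed

lemma fam_local_system:
  assumes lpc: "locally_path_connected_space X" and slsc: "semilocally_simply_connected X"
  shows "local_system X B fam"
  unfolding local_system_iff locally_constant_sheaf_def
proof (intro conjI ballI fam_sheaf stalk_fam_fg_projective[OF lpc slsc])
  fix x assume x: "x \<in> topspace X"
  obtain U where U: "path_independent U" "x \<in> U" and "U \<subseteq> topspace X"
    by (rule path_independent_nbhd[OF lpc slsc openin_topspace x])
  from fam_trivialisation[OF lpc U] U(2)
  show "\<exists>U (M :: ('b, ('a, 'c) univ) module) \<phi>. x \<in> U \<and> trivialisation X B fam U M \<phi>" by blast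
qed

text \<open>The germs with values \<open>F(\<gamma>|[0,t])(m)\<close> form a flat section along \<open>\<gamma>\<close>: near a parameter \<open>t\<close> they
  come from the family that slides the value at \<open>\<gamma> t\<close> about a path-independent set.\<close>

lemma stalk_eval_parallel_transport:
  assumes lpc: "locally_path_connected_space X" and slsc: "semilocally_simply_connected X"
    and \<gamma>: "pathin X \<gamma>" and g: "g \<in> carrier (stalk X fam (\<gamma> 0))"
  shows "stalk_eval (\<gamma> 1) (parallel_transport X B fam (path_class X \<gamma>) g) = act \<gamma> (stalk_eval (\<gamma> 0) g)"
proof -
  interpret L: local_system X B fam by (rule fam_local_system[OF lpc slsc])
  have X: "\<gamma> t \<in> topspace X" if "t \<in> {0..1}" for t by (rule pathin_in_topspace[OF \<gamma> that])
  note bij = stalk_eval_bij[OF lpc slsc X]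
  \<comment> \<open>\<open>m\<close> transports the value of \<open>g\<close> by \<open>F\<close>, and \<open>\<sigma>\<close> is the family of germs with these values.\<close>
  define m where "m t = act (subpath_between 0 t \<gamma>) (stalk_eval (\<gamma> 0) g)" for t
  define \<sigma> where "\<sigma> t = inv_into (carrier (stalk X fam (\<gamma> t))) (stalk_eval (\<gamma> t)) (m t)" for t
  have g': "stalk_eval (\<gamma> 0) g \<in> carrier (fib (\<gamma> 0))" by (rule module_hom_closed[OF stalk_eval_module_hom g])
  have m: "m t \<in> carrier (fib (\<gamma> t))" if "t \<in> {0..1}" for t
    unfolding m_def
    using act_closed[OF pathin_subpath_between[OF \<gamma>, of 0 t], of "stalk_eval (\<gamma> 0) g"] that g' by simp
  have \<sigma>: "\<sigma> t \<in> carrier (stalk X fam (\<gamma> t))" "stalk_eval (\<gamma> t) (\<sigma> t) = m t" if "t \<in> {0..1}" for t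
  proof -
    have "m t \<in> stalk_eval (\<gamma> t) ` carrier (stalk X fam (\<gamma> t))"
      using m[OF that] bij[OF that] by (simp add: bij_betw_def)
    then show "\<sigma> t \<in> carrier (stalk X fam (\<gamma> t))" "stalk_eval (\<gamma> t) (\<sigma> t) = m t"
      unfolding \<sigma>_def by (rule inv_into_into, rule f_inv_into_f)
  qed
  have "fam.flat_along {0..1} \<gamma> \<sigma>"
  proof (rule fam.flat_alongI[OF \<gamma>[unfolded pathin_def]])
    fix t :: real assume t: "t \<in> {0..1}"
    obtain U where U: "path_independent U" "\<gamma> t \<in> U" and "U \<subseteq> topspace X"
      by (rule path_independent_nbhd[OF lpc slsc openin_topspace X[OF t]])
    note oU = path_independentD(1)[OF U(1)]
    obtain d where d: "d > 0"
      "\<And>s. s \<in> {0..1} \<Longrightarrow> dist s t < d \<Longrightarrow> pathin (subtopology X U) (subpath_between t s \<gamma>)"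
      by (rule short_subpaths_in_open[OF \<gamma> oU t U(2)]) blast
    let ?f = "\<lambda>y\<in>U. slide U (\<gamma> t) y ((\<lambda>y\<in>U. m t) y)"
    have f: "?f \<in> path_compatible X F U"
      by (rule slide_family[OF U order_refl locally_constant_on_const[OF oU m[OF t]]])
    have s: "\<gamma> s \<in> U \<and> \<sigma> s = germ X fam (\<gamma> s) U (Family ?f)" if s: "s \<in> {0..1}" "dist s t < d" for s
    proof
      note p = d(2)[OF s]
      show sU: "\<gamma> s \<in> U" using bspec[OF p[unfolded pathin_subtopology, THEN conjunct2], of 1] by simp
      have "slide U (\<gamma> t) (\<gamma> s) (m t) = act (subpath_between t s \<gamma>) (m t)"
        using slide_act[OF U(1) p, of "m t"] m[OF t] by simp
      also have "\<dots> = m s"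
        unfolding m_def by (rule act_subpath_between[OF \<gamma>]) (use t s g' in auto)
      finally have "?f (\<gamma> s) = m s" using sU by simp
      then have "stalk_eval (\<gamma> s) (germ X fam (\<gamma> s) U (Family ?f)) = stalk_eval (\<gamma> s) (\<sigma> s)"
        using stalk_eval_germ[OF oU sU f] \<sigma>(2)[OF s(1)] by simp
      from stalk_eval_inj[OF lpc _ _ this]
      show "\<sigma> s = germ X fam (\<gamma> s) U (Family ?f)"
        using fam.germ_in_stalk[OF oU sU, of "Family ?f"] f \<sigma>(1)[OF s(1)] by simp
    qed
    have "openin (top_of_set {0..1}) ({0..1} \<inter> ball t d)" by (simp add: openin_open_Int)
    moreover have "t \<in> {0..1} \<inter> ball t d" using t d(1) by simp
    moreover have "\<forall>s\<in>{0..1} \<inter> ball t d. \<gamma> s \<in> U \<and> \<sigma> s = germ X fam (\<gamma> s) U (Family ?f)"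
      using s by (simp add: dist_commute)
    moreover have "Family ?f \<in> carrier (sec fam U)" using f by simp
    ultimately show "\<exists>N W s. openin (top_of_set {0..1}) N \<and> t \<in> N \<and> openin X W \<and> s \<in> carrier (sec fam W) \<and>
        (\<forall>y\<in>N. \<gamma> y \<in> W \<and> \<sigma> y = germ X fam (\<gamma> y) W s)"
      using oU by blast
  qed
  from L.parallel_transport_flat[OF this]
  have pt: "parallel_transport X B fam (path_class X \<gamma>) (\<sigma> 0) = \<sigma> 1" .
  have "m 0 = stalk_eval (\<gamma> 0) g" unfolding m_def by (rule act_subpath_same[OF \<gamma> _ g']) simp
  then have "\<sigma> 0 = g" using stalk_eval_inj[OF lpc \<sigma>(1)[of 0] g] \<sigma>(2)[of 0] by simp
  then show ?thesis using pt \<sigma>(2)[of 1] by (simp add: m_def)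
qed

lemma stalk_eval_nat_iso:
  assumes lpc: "locally_path_connected_space X" and slsc: "semilocally_simply_connected X"
  shows "is_nat_iso (fundamental_groupoid X) (core (Proj B)) (Mon_ob X B fam) F
    (\<lambda>x\<in>topspace X. stalk_eval x)"
proof (rule nat_isoI)
  fix x assume "x \<in> Ob (fundamental_groupoid X)"
  then have x: "x \<in> topspace X" by simp
  have "stalk_eval x \<in> module_iso B (stalk X fam x) (fib x)"
    using stalk_eval_module_hom stalk_eval_bij[OF lpc slsc x] by (simp add: module_iso_def)
  then show "is_iso (core (Proj B)) (on_ob (Mon_ob X B fam) x) (fib x) ((\<lambda>x\<in>topspace X. stalk_eval x) x)"
    using x fg_projective_left_module[OF stalk_fam_fg_projective[OF lpc slsc x]]
    by (simp add: is_iso_core is_iso_Proj)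
next
  fix x y c assume xy: "x \<in> Ob (fundamental_groupoid X)" "y \<in> Ob (fundamental_groupoid X)"
    and "c \<in> Hom (fundamental_groupoid X) x y"
  then obtain \<gamma> where \<gamma>: "pathin X \<gamma>" "\<gamma> 0 = x" "\<gamma> 1 = y" "c = path_class X \<gamma>" by auto
  have "stalk_eval y (parallel_transport X B fam c g) = on_hom F x y c (stalk_eval x g)"
    if "g \<in> carrier (stalk X fam x)" for g
    using stalk_eval_parallel_transport[OF lpc slsc \<gamma>(1), of g] that by (simp add: \<gamma>(2-4) act_def)
  then show "Comp (core (Proj B)) (on_ob (Mon_ob X B fam) x) (on_ob (Mon_ob X B fam) y) (fib y)
      ((\<lambda>x\<in>topspace X. stalk_eval x) y) (on_hom (Mon_ob X B fam) x y c)
    = Comp (core (Proj B)) (on_ob (Mon_ob X B fam) x) (fib x) (fib y)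
      (on_hom F x y c) ((\<lambda>x\<in>topspace X. stalk_eval x) x)"
    using xy by (auto simp: compose_def)
qed simp

text \<open>If all loops in \<open>U\<close> are null-homotopic, then \<open>U\<close> is path-independent, and each value at \<open>x\<close>
  spreads over \<open>U\<close> in exactly one way: by sliding.\<close>

lemma evaluation_at_module_iso:
  assumes U: "openin X U" "path_connectedin X U" "loops_nullhomotopic_in X U" and x: "x \<in> U"
  shows "evaluation_at fam U x \<in> module_iso B (constant_scalars U (sec fam U)) (fib x)"
proof -
  have pi: "path_independent U"
    by (rule path_independentI[OF U(1,2) x]) (use U(3) in \<open>auto simp: loops_nullhomotopic_in_def\<close>)
  have ev: "evaluation_at fam U x (Family f) = f x" if "f \<in> path_compatible X F U" for f
    using that by (simp add: evaluation_at_def)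
  have "evaluation_at fam U x \<in> module_hom B (constant_scalars U (sec fam U)) (fib x)"
  proof (rule module_homI)
    fix s assume "s \<in> carrier (constant_scalars U (sec fam U))"
    then obtain f where s: "s = Family f" and f: "f \<in> path_compatible X F U" by (auto simp: constant_scalars_def)
    show "evaluation_at fam U x s \<in> carrier (fib x)" by (simp add: s ev f path_compatible_closed[OF f x])
    fix t assume "t \<in> carrier (constant_scalars U (sec fam U))"
    then obtain g where t: "t = Family g" and g: "g \<in> path_compatible X F U" by (auto simp: constant_scalars_def)
    show "evaluation_at fam U x (s \<oplus>\<^bsub>constant_scalars U (sec fam U)\<^esub> t)
      = evaluation_at fam U x s \<oplus>\<^bsub>fib x\<^esub> evaluation_at fam U x t"
      using ev[OF path_compatible_add[OF U(1) f g]] x by (simp add: s t ev f g constant_scalars_def)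
  next
    fix b s assume b: "b \<in> carrier B" and "s \<in> carrier (constant_scalars U (sec fam U))"
    then obtain f where s: "s = Family f" and f: "f \<in> path_compatible X F U" by (auto simp: constant_scalars_def)
    show "evaluation_at fam U x (b \<odot>\<^bsub>constant_scalars U (sec fam U)\<^esub> s) = b \<odot>\<^bsub>fib x\<^esub> evaluation_at fam U x s"
      using ev[OF path_compatible_smult[OF U(1) locally_constant_on_const[OF U(1) b] f]] x
      by (simp add: s ev f constant_scalars_def)
  qed (simp add: evaluation_at_def constant_scalars_def)
  moreover have "bij_betw (evaluation_at fam U x) (carrier (sec fam U)) (carrier (fib x))"
    unfolding bij_betw_def
  proof
    show "inj_on (evaluation_at fam U x) (carrier (sec fam U))"
    proof (rule inj_onI)
      fix s t assume "s \<in> carrier (sec fam U)" "t \<in> carrier (sec fam U)"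
        and eq: "evaluation_at fam U x s = evaluation_at fam U x t"
      then obtain f g where s: "s = Family f" and f: "f \<in> path_compatible X F U"
        and t: "t = Family g" and g: "g \<in> path_compatible X F U" by auto
      have "f x = g x" using eq by (simp add: s t ev f g)
      then have "f y = g y" if "y \<in> U" for y
        using path_compatible_eq_on[OF f g U(2) order_refl order_refl x that] by simp
      then have "f = g" by (rule extensionalityI[OF path_compatible_ext[OF f] path_compatible_ext[OF g]])
      then show "s = t" by (simp add: s t)
    qed
    show "evaluation_at fam U x ` carrier (sec fam U) = carrier (fib x)"
    proof (intro equalityI subsetI)
      fix m assume "m \<in> evaluation_at fam U x ` carrier (sec fam U)"
      then show "m \<in> carrier (fib x)" using ev path_compatible_closed x by auto
    next
      fix m assume m: "m \<in> carrier (fib x)"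
      let ?f = "\<lambda>y\<in>U. slide U x y ((\<lambda>y\<in>U. m) y)"
      have f: "?f \<in> path_compatible X F U"
        by (rule slide_family[OF pi x order_refl locally_constant_on_const[OF U(1) m]])
      have "evaluation_at fam U x (Family ?f) = m"
        using ev[OF f] slide_same[OF pi x m] x by simp
      then show "m \<in> evaluation_at fam U x ` carrier (sec fam U)"
        using f by (intro image_eqI[of _ _ "Family ?f"]) simp_all
    qed
  qed
  ultimately show ?thesis by (simp add: module_iso_def constant_scalars_def)
qed

end


section \<open>The quasi-inverse functor\<close>

lemma Family_functor_simps [simp]:
  "on_ob (Family_functor X) = family_sheaf X"
  "on_hom (Family_functor X) F G \<eta> = (\<lambda>U\<in>{U. openin X U}. \<lambda>s\<in>carrier (sec (family_sheaf X F) U).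
     Family (\<lambda>x\<in>U. \<eta> x (members s x)))"
  by (simp_all add: Family_functor_def)

lemma path_representationI:
  "ring B \<Longrightarrow> is_functor (fundamental_groupoid X) (core (Proj B)) F \<Longrightarrow> path_representation X B F"
  by (simp add: path_representation_def path_representation_axioms_def)

locale representation_morphism = F: path_representation X B F + G: path_representation X B G
  for X :: "'a topology" and B :: "('b, 'x) ring_scheme"
    and F G :: "('a, (real \<Rightarrow> 'a) set, ('b, ('a, 'c) univ) module, ('a, 'c) univ \<Rightarrow> ('a, 'c) univ) cfunctor" +
  fixes \<eta> :: "'a \<Rightarrow> ('a, 'c) univ \<Rightarrow> ('a, 'c) univ"
  assumes nat_iso: "is_nat_iso (fundamental_groupoid X) (core (Proj B)) F G \<eta>"
begin

abbreviation fmap :: "'a set \<Rightarrow> ('a, 'c) univ \<Rightarrow> ('a, 'c) univ" where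
  "fmap \<equiv> on_hom (Family_functor X) F G \<eta>"

lemma component_module_hom: "x \<in> topspace X \<Longrightarrow> \<eta> x \<in> module_hom B (F.fib x) (G.fib x)"
  using is_iso_in_Hom nat_iso_iso[OF nat_iso, of x] by (fastforce simp: is_iso_core)

lemma component_closed: "x \<in> topspace X \<Longrightarrow> m \<in> carrier (F.fib x) \<Longrightarrow> \<eta> x m \<in> carrier (G.fib x)"
  by (rule module_hom_closed[OF component_module_hom])

lemma component_act:
  assumes \<gamma>: "pathin X \<gamma>" and m: "m \<in> carrier (F.fib (\<gamma> 0))"
  shows "G.act \<gamma> (\<eta> (\<gamma> 0) m) = \<eta> (\<gamma> 1) (F.act \<gamma> m)"
proof -
  have X: "\<gamma> 0 \<in> topspace X" "\<gamma> 1 \<in> topspace X"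
    using \<gamma> by (auto intro: path_start_in_topspace path_finish_in_topspace)
  have "Comp (core (Proj B)) (F.fib (\<gamma> 0)) (F.fib (\<gamma> 1)) (G.fib (\<gamma> 1)) (\<eta> (\<gamma> 1)) (F.act \<gamma>)
    = Comp (core (Proj B)) (F.fib (\<gamma> 0)) (G.fib (\<gamma> 0)) (G.fib (\<gamma> 1)) (G.act \<gamma>) (\<eta> (\<gamma> 0))"
    unfolding F.act_def G.act_def by (rule nat_iso_natural[OF nat_iso]) (use X \<gamma> in auto)
  then have "compose (carrier (F.fib (\<gamma> 0))) (\<eta> (\<gamma> 1)) (F.act \<gamma>)
    = compose (carrier (F.fib (\<gamma> 0))) (G.act \<gamma>) (\<eta> (\<gamma> 0))" by simp
  from fun_cong[OF this, of m] show ?thesis using m by (simp add: compose_eq)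
qed

lemma fmap_compatible:
  assumes U: "openin X U" and f: "f \<in> path_compatible X F U"
  shows "(\<lambda>x\<in>U. \<eta> x (f x)) \<in> path_compatible X G U"
proof (rule G.path_compatibleI)
  fix x assume "x \<in> U"
  then show "(\<lambda>x\<in>U. \<eta> x (f x)) x \<in> carrier (G.fib x)"
    using component_closed F.path_compatible_closed[OF f] openin_subset[OF U] by auto
next
  fix \<gamma> assume \<gamma>: "pathin (subtopology X U) \<gamma>"
  then have \<gamma>X: "pathin X \<gamma>" and ends: "\<gamma> 0 \<in> U" "\<gamma> 1 \<in> U" by (simp_all add: pathin_subtopology)
  show "G.act \<gamma> ((\<lambda>x\<in>U. \<eta> x (f x)) (\<gamma> 0)) = (\<lambda>x\<in>U. \<eta> x (f x)) (\<gamma> 1)"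
    using component_act[OF \<gamma>X F.path_compatible_closed[OF f ends(1)]] F.path_compatible_act[OF f \<gamma>] ends
    by simp
qed simp

lemma fmap_apply:
  "openin X U \<Longrightarrow> f \<in> path_compatible X F U \<Longrightarrow> fmap U (Family f) = Family (\<lambda>x\<in>U. \<eta> x (f x))"
  by simp

lemma fmap_sheaf_hom: "fmap \<in> sheaf_hom X B (family_sheaf X F) (family_sheaf X G)"
proof (rule sheaf_homI)
  fix U assume U: "openin X U"
  then have X: "x \<in> topspace X" if "x \<in> U" for x using that openin_subset by blast
  show "fmap U \<in> module_hom (const_ring X B U) (sec (family_sheaf X F) U) (sec (family_sheaf X G) U)"
  proof (rule module_homI)
    fix s assume "s \<in> carrier (sec (family_sheaf X F) U)"
    then obtain f where s: "s = Family f" and f: "f \<in> path_compatible X F U" by auto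
    show "fmap U s \<in> carrier (sec (family_sheaf X G) U)"
      unfolding s fmap_apply[OF U f] using fmap_compatible[OF U f] by simp
    fix t assume "t \<in> carrier (sec (family_sheaf X F) U)"
    then obtain g where t: "t = Family g" and g: "g \<in> path_compatible X F U" by auto
    show "fmap U (s \<oplus>\<^bsub>sec (family_sheaf X F) U\<^esub> t) = fmap U s \<oplus>\<^bsub>sec (family_sheaf X G) U\<^esub> fmap U t"
      unfolding s t fmap_apply[OF U f] fmap_apply[OF U g] F.fam_simps G.fam_simps univ.sel
        fmap_apply[OF U F.path_compatible_add[OF U f g]] univ.inject
      by (rule restrict_ext)
        (simp add: module_hom_add[OF component_module_hom[OF X]] F.path_compatible_closed[OF f] F.path_compatible_closed[OF g])
  next
    fix b s assume "b \<in> carrier (const_ring X B U)" "s \<in> carrier (sec (family_sheaf X F) U)"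
    then obtain f where s: "s = Family f" and f: "f \<in> path_compatible X F U"
      and b: "b \<in> locally_constant_on X U (carrier B)" by auto
    show "fmap U (b \<odot>\<^bsub>sec (family_sheaf X F) U\<^esub> s) = b \<odot>\<^bsub>sec (family_sheaf X G) U\<^esub> fmap U s"
      unfolding s fmap_apply[OF U f] F.fam_simps G.fam_simps univ.sel
        fmap_apply[OF U F.path_compatible_smult[OF U b f]] univ.inject
      by (rule restrict_ext)
        (simp add: module_hom_smult[OF component_module_hom[OF X]] F.path_compatible_closed[OF f] locally_constant_on_closed[OF b])
  qed (use U in simp)
next
  fix U V s assume U: "openin X U" "openin X V" "V \<subseteq> U" and "s \<in> carrier (sec (family_sheaf X F) U)"
  then obtain f where s: "s = Family f" and f: "f \<in> path_compatible X F U" by auto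
  show "res (family_sheaf X G) U V (fmap U s) = fmap V (res (family_sheaf X F) U V s)"
    unfolding s fmap_apply[OF U(1) f] F.fam_simps G.fam_simps univ.sel
      fmap_apply[OF U(2) F.path_compatible_restrict[OF f U(3)]] univ.inject
    using U(3) by (auto simp: fun_eq_iff)
qed simp

text \<open>This is the naturality of the counit in \<open>F\<close>.\<close>

lemma stalk_eval_stalk_map:
  assumes x: "x \<in> topspace X" and g: "g \<in> carrier (stalk X (family_sheaf X F) x)"
  shows "G.stalk_eval x (stalk_map X (family_sheaf X F) (family_sheaf X G) fmap x g) = \<eta> x (F.stalk_eval x g)"
proof -
  interpret m: presheaf_morphism X B "family_sheaf X F" "family_sheaf X G" fmap
    unfolding presheaf_morphism_def presheaf_morphism_axioms_def
    by (intro conjI F.fam_presheaf G.fam_presheaf fmap_sheaf_hom)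
  obtain U f where U: "openin X U" "x \<in> U" and f: "f \<in> path_compatible X F U"
    and gf: "g = germ X (family_sheaf X F) x U (Family f)" using g by (rule F.stalk_famE)
  have "stalk_map X (family_sheaf X F) (family_sheaf X G) fmap x g
    = germ X (family_sheaf X G) x U (Family (\<lambda>x\<in>U. \<eta> x (f x)))"
    unfolding gf fmap_apply[OF U(1) f, symmetric] by (rule m.stalk_map_germ[OF U]) (use f in simp)
  then show ?thesis
    using G.stalk_eval_germ[OF U fmap_compatible[OF U(1) f]] F.stalk_eval_germ[OF U f] U(2) by (simp add: gf)
qed

end

text \<open>It suffices to reach the category of all sheaf morphisms, since the source is a groupoid.\<close>

lemma Family_functor_functor:
  assumes B: "ring B" and lpc: "locally_path_connected_space X" and slsc: "semilocally_simply_connected X"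
  shows "is_functor (Fun_groupoid (fundamental_groupoid X) (core (Proj B)))
    (LCS X B :: (('a, 'b, ('a, 'c) univ) msheaf, _) category) (Family_functor X)"
  unfolding LCS_core
proof (rule functor_into_core)
  let ?P = "fundamental_groupoid X" and ?D = "core (Proj B :: (('b, ('a, 'c) univ) module, _) category)"
  show "is_groupoid (Fun_groupoid ?P ?D)" by (rule is_groupoid_Fun_groupoid[OF is_category_core_Proj])
  show "is_functor (Fun_groupoid ?P ?D) (local_systems X B) (Family_functor X)"
  proof (rule functorI)
    fix F assume "F \<in> Ob (Fun_groupoid ?P ?D)"
    then interpret F: path_representation X B F by (intro path_representationI[OF B]) simp
    show "on_ob (Family_functor X) F \<in> Ob (local_systems X B)"
      by (simp add: F.fam_local_system[OF lpc slsc])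
    have "Family (\<lambda>x\<in>U. (\<lambda>x\<in>topspace X. \<lambda>m\<in>carrier (F.fib x). m) x (members s x)) = s"
      if U: "openin X U" and sU: "s \<in> carrier (sec (family_sheaf X F) U)" for U s
    proof -
      obtain f where s: "s = Family f" and f: "f \<in> path_compatible X F U" using sU by auto
      have "(\<lambda>x\<in>U. (\<lambda>x\<in>topspace X. \<lambda>m\<in>carrier (F.fib x). m) x (f x)) = f"
        by (rule extensionalityI[OF restrict_extensional F.path_compatible_ext[OF f]])
          (use openin_subset[OF U] F.path_compatible_closed[OF f] in auto)
      then show ?thesis by (simp only: s univ.sel)
    qed
    then show "on_hom (Family_functor X) F F (Ident (Fun_groupoid ?P ?D) F)
        = Ident (local_systems X B) (on_ob (Family_functor X) F)"
      unfolding Family_functor_simps Fun_groupoid_simps local_systems_simps sheaf_id_def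
      by (intro restrict_ext) simp
  next
    fix F G \<eta> assume "F \<in> Ob (Fun_groupoid ?P ?D)" "G \<in> Ob (Fun_groupoid ?P ?D)" "\<eta> \<in> Hom (Fun_groupoid ?P ?D) F G"
    then interpret representation_morphism X B F G \<eta>
      unfolding representation_morphism_def representation_morphism_axioms_def
      by (auto intro: path_representationI[OF B])
    show "on_hom (Family_functor X) F G \<eta>
        \<in> Hom (local_systems X B) (on_ob (Family_functor X) F) (on_ob (Family_functor X) G)"
      unfolding local_systems_simps Family_functor_simps(1) by (rule fmap_sheaf_hom)
  next
    fix F G H \<eta> \<theta>
    assume *: "F \<in> Ob (Fun_groupoid ?P ?D)" "G \<in> Ob (Fun_groupoid ?P ?D)" "H \<in> Ob (Fun_groupoid ?P ?D)"
      "\<eta> \<in> Hom (Fun_groupoid ?P ?D) F G" "\<theta> \<in> Hom (Fun_groupoid ?P ?D) G H"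
    interpret \<eta>: representation_morphism X B F G \<eta>
      using * unfolding representation_morphism_def representation_morphism_axioms_def
      by (auto intro: path_representationI[OF B])
    interpret \<theta>: representation_morphism X B G H \<theta>
      using * unfolding representation_morphism_def representation_morphism_axioms_def
      by (auto intro: path_representationI[OF B])
    let ?\<theta>\<eta> = "Comp (Fun_groupoid ?P ?D) F G H \<theta> \<eta>"
    interpret \<theta>\<eta>: representation_morphism X B F H ?\<theta>\<eta>
      unfolding representation_morphism_def representation_morphism_axioms_def
    proof (intro conjI \<eta>.F.path_representation_axioms \<theta>.G.path_representation_axioms)
      show "is_nat_iso ?P ?D F H ?\<theta>\<eta>"
        unfolding Fun_groupoid_simps
        by (rule nat_iso_comp[OF is_category_core_Proj \<eta>.F.representation \<eta>.G.representation
              \<theta>.G.representation \<eta>.nat_iso \<theta>.nat_iso])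
    qed
    have eq: "\<theta>\<eta>.fmap U s = \<theta>.fmap U (\<eta>.fmap U s)"
      if U: "openin X U" and sU: "s \<in> carrier (sec (family_sheaf X F) U)" for U s
    proof -
      obtain f where s: "s = Family f" and f: "f \<in> path_compatible X F U" using sU by auto
      have "\<theta>.fmap U (\<eta>.fmap U s) = Family (\<lambda>x\<in>U. \<theta> x ((\<lambda>x\<in>U. \<eta> x (f x)) x))"
        unfolding s \<eta>.fmap_apply[OF U f] by (rule \<theta>.fmap_apply[OF U \<eta>.fmap_compatible[OF U f]])
      also have "(\<lambda>x\<in>U. \<theta> x ((\<lambda>x\<in>U. \<eta> x (f x)) x)) = (\<lambda>x\<in>U. ?\<theta>\<eta> x (f x))"
        by (rule restrict_ext)
          (use openin_subset[OF U] \<eta>.F.path_compatible_closed[OF f] in \<open>auto simp: compose_eq\<close>)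
      finally show ?thesis unfolding s \<theta>\<eta>.fmap_apply[OF U f] by (rule sym)
    qed
    have "\<theta>\<eta>.fmap = sheaf_comp X (family_sheaf X F) \<theta>.fmap \<eta>.fmap"
      by (rule sheaf_hom_eqI[OF \<theta>\<eta>.fmap_sheaf_hom module_presheaf.sheaf_comp_hom[OF \<eta>.F.fam_presheaf
              \<eta>.fmap_sheaf_hom \<theta>.fmap_sheaf_hom]])
        (simp only: sheaf_comp_apply eq)
    then show "on_hom (Family_functor X) F H ?\<theta>\<eta>
        = Comp (local_systems X B) (on_ob (Family_functor X) F) (on_ob (Family_functor X) G) (on_ob (Family_functor X) H)
            (on_hom (Family_functor X) G H \<theta>) (on_hom (Family_functor X) F G \<eta>)"
      unfolding local_systems_simps Family_functor_simps(1) .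
  qed
qed


section \<open>Unit and counit\<close>

text \<open>The component of the unit at \<open>E\<close>.\<close>

definition germ_families :: "'a topology \<Rightarrow> ('a, 'b, ('a, 'c) univ) msheaf \<Rightarrow>
    'a set \<Rightarrow> ('a, 'c) univ \<Rightarrow> ('a, 'c) univ" where
  "germ_families X E = (\<lambda>U\<in>{U. openin X U}. \<lambda>s\<in>carrier (sec E U). Family (\<lambda>x\<in>U. germ X E x U s))"

lemma germ_families_apply:
  "openin X U \<Longrightarrow> s \<in> carrier (sec E U) \<Longrightarrow> germ_families X E U s = Family (\<lambda>x\<in>U. germ X E x U s)"
  by (simp add: germ_families_def)

context local_system
begin

context
  assumes B: "ring B" and lpc: "locally_path_connected_space X"
begin

interpretation M: path_representation X B "Mon_ob X B E"
  by (rule path_representationI[OF B Mon_ob_functor])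

lemma germ_family_compatible:
  assumes U: "openin X U" and s: "s \<in> carrier (sec E U)"
  shows "(\<lambda>x\<in>U. germ X E x U s) \<in> path_compatible X (Mon_ob X B E) U"
proof (rule M.path_compatibleI)
  fix \<gamma> assume \<gamma>: "pathin (subtopology X U) \<gamma>"
  then have \<gamma>U: "\<gamma> z \<in> U" if "z \<in> {0..1}" for z using that by (simp add: pathin_subtopology)
  have "pathin X \<gamma>" using \<gamma> by (simp add: pathin_subtopology)
  then have "flat_along {0..1} \<gamma> (\<lambda>z. germ X E (\<gamma> z) U s)"
    unfolding pathin_def by (rule flat_along_section[OF _ U s \<gamma>U])
  from parallel_transport_flat[OF this]
  show "M.act \<gamma> ((\<lambda>x\<in>U. germ X E x U s) (\<gamma> 0)) = (\<lambda>x\<in>U. germ X E x U s) (\<gamma> 1)"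
    using \<gamma>U[of 0] \<gamma>U[of 1] by (simp add: M.act_def)
qed (simp_all add: germ_in_stalk[OF U _ s])

text \<open>A path-compatible family of germs is near each point given by one section, because transport
  inside a trivialising set follows the germs of a section. These sections glue.\<close>

lemma germ_family_of_section:
  assumes U: "openin X U" and f: "f \<in> path_compatible X (Mon_ob X B E) U"
  obtains s where "s \<in> carrier (sec E U)" "\<And>x. x \<in> U \<Longrightarrow> f x = germ X E x U s"
proof -
  \<comment> \<open>The sections \<open>t W\<close> need no compatible choice: a section is determined by its germs.\<close>
  define \<W> where "\<W> = {W. openin X W \<and> W \<subseteq> U \<and> (\<exists>t\<in>carrier (sec E W). \<forall>y\<in>W. f y = germ X E y W t)}"
  define t where "t W = (SOME t. t \<in> carrier (sec E W) \<and> (\<forall>y\<in>W. f y = germ X E y W t))" for W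
  have W: "openin X W" "W \<subseteq> U" if "W \<in> \<W>" for W using that by (simp_all add: \<W>_def)
  have "t W \<in> carrier (sec E W) \<and> (\<forall>y\<in>W. f y = germ X E y W (t W))" if "W \<in> \<W>" for W
    unfolding t_def by (rule someI_ex) (use that in \<open>auto simp: \<W>_def\<close>)
  then have tW: "t W \<in> carrier (sec E W)" "\<And>y. y \<in> W \<Longrightarrow> f y = germ X E y W (t W)" if "W \<in> \<W>" for W
    using that by blast+
  have "x \<in> \<Union>\<W>" if x: "x \<in> U" for x
  proof -
    have X: "x \<in> topspace X" using x openin_subset[OF U] by blast
    obtain V M \<phi> where V: "x \<in> V" "trivialised X B E V M \<phi>" by (rule trivialised_at[OF X])
    interpret V: trivialised X B E V M \<phi> by (rule V(2))
    have "f x \<in> carrier (stalk X E x)" using M.path_compatible_closed[OF f x] by simp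
    then obtain m r where r: "V.constant_section m r" "f x = germ X E x V r"
      by (rule V.germ_of_constant_section[OF V(1)])
    have rV: "r \<in> carrier (sec E V)" using r(1) by (simp add: V.constant_section_def)
    have "openin X (U \<inter> V)" "x \<in> U \<inter> V" using U V.openU x V(1) by auto
    then obtain W where W: "openin X W" "path_connectedin X W" "x \<in> W" "W \<subseteq> U \<inter> V"
      using lpc unfolding locally_path_connected_space by blast
    then have WV: "W \<subseteq> V" by blast
    have "f y = germ X E y W (res E V W r)" if y: "y \<in> W" for y
    proof -
      have "f y = (\<lambda>z\<in>V. germ X E z V r) y"
        by (rule M.path_compatible_eq_on[OF f germ_family_compatible[OF V.openU rV] W(2) _ WV W(3) y])
          (use W(4) V(1) r(2) in auto)
      then show ?thesis using germ_res[OF V.openU W(1) WV y rV] y WV by auto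
    qed
    then have "W \<in> \<W>" using W res_closed[OF V.openU W(1) WV rV] unfolding \<W>_def by blast
    then show ?thesis using W(3) by blast
  qed
  then have cover: "\<Union>\<W> = U" using W(2) by blast
  have "\<exists>!s. s \<in> carrier (sec E (\<Union>\<W>)) \<and> (\<forall>W\<in>\<W>. res E (\<Union>\<W>) W s = t W)"
  proof (rule sections_glue)
    fix V W assume VW: "V \<in> \<W>" "W \<in> \<W>"
    have o: "openin X (V \<inter> W)" using W VW by blast
    show "res E V (V \<inter> W) (t V) = res E W (V \<inter> W) (t W)"
    proof (rule section_eqI_germs[OF o])
      fix y assume y: "y \<in> V \<inter> W"
      then show "germ X E y (V \<inter> W) (res E V (V \<inter> W) (t V)) = germ X E y (V \<inter> W) (res E W (V \<inter> W) (t W))"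
        using germ_res[OF W(1)[OF VW(1)] o _ y tW(1)[OF VW(1)]] germ_res[OF W(1)[OF VW(2)] o _ y tW(1)[OF VW(2)]]
          tW(2)[OF VW(1), of y] tW(2)[OF VW(2), of y] by simp
    qed (use W VW o tW in \<open>auto intro: res_closed\<close>)
  qed (use W tW in auto)
  then obtain s where s: "s \<in> carrier (sec E U)" "\<And>W. W \<in> \<W> \<Longrightarrow> res E U W s = t W"
    unfolding cover by blast
  have "f x = germ X E x U s" if "x \<in> U" for x
  proof -
    obtain W' where W': "W' \<in> \<W>" "x \<in> W'" using \<open>x \<in> U\<close> cover by blast
    show ?thesis
      using germ_res[OF U W(1)[OF W'(1)] W(2)[OF W'(1)] W'(2) s(1)] s(2)[OF W'(1)] tW(2)[OF W'] by simp
  qed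
  with s(1) show ?thesis by (rule that)
qed

lemma germ_families_sheaf_iso:
  "germ_families X E \<in> sheaf_iso X B E (family_sheaf X (Mon_ob X B E))"
proof (rule sheaf_isoI)
  show "germ_families X E \<in> sheaf_hom X B E (family_sheaf X (Mon_ob X B E))"
  proof (rule sheaf_homI)
    fix U assume U: "openin X U"
    note ap = germ_families_apply[OF U]
    show "germ_families X E U \<in> module_hom (const_ring X B U) (sec E U) (sec (family_sheaf X (Mon_ob X B E)) U)"
    proof (rule module_homI)
      fix s assume s: "s \<in> carrier (sec E U)"
      show "germ_families X E U s \<in> carrier (sec (family_sheaf X (Mon_ob X B E)) U)"
        using germ_family_compatible[OF U s] by (simp add: ap[OF s])
      fix t assume t: "t \<in> carrier (sec E U)"
      show "germ_families X E U (s \<oplus>\<^bsub>sec E U\<^esub> t)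
        = germ_families X E U s \<oplus>\<^bsub>sec (family_sheaf X (Mon_ob X B E)) U\<^esub> germ_families X E U t"
        unfolding ap[OF s] ap[OF t] ap[OF sec_add_closed[OF U s t]] M.fam_simps univ.sel univ.inject
        by (rule restrict_ext) (simp add: germ_add[OF U _ s t])
    next
      fix b s assume "b \<in> carrier (const_ring X B U)" and s: "s \<in> carrier (sec E U)"
      then have b: "b \<in> locally_constant_on X U (carrier B)" by simp
      have "germ X E x U (b \<odot>\<^bsub>sec E U\<^esub> s) = b x \<odot>\<^bsub>stalk X E x\<^esub> germ X E x U s" if x: "x \<in> U" for x
      proof -
        obtain W where W: "openin X W" "x \<in> W" "W \<subseteq> U" "\<And>y. y \<in> W \<Longrightarrow> b y = b x"
          using locally_constant_onE[OF b x] by blast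
        have bx: "b x \<in> carrier B" by (rule locally_constant_on_closed[OF b x])
        have "restrict b W = (\<lambda>y\<in>W. b x)" by (rule restrict_ext) (rule W(4))
        then have "res E U W (b \<odot>\<^bsub>sec E U\<^esub> s) = (\<lambda>y\<in>W. b x) \<odot>\<^bsub>sec E W\<^esub> res E U W s"
          using res_smult[OF U W(1,3) b s] by simp
        then have "germ X E x U (b \<odot>\<^bsub>sec E U\<^esub> s) = germ X E x W ((\<lambda>y\<in>W. b x) \<odot>\<^bsub>sec E W\<^esub> res E U W s)"
          using germ_res[OF U W(1,3,2) sec_smult_closed[OF U b s]] by simp
        also have "\<dots> = b x \<odot>\<^bsub>stalk X E x\<^esub> germ X E x W (res E U W s)"
          by (rule germ_smult[OF W(1,2) res_closed[OF U W(1,3) s] bx, symmetric])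
        finally show ?thesis using germ_res[OF U W(1,3,2) s] by simp
      qed
      then show "germ_families X E U (b \<odot>\<^bsub>sec E U\<^esub> s)
        = b \<odot>\<^bsub>sec (family_sheaf X (Mon_ob X B E)) U\<^esub> germ_families X E U s"
        unfolding ap[OF s] ap[OF sec_smult_closed[OF U b s]] M.fam_simps univ.sel univ.inject
        by (intro restrict_ext) simp
    qed (simp add: germ_families_def U)
  next
    fix U V s assume U: "openin X U" "openin X V" "V \<subseteq> U" and s: "s \<in> carrier (sec E U)"
    show "res (family_sheaf X (Mon_ob X B E)) U V (germ_families X E U s) = germ_families X E V (res E U V s)"
      unfolding germ_families_apply[OF U(1) s] germ_families_apply[OF U(2) res_closed[OF U s]]
        M.fam_simps univ.sel univ.inject
      by (rule extensionalityI[where A = V]) (use U(3) germ_res[OF U _ s] in auto)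
  qed (simp add: germ_families_def)
  fix U assume U: "openin X U"
  show "bij_betw (germ_families X E U) (carrier (sec E U)) (carrier (sec (family_sheaf X (Mon_ob X B E)) U))"
    unfolding bij_betw_def
  proof
    show "inj_on (germ_families X E U) (carrier (sec E U))"
    proof (rule inj_onI)
      fix s t assume s: "s \<in> carrier (sec E U)" and t: "t \<in> carrier (sec E U)"
        and "germ_families X E U s = germ_families X E U t"
      then have eq: "(\<lambda>x\<in>U. germ X E x U s) = (\<lambda>x\<in>U. germ X E x U t)"
        by (simp add: germ_families_apply[OF U])
      show "s = t"
        by (rule section_eqI_germs[OF U s t]) (use fun_cong[OF eq] in \<open>metis restrict_apply'\<close>)
    qed
    show "germ_families X E U ` carrier (sec E U) = carrier (sec (family_sheaf X (Mon_ob X B E)) U)"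
    proof (intro equalityI subsetI)
      fix r assume "r \<in> germ_families X E U ` carrier (sec E U)"
      then show "r \<in> carrier (sec (family_sheaf X (Mon_ob X B E)) U)"
        using germ_family_compatible[OF U] by (auto simp: germ_families_apply[OF U])
    next
      fix r assume "r \<in> carrier (sec (family_sheaf X (Mon_ob X B E)) U)"
      then obtain f where r: "r = Family f" and f: "f \<in> path_compatible X (Mon_ob X B E) U" by auto
      obtain s where s: "s \<in> carrier (sec E U)" "\<And>x. x \<in> U \<Longrightarrow> f x = germ X E x U s"
        by (rule germ_family_of_section[OF U f]) blast
      have "f = (\<lambda>x\<in>U. germ X E x U s)"
        by (rule extensionalityI[OF M.path_compatible_ext[OF f] restrict_extensional]) (simp add: s(2))
      then have "r = germ_families X E U s" by (simp add: r germ_families_apply[OF U s(1)])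
      then show "r \<in> germ_families X E U ` carrier (sec E U)" using s(1) by blast
    qed
  qed
qed

end

end

lemma unit_nat_iso:
  assumes B: "ring B" and lpc: "locally_path_connected_space X"
  shows "is_nat_iso (LCS X B) (LCS X B :: (('a, 'b, ('a, 'c) univ) msheaf, _) category)
    id_functor (comp_functor (Family_functor X) (Mon X B)) (\<lambda>E\<in>Ob (LCS X B). germ_families X E)"
proof (rule nat_isoI)
  fix E :: "('a, 'b, ('a, 'c) univ) msheaf" assume E: "E \<in> Ob (LCS X B)"
  then have "local_system X B E" by (simp add: LCS_core)
  then have "germ_families X E \<in> sheaf_iso X B E (family_sheaf X (Mon_ob X B E))"
    using B lpc by (rule local_system.germ_families_sheaf_iso)
  then show "is_iso (LCS X B) (on_ob id_functor E) (on_ob (comp_functor (Family_functor X) (Mon X B)) E)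
      ((\<lambda>E\<in>Ob (LCS X B). germ_families X E) E)"
    using E by (simp add: LCS_core is_iso_core is_iso_local_systems id_functor_def comp_functor_def)
next
  fix E E' :: "('a, 'b, ('a, 'c) univ) msheaf" and \<phi>
  assume E: "E \<in> Ob (LCS X B)" and E': "E' \<in> Ob (LCS X B)" and "\<phi> \<in> Hom (LCS X B) E E'"
  then have iso: "\<phi> \<in> sheaf_iso X B E E'" by (simp add: LCS_core is_iso_local_systems)
  interpret E: local_system X B E using E by (simp add: LCS_core)
  interpret E': local_system X B E' using E' by (simp add: LCS_core)
  interpret \<phi>: presheaf_morphism X B E E' \<phi> by unfold_locales (use iso in \<open>simp add: sheaf_iso_def\<close>)
  let ?\<eta> = "\<lambda>x\<in>topspace X. stalk_map X E E' \<phi> x"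
  interpret M: representation_morphism X B "Mon_ob X B E" "Mon_ob X B E'" ?\<eta>
    unfolding representation_morphism_def representation_morphism_axioms_def
    by (intro conjI path_representationI[OF B] E.Mon_ob_functor E'.Mon_ob_functor
        stalk_map_nat_iso E.local_system_axioms E'.local_system_axioms iso)
  have "germ_families X E' U (\<phi> U s) = M.fmap U (germ_families X E U s)"
    if U: "openin X U" and s: "s \<in> carrier (sec E U)" for U s
  proof -
    have "M.fmap U (germ_families X E U s) = Family (\<lambda>x\<in>U. ?\<eta> x ((\<lambda>x\<in>U. germ X E x U s) x))"
      unfolding germ_families_apply[OF U s]
      by (rule M.fmap_apply[OF U E.germ_family_compatible[OF B lpc U s]])
    also have "(\<lambda>x\<in>U. ?\<eta> x ((\<lambda>x\<in>U. germ X E x U s) x)) = (\<lambda>x\<in>U. germ X E' x U (\<phi> U s))"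
      by (rule restrict_ext) (use openin_subset[OF U] \<phi>.stalk_map_germ[OF U _ s] in auto)
    finally show ?thesis by (simp only: germ_families_apply[OF U \<phi>.hom_closed[OF U s]])
  qed
  then have "sheaf_comp X E (germ_families X E') \<phi> = sheaf_comp X E M.fmap (germ_families X E)"
    unfolding sheaf_comp_def compose_def by (intro restrict_ext) simp
  then show "Comp (LCS X B) (on_ob id_functor E) (on_ob id_functor E')
      (on_ob (comp_functor (Family_functor X) (Mon X B)) E')
      ((\<lambda>E\<in>Ob (LCS X B). germ_families X E) E') (on_hom id_functor E E' \<phi>)
    = Comp (LCS X B) (on_ob id_functor E) (on_ob (comp_functor (Family_functor X) (Mon X B)) E)
      (on_ob (comp_functor (Family_functor X) (Mon X B)) E')
      (on_hom (comp_functor (Family_functor X) (Mon X B)) E E' \<phi>) ((\<lambda>E\<in>Ob (LCS X B). germ_families X E) E)"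
    using E E' by (simp add: LCS_core id_functor_def comp_functor_def del: Family_functor_simps(2))
qed simp

text \<open>A morphism of the groupoid of functors is invertible, so naturality of the evaluation maps in
  the point (\<open>stalk_eval_nat_iso\<close>) and in \<open>F\<close> (\<open>stalk_eval_stalk_map\<close>) is all that is needed.\<close>

lemma counit_nat_iso:
  assumes B: "ring B" and lpc: "locally_path_connected_space X" and slsc: "semilocally_simply_connected X"
  defines "D \<equiv> Fun_groupoid (fundamental_groupoid X) (core (Proj B :: (('b, ('a, 'c) univ) module, _) category))"
  shows "is_nat_iso D D (comp_functor (Mon X B) (Family_functor X)) id_functor
    (\<lambda>F\<in>Ob D. \<lambda>x\<in>topspace X. path_representation.stalk_eval X F x)"
proof (rule nat_isoI)
  have rep: "path_representation X B F" if "F \<in> Ob D" for F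
    using that by (intro path_representationI[OF B]) (simp add: D_def)
  have D: "is_groupoid D"
    unfolding D_def by (rule is_groupoid_Fun_groupoid[OF is_category_core_Proj])
  {
    fix F assume F: "F \<in> Ob D"
    interpret F: path_representation X B F by (rule rep[OF F])
    have M: "Mon_ob X B (family_sheaf X F) \<in> Ob D"
      unfolding D_def by (simp add: local_system.Mon_ob_functor[OF F.fam_local_system[OF lpc slsc]])
    have "(\<lambda>x\<in>topspace X. F.stalk_eval x) \<in> Hom D (Mon_ob X B (family_sheaf X F)) F"
      unfolding D_def using F.stalk_eval_nat_iso[OF lpc slsc] by simp
    then have "is_iso D (Mon_ob X B (family_sheaf X F)) F (\<lambda>x\<in>topspace X. F.stalk_eval x)"
      using D M F by (simp add: is_groupoid_def)
    then show "is_iso D (on_ob (comp_functor (Mon X B) (Family_functor X)) F) (on_ob id_functor F)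
        ((\<lambda>F\<in>Ob D. \<lambda>x\<in>topspace X. path_representation.stalk_eval X F x) F)"
      using F by (simp add: comp_functor_def id_functor_def)
  }
  fix F G \<eta> assume F: "F \<in> Ob D" and G: "G \<in> Ob D" and "\<eta> \<in> Hom D F G"
  then interpret m: representation_morphism X B F G \<eta>
    unfolding representation_morphism_def representation_morphism_axioms_def
    by (intro conjI rep) (simp_all add: D_def)
  have "(\<lambda>x\<in>topspace X. compose (carrier (stalk X (family_sheaf X F) x)) (m.G.stalk_eval x)
        (stalk_map X (family_sheaf X F) (family_sheaf X G) m.fmap x))
      = (\<lambda>x\<in>topspace X. compose (carrier (stalk X (family_sheaf X F) x)) (\<eta> x) (m.F.stalk_eval x))"
    unfolding compose_def by (intro restrict_ext) (rule m.stalk_eval_stalk_map)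
  then show "Comp D (on_ob (comp_functor (Mon X B) (Family_functor X)) F)
      (on_ob (comp_functor (Mon X B) (Family_functor X)) G) (on_ob id_functor G)
      ((\<lambda>F\<in>Ob D. \<lambda>x\<in>topspace X. path_representation.stalk_eval X F x) G)
      (on_hom (comp_functor (Mon X B) (Family_functor X)) F G \<eta>)
    = Comp D (on_ob (comp_functor (Mon X B) (Family_functor X)) F) (on_ob id_functor F) (on_ob id_functor G)
      (on_hom id_functor F G \<eta>) ((\<lambda>F\<in>Ob D. \<lambda>x\<in>topspace X. path_representation.stalk_eval X F x) F)"
    using F G by (simp add: D_def comp_functor_def id_functor_def del: Family_functor_simps(2) cong: restrict_cong)
qed simp

theorem theorem78:
  fixes X :: "'a topology"
    and K :: "('k, 'x) ring_scheme"
    and B :: "('k, 'b, 'y) module_scheme"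
  assumes "locally_path_connected_space X"
    and "semilocally_simply_connected X"
    and "unital_algebra K B"
    and "char_zero K"
  shows "groupoid_equivalence
           (LCS X B :: (('a, 'b, ('a, 'c) univ) msheaf, _) category)
           (Fun_groupoid (fundamental_groupoid X) (core (Proj B)))
           (Mon X B) (Family_functor X)
    \<and> (\<forall>F \<in> Ob (Fun_groupoid (fundamental_groupoid X)
                    (core (Proj B :: (('b, ('a, 'c) univ) module, _) category))).
         \<forall>U. openin X U \<and> path_connectedin X U \<and> loops_nullhomotopic_in X U \<longrightarrow>
           (\<forall>x\<in>U. evaluation_at (on_ob (Family_functor X) F) U x
              \<in> module_iso B (constant_scalars U (sec (on_ob (Family_functor X) F) U)) (on_ob F x)))"
proof (intro conjI ballI allI impI)
  have B: "ring B" using assms(3) by (simp add: unital_algebra_def)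
  show "groupoid_equivalence
           (LCS X B :: (('a, 'b, ('a, 'c) univ) msheaf, _) category)
           (Fun_groupoid (fundamental_groupoid X) (core (Proj B)))
           (Mon X B) (Family_functor X)"
    unfolding groupoid_equivalence_def
  proof (intro conjI exI)
    show "is_groupoid (LCS X B :: (('a, 'b, ('a, 'c) univ) msheaf, _) category)"
      unfolding LCS_core by (rule is_groupoid_core[OF is_category_local_systems])
    show "is_groupoid (Fun_groupoid (fundamental_groupoid X)
        (core (Proj B :: (('b, ('a, 'c) univ) module, _) category)))"
      by (rule is_groupoid_Fun_groupoid[OF is_category_core_Proj])
    show "is_functor (LCS X B :: (('a, 'b, ('a, 'c) univ) msheaf, _) category)
        (Fun_groupoid (fundamental_groupoid X) (core (Proj B))) (Mon X B)"
      by (rule Mon_functor)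
    show "is_functor (Fun_groupoid (fundamental_groupoid X) (core (Proj B)))
        (LCS X B :: (('a, 'b, ('a, 'c) univ) msheaf, _) category) (Family_functor X)"
      by (rule Family_functor_functor[OF B assms(1,2)])
  qed (rule unit_nat_iso[OF B assms(1)], rule counit_nat_iso[OF B assms(1,2)])
  fix F :: "('a, (real \<Rightarrow> 'a) set, ('b, ('a, 'c) univ) module, ('a, 'c) univ \<Rightarrow> ('a, 'c) univ) cfunctor"
    and U x
  assume "F \<in> Ob (Fun_groupoid (fundamental_groupoid X) (core (Proj B)))"
    and U: "openin X U \<and> path_connectedin X U \<and> loops_nullhomotopic_in X U" and x: "x \<in> U"
  then interpret F: path_representation X B F by (intro path_representationI[OF B]) simp
  show "evaluation_at (on_ob (Family_functor X) F) U x
      \<in> module_iso B (constant_scalars U (sec (on_ob (Family_functor X) F) U)) (on_ob F x)"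
    using F.evaluation_at_module_iso U x by simp
qed

end
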